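(* For $n\geq 3$ the pure braid group $P_n$ is a semi-direct product of free groups $$P_n=V_1\leftthreetimes(V_2\leftthreetimes(\ldots(V_{n-2}\leftthreetimes V_{n-1})\ldots)),$$ where $$V_{n-1}=\langle c_{n-1,1}\rangle,\quad V_{n-2}=\langle c_{n-2,1},c_{n-2,2}\rangle,\quad\ldots,\quad V_1=\langle c_{11},c_{12},\ldots,c_{1,n-1}\rangle,$$ that is, $V_k=\langle c_{k,1},c_{k,2},\dots,c_{k,n-k}\rangle$ for $1\le k\le n-1$.
   Context: The notation $A\leftthreetimes B$ means the (internal) semi-direct product with $A$ normal and $B$ a complement acting on it by conjugation. The virtual braid group $VB_n$ is generated by $\sigma_1,\dots,\sigma_{n-1},\rho_1,\dots,\rho_{n-1}$ subject to the braid relations for the $\sigma_i$, the Coxeter relations of $S_n$ for the $\rho_i$ (with $\rho_i^2=1$), $\sigma_i\rho_j=\rho_j\sigma_i$ for $|i-j|>1$, and $\rho_i\rho_{i+1}\sigma_i=\sigma_{i+1}\rho_i\rho_{i+1}$. The $\sigma_i$ generate the classical braid group $B_n\le VB_n$. $VP_n$ is the kernel of $VB_n\to S_n$, $\sigma_i,\rho_i\mapsto\rho_i$, and the Artin pure braid group is $P_n=B_n\cap VP_n$. In $VP_n$ set $\lambda_{i,i+1}=\rho_i\sigma_i^{-1}$, $\lambda_{i+1,i}=\sigma_i^{-1}\rho_i$ and, for $i<j-1$, $\lambda_{ij}=\rho_{j-1}\cdots\rho_{i+1}\lambda_{i,i+1}\rho_{i+1}\cdots\rho_{j-1}$, $\lambda_{ji}=\rho_{j-1}\cdots\rho_{i+1}\lambda_{i+1,i}\rho_{i+1}\cdots\rho_{j-1}$;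 these generate $VP_n$. $VP_m\le VP_n$ for $m\le n$ by adding trivial strands at the end. The degeneracy homomorphism $s_{i-1}\colon VP_n\to VP_{n+1}$, $1\le i\le n$ (doubling the $i$-th strand) is given, for $k<l$, by: $s_{i-1}(\lambda_{k,l})=\lambda_{k+1,l+1}$ if $i<k$; $\lambda_{k,l+1}\lambda_{k+1,l+1}$ if $i=k$; $\lambda_{k,l+1}$ if $k<i<l$; $\lambda_{k,l+1}\lambda_{k,l}$ if $i=l$; $\lambda_{k,l}$ if $i>l$; $s_{i-1}(\lambda_{l,k})=\lambda_{l+1,k+1}$ if $i<k$; $\lambda_{l+1,k+1}\lambda_{l+1,k}$ if $i=k$; $\lambda_{l+1,k}$ if $k<i<l$; $\lambda_{l,k}\lambda_{l+1,k}$ if $i=l$; $\lambda_{l,k}$ if $i>l$. Cabled generators: $a_{i,j},b_{i,j}\in VP_{i+j}$ ($i,j\ge1$) are obtained from $\lambda_{12}$, respectively $\lambda_{21}$, by taking $i$-cabling of the first strand and $j$-cabling of the second strand: $a_{1,1}=\lambda_{12}$, $b_{1,1}=\lambda_{21}$, $a_{i+1,j}=s_0(a_{i,j})$, $a_{i,j+1}=s_{i+j-1}(a_{i,j})$, and likewise for $b$. Put $c_{i,j}=b_{i,j}a_{i,j}$ (also written $c_{ij}$); these elements lie in $P_{i+j}$, and $c_{11}=\sigma_1^{-2}$. *)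

theory Defs
  imports "HOL-Algebra.Sym_Groups" "HOL-Algebra.Generated_Groups"
begin

section \<open>Groups given by generators and relations\<close>

text \<open>A word is a list of letters; the letter \<open>(x, True)\<close> stands for \<open>x\<close> and \<open>(x, False)\<close> for its
  inverse. A relation is a pair of words, read as an equation.\<close>

type_synonym 'g word = "('g \<times> bool) list"

inductive word_eq :: "'g set \<Rightarrow> ('g word \<times> 'g word) set \<Rightarrow> 'g word \<Rightarrow> 'g word \<Rightarrow> bool"
  for X R where
  refl: "w \<in> lists (X \<times> UNIV) \<Longrightarrow> word_eq X R w w"
| sym: "word_eq X R u v \<Longrightarrow> word_eq X R v u"
| trans: "word_eq X R u v \<Longrightarrow> word_eq X R v w \<Longrightarrow> word_eq X R u w"
| cong: "word_eq X R u u' \<Longrightarrow> word_eq X R v v' \<Longrightarrow> word_eq X R (u @ v) (u' @ v')"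
| cancel: "x \<in> X \<Longrightarrow> word_eq X R [(x, b), (x, \<not> b)] []"
| rel: "(u, v) \<in> R \<Longrightarrow> u \<in> lists (X \<times> UNIV) \<Longrightarrow> v \<in> lists (X \<times> UNIV) \<Longrightarrow> word_eq X R u v"

definition presented_group :: "'g set \<Rightarrow> ('g word \<times> 'g word) set \<Rightarrow> 'g word set monoid" where
  "presented_group X R =
     \<lparr>carrier = lists (X \<times> UNIV) // {(u, v). word_eq X R u v},
      mult = (\<lambda>A B. {w. \<exists>u\<in>A. \<exists>v\<in>B. word_eq X R (u @ v) w}),
      one = {w. word_eq X R [] w}\<rparr>"

definition gen_class :: "'g set \<Rightarrow> ('g word \<times> 'g word) set \<Rightarrow> 'g \<Rightarrow> 'g word set" where
  "gen_class X R x = {w. word_eq X R [(x, True)] w}"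

definition list_prod :: "('a, 'b) monoid_scheme \<Rightarrow> 'a list \<Rightarrow> 'a" where
  "list_prod G xs = foldr (mult G) xs \<one>\<^bsub>G\<^esub>"

definition eval_word :: "('a, 'b) monoid_scheme \<Rightarrow> ('g \<Rightarrow> 'a) \<Rightarrow> 'g word \<Rightarrow> 'a" where
  "eval_word G f w = list_prod G (map (\<lambda>(x, b). if b then f x else inv\<^bsub>G\<^esub> (f x)) w)"

text \<open>The homomorphism from a presented group to \<open>G\<close> induced by an assignment \<open>f\<close> of its generators:
  if \<open>f\<close> respects the relations, then evaluation is constant on each class.\<close>

definition induced_hom :: "('a, 'b) monoid_scheme \<Rightarrow> ('g \<Rightarrow> 'a) \<Rightarrow> 'g word set \<Rightarrow> 'a" where
  "induced_hom G f A = the_elem (eval_word G f ` A)"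

text \<open>The free group on \<open>I\<close> is the group presented by \<open>I\<close> without relations. The family
  \<open>(x i)\<^bsub>i \<in> I\<^esub>\<close> is a free basis of \<open>G\<close> if it induces an isomorphism from it onto \<open>G\<close>.\<close>

definition free_basis :: "('a, 'b) monoid_scheme \<Rightarrow> 'i set \<Rightarrow> ('i \<Rightarrow> 'a) \<Rightarrow> bool" where
  "free_basis G I x \<longleftrightarrow> induced_hom G x \<in> iso (presented_group I {}) G"

section \<open>Internal semi-direct products\<close>

definition internal_semidirect ::
  "('a, 'b) monoid_scheme \<Rightarrow> 'a set \<Rightarrow> 'a set \<Rightarrow> 'a set \<Rightarrow> bool" where
  "internal_semidirect G W A B \<longleftrightarrow>
     subgroup W G \<and> A \<lhd> (G\<lparr>carrier := W\<rparr>) \<and> subgroup B (G\<lparr>carrier := W\<rparr>) \<and>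
     A \<inter> B = {\<one>\<^bsub>G\<^esub>} \<and> A <#>\<^bsub>G\<^esub> B = W"

text \<open>\<open>iterated_semidirect G [A\<^sub>1, \<dots>, A\<^sub>m] W\<close> says that \<open>W\<close> is the product bracketed to the right, with
  \<open>A\<^sub>1\<close> normal in \<open>W\<close> and complemented by the product of \<open>[A\<^sub>2, \<dots>, A\<^sub>m]\<close>.\<close>

fun iterated_semidirect :: "('a, 'b) monoid_scheme \<Rightarrow> 'a set list \<Rightarrow> 'a set \<Rightarrow> bool" where
  "iterated_semidirect G [] W \<longleftrightarrow> W = {\<one>\<^bsub>G\<^esub>}"
| "iterated_semidirect G [A] W \<longleftrightarrow> subgroup A G \<and> W = A"
| "iterated_semidirect G (A # A' # As) W \<longleftrightarrow>
     (\<exists>B. internal_semidirect G W A B \<and> iterated_semidirect G (A' # As) B)"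

section \<open>Virtual braid groups\<close>

datatype vb_gen = Sigma nat | Rho nat

definition vb_gens :: "nat \<Rightarrow> vb_gen set" where
  "vb_gens n = Sigma ` {1..<n} \<union> Rho ` {1..<n}"

abbreviation pos_word :: "'g list \<Rightarrow> 'g word" where
  "pos_word xs \<equiv> map (\<lambda>x. (x, True)) xs"

definition vb_rels :: "nat \<Rightarrow> (vb_gen word \<times> vb_gen word) set" where
  "vb_rels n =
     {(pos_word [Sigma i, Sigma j], pos_word [Sigma j, Sigma i]) | i j.
        i \<in> {1..<n} \<and> j \<in> {1..<n} \<and> (i + 1 < j \<or> j + 1 < i)} \<union>
     {(pos_word [Sigma i, Sigma (i + 1), Sigma i],
       pos_word [Sigma (i + 1), Sigma i, Sigma (i + 1)]) | i. 1 \<le> i \<and> i + 1 < n} \<union>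
     {(pos_word [Rho i, Rho j], pos_word [Rho j, Rho i]) | i j.
        i \<in> {1..<n} \<and> j \<in> {1..<n} \<and> (i + 1 < j \<or> j + 1 < i)} \<union>
     {(pos_word [Rho i, Rho (i + 1), Rho i],
       pos_word [Rho (i + 1), Rho i, Rho (i + 1)]) | i. 1 \<le> i \<and> i + 1 < n} \<union>
     {(pos_word [Rho i, Rho i], []) | i. i \<in> {1..<n}} \<union>
     {(pos_word [Sigma i, Rho j], pos_word [Rho j, Sigma i]) | i j.
        i \<in> {1..<n} \<and> j \<in> {1..<n} \<and> (i + 1 < j \<or> j + 1 < i)} \<union>
     {(pos_word [Rho i, Rho (i + 1), Sigma i],
       pos_word [Sigma (i + 1), Rho i, Rho (i + 1)]) | i. 1 \<le> i \<and> i + 1 < n}"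

definition VB :: "nat \<Rightarrow> vb_gen word set monoid" where
  "VB n = presented_group (vb_gens n) (vb_rels n)"

definition vb_class :: "nat \<Rightarrow> vb_gen \<Rightarrow> vb_gen word set" where
  "vb_class n = gen_class (vb_gens n) (vb_rels n)"

definition sigma :: "nat \<Rightarrow> nat \<Rightarrow> vb_gen word set" where
  "sigma n i = vb_class n (Sigma i)"

definition rho :: "nat \<Rightarrow> nat \<Rightarrow> vb_gen word set" where
  "rho n i = vb_class n (Rho i)"

fun gen_perm :: "vb_gen \<Rightarrow> nat \<Rightarrow> nat" where
  "gen_perm (Sigma i) = transpose i (i + 1)"
| "gen_perm (Rho i) = transpose i (i + 1)"

definition vb_perm :: "nat \<Rightarrow> vb_gen word set \<Rightarrow> nat \<Rightarrow> nat" where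
  "vb_perm n = induced_hom (sym_group n) gen_perm"

definition VP :: "nat \<Rightarrow> vb_gen word set set" where
  "VP n = kernel (VB n) (sym_group n) (vb_perm n)"

abbreviation VP_group :: "nat \<Rightarrow> vb_gen word set monoid" where
  "VP_group n \<equiv> (VB n)\<lparr>carrier := VP n\<rparr>"

definition classical_braids :: "nat \<Rightarrow> vb_gen word set set" where
  "classical_braids n = generate (VB n) (sigma n ` {1..<n})"

definition pure_braids :: "nat \<Rightarrow> vb_gen word set set" where
  "pure_braids n = classical_braids n \<inter> VP n"

text \<open>The map \<open>VB m \<rightarrow> VB n\<close>, \<open>m \<le> n\<close>, adding trivial strands at the end: each generator goes to the
  generator of the same name. The index \<open>m\<close> is implicit in the argument.\<close>

definition vb_incl :: "nat \<Rightarrow> vb_gen word set \<Rightarrow> vb_gen word set" where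
  "vb_incl n = induced_hom (VB n) (vb_class n)"

text \<open>The generators of \<open>VP n\<close>: for \<open>i < j\<close>, \<open>lam n i j\<close> is \<open>\<rho>\<^sub>i \<sigma>\<^sub>i\<inverse>\<close> and \<open>lam n j i\<close> is \<open>\<sigma>\<^sub>i\<inverse> \<rho>\<^sub>i\<close>,
  both conjugated by \<open>\<rho>\<^bsub>j-1\<^esub> \<cdots> \<rho>\<^bsub>i+1\<^esub>\<close> (an empty product if \<open>j = i + 1\<close>).\<close>

definition rho_conj :: "nat \<Rightarrow> nat \<Rightarrow> nat \<Rightarrow> vb_gen word set \<Rightarrow> vb_gen word set" where
  "rho_conj n i j g =
     list_prod (VB n) (map (rho n) (rev [i + 1..<j])) \<otimes>\<^bsub>VB n\<^esub> g
       \<otimes>\<^bsub>VB n\<^esub> list_prod (VB n) (map (rho n) [i + 1..<j])"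

definition lam :: "nat \<Rightarrow> nat \<Rightarrow> nat \<Rightarrow> vb_gen word set" where
  "lam n i j =
     (if i < j then rho_conj n i j (rho n i \<otimes>\<^bsub>VB n\<^esub> inv\<^bsub>VB n\<^esub> (sigma n i))
      else rho_conj n j i (inv\<^bsub>VB n\<^esub> (sigma n j) \<otimes>\<^bsub>VB n\<^esub> rho n j))"

section \<open>Strand doubling and cabled generators\<close>

definition doubles_strand ::
  "nat \<Rightarrow> nat \<Rightarrow> (vb_gen word set \<Rightarrow> vb_gen word set) \<Rightarrow> bool" where
  "doubles_strand n i s \<longleftrightarrow>
     s \<in> hom (VP_group n) (VP_group (n + 1)) \<and>
     (\<forall>k l. 1 \<le> k \<and> k < l \<and> l \<le> n \<longrightarrow>
        s (lam n k l) =
          (if i < k then lam (n + 1) (k + 1) (l + 1)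
           else if i = k then lam (n + 1) k (l + 1) \<otimes>\<^bsub>VB (n + 1)\<^esub> lam (n + 1) (k + 1) (l + 1)
           else if i < l then lam (n + 1) k (l + 1)
           else if i = l then lam (n + 1) k (l + 1) \<otimes>\<^bsub>VB (n + 1)\<^esub> lam (n + 1) k l
           else lam (n + 1) k l) \<and>
        s (lam n l k) =
          (if i < k then lam (n + 1) (l + 1) (k + 1)
           else if i = k then lam (n + 1) (l + 1) (k + 1) \<otimes>\<^bsub>VB (n + 1)\<^esub> lam (n + 1) (l + 1) k
           else if i < l then lam (n + 1) (l + 1) k
           else if i = l then lam (n + 1) l k \<otimes>\<^bsub>VB (n + 1)\<^esub> lam (n + 1) (l + 1) k
           else lam (n + 1) l k))"

text \<open>\<open>degeneracy n r\<close> is \<open>s\<^sub>r : VP n \<rightarrow> VP (n + 1)\<close> for \<open>r < n\<close>; it doubles strand \<open>r + 1\<close>. As the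
  \<open>lam n k l\<close> generate \<open>VP n\<close>, the choice is unique on \<open>VP n\<close>.\<close>

definition degeneracy :: "nat \<Rightarrow> nat \<Rightarrow> vb_gen word set \<Rightarrow> vb_gen word set" where
  "degeneracy n r = (SOME s. doubles_strand n (r + 1) s)"

text \<open>\<open>cabled g i j\<close>, for \<open>g\<close> in \<open>VP 2\<close> and \<open>i, j \<ge> 1\<close>, lies in \<open>VP (i + j)\<close>. The first strand is cabled
  first; the simplicial identities make the order irrelevant. Values at \<open>i = 0\<close> or \<open>j = 0\<close> are junk.\<close>

fun cabled :: "vb_gen word set \<Rightarrow> nat \<Rightarrow> nat \<Rightarrow> vb_gen word set" where
  "cabled g i (Suc (Suc j)) = degeneracy (i + Suc j) (i + Suc j - 1) (cabled g i (Suc j))"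
| "cabled g (Suc (Suc i)) j = degeneracy (Suc i + j) 0 (cabled g (Suc i) j)"
| "cabled g i j = g"

definition cable_a :: "nat \<Rightarrow> nat \<Rightarrow> vb_gen word set" where
  "cable_a = cabled (lam 2 1 2)"

definition cable_b :: "nat \<Rightarrow> nat \<Rightarrow> vb_gen word set" where
  "cable_b = cabled (lam 2 2 1)"

definition cable_c :: "nat \<Rightarrow> nat \<Rightarrow> vb_gen word set" where
  "cable_c i j = cable_b i j \<otimes>\<^bsub>VB (i + j)\<^esub> cable_a i j"

definition cable_c_in :: "nat \<Rightarrow> nat \<Rightarrow> nat \<Rightarrow> vb_gen word set" where
  "cable_c_in n k l = vb_incl n (cable_c k l)"

definition V :: "nat \<Rightarrow> nat \<Rightarrow> vb_gen word set set" where
  "V n k = generate (VB n) (cable_c_in n k ` {1..n - k})"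

end

theory Submission
  imports Defs
begin

text \<open>Deleting the first of \<open>n + 1\<close> strands maps \<open>P\<^bsub>n+1\<^esub>\<close> onto \<open>P\<^sub>n\<close>. The kernel consists of the motions of the
  first strand round the others and is free on the elements \<open>c\<^bsub>1,1\<^esub>, \<dots>, c\<^bsub>1,n\<^esub>\<close>, where \<open>c\<^bsub>1,j\<^esub>\<close> is the inverse of the
  loop of strand \<open>1\<close> round the strands \<open>2, \<dots>, j + 1\<close>. Doubling the first strand is a section of this map,
  because deleting one of the two copies undoes it. Thus \<open>P\<^bsub>n+1\<^esub>\<close> is the semi-direct product of \<open>V\<^sub>1\<close> and
  \<open>s\<^sub>0 P\<^sub>n\<close>. Since \<open>s\<^sub>0 c\<^bsub>k,j\<^esub> = c\<^bsub>k+1,j\<^esub>\<close>, the map \<open>s\<^sub>0\<close> carries the decomposition of \<open>P\<^sub>n\<close> into \<open>V\<^sub>1, V\<^sub>2, \<dots>\<close>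
  to one of \<open>s\<^sub>0 P\<^sub>n\<close> into \<open>V\<^sub>2, V\<^sub>3, \<dots>\<close>, and the theorem follows by induction on \<open>n\<close>.

  Doubling and deleting are defined on all virtual braids, letter by letter along a word, while the position of
  the chosen strand is followed. They are not homomorphisms there, but become so on pure braids, and only the defining
  relations of the virtual braid group have to be checked. This also shows that the degeneracy
  maps exist. A chosen degeneracy map agrees with doubling on the subgroup generated by the \<open>\<lambda>\<^bsub>kl\<^esub>\<close> (\<open>doubles_strand_lam_group\<close>), which contains the cables.

  That the loops generate the kernel is a coset enumeration (\<open>braid_factored\<close>): the products of loops with braids of the
  strands \<open>2, \<dots>, n + 1\<close> form a subgroup whose cosets by \<open>\<sigma>\<^sub>1 \<cdots> \<sigma>\<^sub>j\<close> are permuted by the generators. That the loops are free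
  (\<open>loops_free\<close>) follows from an action of virtual braids on colourings of the strands by elements of a free
  group, a set-theoretic form of Artin's representation, in which the first strand records the colours of the strands
  under which it passes.

  The calculations take place in a group on infinitely many strands, a type of class \<open>mgroup\<close>, into which
  each \<open>VB n\<close> embeds because superfluous strands can be deleted (\<open>stable_eq_restrict\<close>).\<close>

section \<open>Groups as a type class\<close>

text \<open>Calculations with braid words are long; a type class of groups, written multiplicatively, lets the
  simplifier carry them out without membership conditions.\<close>

class mgroup = monoid_mult +
  fixes ginv :: "'a \<Rightarrow> 'a"
  assumes ginv_left [simp]: "ginv a * a = 1"
begin

lemma ginv_left_cancel [simp]: "ginv a * (a * b) = b"
  by (simp flip: mult.assoc)

lemma ginv_unique: "a * b = 1 \<Longrightarrow> ginv a = b"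
  by (metis ginv_left_cancel mult_1_right)

lemma ginv_ginv [simp]: "ginv (ginv a) = a"
  by (simp add: ginv_unique)

lemma ginv_right [simp]: "a * ginv a = 1"
  using ginv_left [of "ginv a"] by simp

lemma ginv_right_cancel [simp]: "a * (ginv a * b) = b"
  by (simp flip: mult.assoc)

lemma ginv_one [simp]: "ginv 1 = 1"
  by (simp add: ginv_unique)

lemma ginv_mult: "ginv (a * b) = ginv b * ginv a"
  by (rule ginv_unique) (simp add: mult.assoc)

end

definition whole_group :: "'a::mgroup monoid" where
  "whole_group = \<lparr>carrier = UNIV, mult = (*), one = 1\<rparr>"

lemma whole_group_simps [simp]:
  "carrier whole_group = UNIV" "mult whole_group = (*)" "one whole_group = 1"
  by (simp_all add: whole_group_def)

lemma group_whole_group [simp]: "group (whole_group :: 'a::mgroup monoid)"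
  by (rule groupI) (auto simp: mult.assoc intro: exI [of _ "ginv _"] ginv_left)

lemma inv_whole_group [simp]: "inv\<^bsub>whole_group\<^esub> a = ginv a"
  by (rule group.inv_equality) simp_all

lemma ginv_swap: "a * x = x * b \<Longrightarrow> x * ginv b = ginv a * x" for a x :: "'a::mgroup"
  by (metis ginv_left_cancel ginv_right mult.assoc mult_1_right)

lemma subgroup_whole_group:
  assumes "1 \<in> H" "\<And>x y. x \<in> H \<Longrightarrow> y \<in> H \<Longrightarrow> x * y \<in> H" "\<And>x. x \<in> H \<Longrightarrow> ginv x \<in> H"
  shows "subgroup H whole_group"
  by (rule group.subgroupI [OF group_whole_group]) (use assms in auto)

section \<open>Words and presented groups\<close>

subsection \<open>Words\<close>

declare in_lists_conv_set [simp del] in_listsD [rule del] in_listsI [rule del]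

abbreviation words :: "'g set \<Rightarrow> 'g word set" where
  "words X \<equiv> lists (X \<times> UNIV)"

lemma Cons_in_words [simp]: "l # w \<in> words X \<longleftrightarrow> fst l \<in> X \<and> w \<in> words X"
  by (auto simp: mem_Times_iff)

definition inv_word :: "'g word \<Rightarrow> 'g word" where
  "inv_word w = rev (map (\<lambda>(x, b). (x, \<not> b)) w)"

lemma inv_word_simps [simp]:
  "inv_word [] = []" "inv_word ((x, b) # w) = inv_word w @ [(x, \<not> b)]"
  "inv_word (u @ v) = inv_word v @ inv_word u"
  by (simp_all add: inv_word_def)

lemma inv_word_inv_word [simp]: "inv_word (inv_word w) = w"
  by (induction w) auto

lemma inv_word_words [simp]: "inv_word w \<in> words X \<longleftrightarrow> w \<in> words X"
  by (induction w) auto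

lemma word_eq_words: "word_eq X R u v \<Longrightarrow> u \<in> words X \<and> v \<in> words X"
  by (induction rule: word_eq.induct) auto

lemma word_eq_inv_right: "w \<in> words X \<Longrightarrow> word_eq X R (w @ inv_word w) []"
proof (induction w)
  case (Cons l w)
  obtain x b where l: "l = (x, b)" by force
  have x: "x \<in> X" and w: "w \<in> words X" using Cons.prems l by auto
  have r: "word_eq X R [(x, c)] [(x, c)]" for c using x by (intro word_eq.refl) simp
  have "word_eq X R ((w @ inv_word w) @ [(x, \<not> b)]) ([] @ [(x, \<not> b)])"
    using Cons.IH w r by (intro word_eq.cong) auto
  then have "word_eq X R ([(x, b)] @ ((w @ inv_word w) @ [(x, \<not> b)])) ([(x, b)] @ ([] @ [(x, \<not> b)]))"
    using r by (rule word_eq.cong [rotated])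
  then show ?case using word_eq.cancel [OF x, of R b] l word_eq.trans by fastforce
qed (simp add: word_eq.refl)

lemma word_eq_inv_left: "w \<in> words X \<Longrightarrow> word_eq X R (inv_word w @ w) []"
  using word_eq_inv_right [of "inv_word w" X R] by simp

lemma word_eq_inv_cong:
  assumes "word_eq X R u v"
  shows "word_eq X R (inv_word u) (inv_word v)"
proof -
  have w: "u \<in> words X" "v \<in> words X" using word_eq_words assms by auto
  have "word_eq X R (inv_word u @ (v @ inv_word v)) (inv_word u @ [])"
    using w by (intro word_eq.cong word_eq_inv_right word_eq.refl) auto
  moreover have "word_eq X R (inv_word u @ (v @ inv_word v)) (inv_word u @ (u @ inv_word v))"
    using w assms by (intro word_eq.cong word_eq.refl) (auto intro: word_eq.sym)
  moreover have "word_eq X R ((inv_word u @ u) @ inv_word v) ([] @ inv_word v)"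
    using w by (intro word_eq.cong word_eq_inv_left word_eq.refl) auto
  ultimately show ?thesis
    by (metis append.assoc append_Nil append_Nil2 word_eq.sym word_eq.trans)
qed

lemma word_eq_mono:
  assumes "word_eq X R u v" "X \<subseteq> Y" "R \<subseteq> S"
  shows "word_eq Y S u v"
  using assms
proof (induction rule: word_eq.induct)
  case (refl w)
  moreover have "words X \<subseteq> words Y" using refl.prems by (intro lists_mono) auto
  ultimately show ?case by (auto intro: word_eq.refl)
next
  case (cong u u' v v')
  then show ?case by (blast intro: word_eq.cong)
next
  case (rel u v)
  moreover have "words X \<subseteq> words Y" using rel.prems by (intro lists_mono) auto
  ultimately show ?case by (intro word_eq.rel) auto
qed (auto intro: word_eq.refl word_eq.cancel word_eq.sym word_eq.trans)

text \<open>Every word occurring in a derivation uses the generators \<open>X\<close> only, so relations with other letters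
  are never applied.\<close>

lemma word_eq_letters:
  assumes "word_eq X R u v"
  shows "word_eq X {(u, v) \<in> R. u \<in> words X \<and> v \<in> words X} u v"
  using assms
  by (induction rule: word_eq.induct)
    (auto intro: word_eq.refl word_eq.cancel word_eq.sym word_eq.trans word_eq.cong word_eq.rel)

lemma equivp_word_eq_UNIV: "equivp (word_eq UNIV R)"
  by (intro equivpI reflpI sympI transpI)
    (auto intro: word_eq.refl word_eq.sym word_eq.trans)

text \<open>An action of the letters on a set factors through the presented group as soon as opposite letters
  undo each other and the relations hold.\<close>

lemma fold_word_eq:
  assumes "word_eq X R u v"
    and "\<And>x b s. x \<in> X \<Longrightarrow> f (x, \<not> b) (f (x, b) s) = s"
    and "\<And>u v s. (u, v) \<in> R \<Longrightarrow> fold f u s = fold f v s"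
  shows "fold f u s = fold f v s"
  using assms by (induction arbitrary: s rule: word_eq.induct) auto

subsection \<open>The group of classes\<close>


definition wclass :: "'g set \<Rightarrow> ('g word \<times> 'g word) set \<Rightarrow> 'g word \<Rightarrow> 'g word set" where
  "wclass X R w = {v. word_eq X R w v}"

lemma wclass_eq_iff:
  assumes "u \<in> words X"
  shows "wclass X R u = wclass X R v \<longleftrightarrow> word_eq X R u v"
  using assms unfolding wclass_def
  by (auto intro: word_eq.refl word_eq.sym word_eq.trans)

lemma carrier_presented_group: "carrier (presented_group X R) = wclass X R ` words X"
  unfolding presented_group_def wclass_def quotient_def by auto

lemma mult_presented_group:
  assumes "u \<in> words X" "v \<in> words X"
  shows "wclass X R u \<otimes>\<^bsub>presented_group X R\<^esub> wclass X R v = wclass X R (u @ v)"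
  unfolding presented_group_def wclass_def using assms
  by (auto intro: word_eq.cong word_eq.trans word_eq.refl)

lemma one_presented_group: "\<one>\<^bsub>presented_group X R\<^esub> = wclass X R []"
  unfolding presented_group_def wclass_def by simp

lemma group_presented_group [simp]: "group (presented_group X R)"
proof (rule groupI)
  fix x assume "x \<in> carrier (presented_group X R)"
  then obtain u where u: "u \<in> words X" "x = wclass X R u"
    by (auto simp: carrier_presented_group)
  have "wclass X R (inv_word u) \<otimes>\<^bsub>presented_group X R\<^esub> x = \<one>\<^bsub>presented_group X R\<^esub>"
    using u word_eq_inv_left [of u X R]
    by (simp add: mult_presented_group one_presented_group wclass_eq_iff)
  then show "\<exists>y\<in>carrier (presented_group X R). y \<otimes>\<^bsub>presented_group X R\<^esub> x = \<one>\<^bsub>presented_group X R\<^esub>"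
    using u by (intro bexI [of _ "wclass X R (inv_word u)"]) (auto simp: carrier_presented_group)
qed (auto simp: carrier_presented_group mult_presented_group one_presented_group)

lemma inv_presented_group:
  assumes "u \<in> words X"
  shows "inv\<^bsub>presented_group X R\<^esub> (wclass X R u) = wclass X R (inv_word u)"
  using assms word_eq_inv_left [of u X R]
  by (intro group.inv_equality)
    (auto simp: carrier_presented_group mult_presented_group one_presented_group wclass_eq_iff)

lemma gen_class_eq: "gen_class X R x = wclass X R [(x, True)]"
  by (simp add: gen_class_def wclass_def)

subsection \<open>Evaluation of words\<close>

definition letter_val :: "('a, 'b) monoid_scheme \<Rightarrow> ('g \<Rightarrow> 'a) \<Rightarrow> 'g \<times> bool \<Rightarrow> 'a" where
  "letter_val G f l = (if snd l then f (fst l) else inv\<^bsub>G\<^esub> (f (fst l)))"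

lemma eval_word_simps [simp]:
  "eval_word G f [] = \<one>\<^bsub>G\<^esub>"
  "eval_word G f (l # w) = letter_val G f l \<otimes>\<^bsub>G\<^esub> eval_word G f w"
  by (auto simp: eval_word_def list_prod_def letter_val_def split: prod.splits)

lemma (in group) letter_val_closed:
  "f ` X \<subseteq> carrier G \<Longrightarrow> fst l \<in> X \<Longrightarrow> letter_val G f l \<in> carrier G"
  by (auto simp: letter_val_def)

lemma (in group) eval_word_closed:
  "f ` X \<subseteq> carrier G \<Longrightarrow> w \<in> words X \<Longrightarrow> eval_word G f w \<in> carrier G"
  by (induction w) (auto simp: letter_val_closed)

lemma (in group) eval_word_append:
  assumes "f ` X \<subseteq> carrier G" "u \<in> words X" "v \<in> words X"
  shows "eval_word G f (u @ v) = eval_word G f u \<otimes> eval_word G f v"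
  using assms(2)
proof (induction u)
  case (Cons l u)
  then have "letter_val G f l \<in> carrier G"
    using assms(1) by (intro letter_val_closed) auto
  then show ?case
    using Cons eval_word_closed [OF assms(1)] assms(3) by (simp add: m_assoc)
qed (use eval_word_closed [OF assms(1)] assms(3) in simp)

lemma eval_word_eqI: "(\<And>x. x \<in> X \<Longrightarrow> f x = g x) \<Longrightarrow> w \<in> words X \<Longrightarrow> eval_word G f w = eval_word G g w"
  by (induction w) (auto simp: letter_val_def)

lemma (in group) eval_word_cong:
  assumes "word_eq X R u v" "f ` X \<subseteq> carrier G"
    and "\<And>u v. (u, v) \<in> R \<Longrightarrow> u \<in> words X \<Longrightarrow> v \<in> words X \<Longrightarrow> eval_word G f u = eval_word G f v"
  shows "eval_word G f u = eval_word G f v"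
  using assms(1)
proof (induction rule: word_eq.induct)
  case (cong u u' v v')
  then show ?case
    using word_eq_words [OF cong.hyps(1)] word_eq_words [OF cong.hyps(2)] assms(2)
    by (simp add: eval_word_append [of f X])
next
  case (cancel x b)
  then show ?case using assms(2) by (cases b) (auto simp: letter_val_def)
qed (use assms in auto)

lemma (in group_hom) letter_val_hom:
  "f ` X \<subseteq> carrier G \<Longrightarrow> fst l \<in> X \<Longrightarrow> h (letter_val G f l) = letter_val H (\<lambda>x. h (f x)) l"
  by (auto simp: letter_val_def)

lemma (in group_hom) eval_word_hom:
  assumes "f ` X \<subseteq> carrier G" "w \<in> words X"
  shows "h (eval_word G f w) = eval_word H (\<lambda>x. h (f x)) w"
  using assms(2)
proof (induction w)
  case (Cons l w)
  then show ?case
    using assms(1) G.letter_val_closed [of f X l] G.eval_word_closed [of f X w]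
    by (auto simp: letter_val_hom)
qed auto

lemma induced_hom_wclass:
  assumes "w \<in> words X" "\<And>u v. word_eq X R u v \<Longrightarrow> eval_word G f u = eval_word G f v"
  shows "induced_hom G f (wclass X R w) = eval_word G f w"
proof -
  have "eval_word G f ` wclass X R w = {eval_word G f w}"
    using assms word_eq.refl [OF assms(1)] by (auto simp: wclass_def)
  then show ?thesis by (simp add: induced_hom_def)
qed

lemma eval_word_gen_class:
  assumes "w \<in> words X"
  shows "eval_word (presented_group X R) (gen_class X R) w = wclass X R w"
  using assms
proof (induction w)
  case (Cons l w)
  have "letter_val (presented_group X R) (gen_class X R) l = wclass X R [l]"
  proof -
    have "[(fst l, True)] \<in> words X" using Cons by (simp add: mem_Times_iff)
    then show ?thesis
      using inv_presented_group [of "[(fst l, True)]" X R]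
      by (cases l) (simp add: letter_val_def gen_class_eq)
  qed
  then show ?case using Cons by (auto simp: mult_presented_group)
qed (simp add: one_presented_group)

lemma (in group) generate_eq_eval_word:
  assumes "f ` X \<subseteq> carrier G"
  shows "generate G (f ` X) = eval_word G f ` words X"
proof (intro equalityI subsetI)
  fix a assume "a \<in> generate G (f ` X)"
  then show "a \<in> eval_word G f ` words X"
  proof (induction rule: generate.induct)
    case one
    then show ?case by (intro image_eqI [of _ _ "[]"]) auto
  next
    case (incl h)
    then obtain x where "x \<in> X" "h = f x" by auto
    then show ?case using assms
      by (intro image_eqI [of _ _ "[(x, True)]"]) (auto simp: letter_val_def)
  next
    case (inv h)
    then obtain x where "x \<in> X" "h = f x" by auto
    then show ?case using assms
      by (intro image_eqI [of _ _ "[(x, False)]"]) (auto simp: letter_val_def)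
  next
    case (eng a b)
    then obtain u v where "u \<in> words X" "a = eval_word G f u" "v \<in> words X" "b = eval_word G f v"
      by auto
    then show ?case using assms
      by (intro image_eqI [of _ _ "u @ v"]) (auto simp: eval_word_append)
  qed
next
  fix a assume "a \<in> eval_word G f ` words X"
  then obtain w where "w \<in> words X" "a = eval_word G f w" by auto
  then show "a \<in> generate G (f ` X)"
  proof (induction w arbitrary: a)
    case (Cons l w)
    then have "letter_val G f l \<in> generate G (f ` X)"
      by (auto simp: letter_val_def intro: generate.intros)
    with Cons show ?case by (auto intro: generate.eng)
  qed (auto intro: generate.one)
qed

lemma (in group) letter_val_subgroup:
  assumes "subgroup H G" "f ` X \<subseteq> H" "fst l \<in> X"
  shows "letter_val (G\<lparr>carrier := H\<rparr>) f l = letter_val G f l"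
  using assms m_inv_consistent [OF assms(1), of "f (fst l)"] by (auto simp: letter_val_def)

lemma (in group) eval_word_subgroup:
  assumes "subgroup H G" "f ` X \<subseteq> H" "w \<in> words X"
  shows "eval_word (G\<lparr>carrier := H\<rparr>) f w = eval_word G f w"
  using assms(3)
  by (induction w) (auto simp: letter_val_subgroup [OF assms(1,2)])

text \<open>On the subgroup generated by the family the induced map is onto, so freeness amounts to the absence
  of relations.\<close>

lemma (in group) free_basisI:
  fixes f :: "'g \<Rightarrow> 'a"
  assumes f: "f ` X \<subseteq> carrier G"
    and free: "\<And>w. w \<in> words X \<Longrightarrow> eval_word G f w = \<one> \<Longrightarrow> word_eq X {} w []"
  shows "free_basis (G\<lparr>carrier := generate G (f ` X)\<rparr>) X f"
proof -
  let ?H = "generate G (f ` X)"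
  let ?F = "presented_group X ({} :: ('g word \<times> 'g word) set)"
  have H: "subgroup ?H G" using f by (rule generate_is_subgroup)
  have fH: "f ` X \<subseteq> ?H" by (auto intro: generate.incl)
  have ev: "induced_hom (G\<lparr>carrier := ?H\<rparr>) f (wclass X {} w) = eval_word G f w"
    if w: "w \<in> words X" for w
  proof -
    have "eval_word (G\<lparr>carrier := ?H\<rparr>) f u = eval_word (G\<lparr>carrier := ?H\<rparr>) f v"
      if "word_eq X {} u v" for u v
      using that word_eq_words [OF that] eval_word_cong [OF that f]
      by (simp add: eval_word_subgroup [OF H fH])
    then show ?thesis using w by (simp add: induced_hom_wclass eval_word_subgroup [OF H fH])
  qed
  have "inj_on (induced_hom (G\<lparr>carrier := ?H\<rparr>) f) (carrier ?F)"
  proof (rule inj_onI)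
    fix a b assume ab: "a \<in> carrier ?F" "b \<in> carrier ?F"
      and eq: "induced_hom (G\<lparr>carrier := ?H\<rparr>) f a = induced_hom (G\<lparr>carrier := ?H\<rparr>) f b"
    obtain u v where uv: "u \<in> words X" "a = wclass X {} u" "v \<in> words X" "b = wclass X {} v"
      using ab by (auto simp: carrier_presented_group)
    have "eval_word G f (u @ inv_word v) = eval_word G f (v @ inv_word v)"
      using eq uv f by (simp add: ev eval_word_append)
    also have "\<dots> = eval_word G f []"
      using uv by (intro eval_word_cong [OF word_eq_inv_right f]) auto
    finally have "word_eq X {} (u @ inv_word v) []" using free uv by simp
    then have "word_eq X {} ((u @ inv_word v) @ v) ([] @ v)"
      using uv by (intro word_eq.cong word_eq.refl)
    moreover have "word_eq X {} (u @ (inv_word v @ v)) (u @ [])"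
      using uv by (intro word_eq.cong word_eq.refl word_eq_inv_left)
    ultimately have "word_eq X {} u v"
      using word_eq.sym word_eq.trans by fastforce
    then show "a = b" using uv by (simp add: wclass_eq_iff)
  qed
  moreover have "induced_hom (G\<lparr>carrier := ?H\<rparr>) f ` carrier ?F = ?H"
    using ev by (simp add: carrier_presented_group image_image generate_eq_eval_word [OF f] cong: image_cong)
  moreover have "induced_hom (G\<lparr>carrier := ?H\<rparr>) f \<in> hom ?F (G\<lparr>carrier := ?H\<rparr>)"
    using calculation(2) f
    by (intro homI) (auto simp: carrier_presented_group mult_presented_group ev eval_word_append)
  ultimately show ?thesis
    by (simp add: free_basis_def iso_def bij_betw_def)
qed

section \<open>The virtual braid group on infinitely many strands\<close>

text \<open>The three cubic families of relations have the common shape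
  \<open>x\<^sub>i y\<^bsub>i+1\<^esub> z\<^sub>i = z\<^bsub>i+1\<^esub> y\<^sub>i x\<^bsub>i+1\<^esub>\<close>, which is what makes one argument about doubled
  strands serve for all of them.\<close>

definition exch_types :: "((nat \<Rightarrow> vb_gen) \<times> (nat \<Rightarrow> vb_gen) \<times> (nat \<Rightarrow> vb_gen)) set" where
  "exch_types = {(Sigma, Sigma, Sigma), (Rho, Rho, Rho), (Rho, Rho, Sigma)}"

definition comm_types :: "((nat \<Rightarrow> vb_gen) \<times> (nat \<Rightarrow> vb_gen)) set" where
  "comm_types = {(Sigma, Sigma), (Rho, Rho), (Sigma, Rho)}"

text \<open>Strands are numbered \<open>0, 1, 2, \<dots>\<close> without end. Having a strand \<open>0\<close> removes all lower bounds on
  indices; the group on \<open>n\<close> strands sits on the strands \<open>1, \<dots>, n\<close>.\<close>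

inductive_set stable_rels :: "(vb_gen word \<times> vb_gen word) set" where
  comm: "(x, y) \<in> comm_types \<Longrightarrow> i + 1 < j \<or> j + 1 < i \<Longrightarrow>
    (pos_word [x i, y j], pos_word [y j, x i]) \<in> stable_rels"
| exch: "(x, y, z) \<in> exch_types \<Longrightarrow>
    (pos_word [x i, y (i + 1), z i], pos_word [z (i + 1), y i, x (i + 1)]) \<in> stable_rels"
| invol: "(pos_word [Rho i, Rho i], []) \<in> stable_rels"

abbreviation "stable_eq X \<equiv> word_eq X stable_rels"

lemma vb_rels_eq:
  "vb_rels n = {(u, v) \<in> stable_rels. u \<in> words (vb_gens n) \<and> v \<in> words (vb_gens n)}"
proof (intro equalityI subrelI)
  fix u v assume "(u, v) \<in> vb_rels n"
  then show "(u, v) \<in> {(u, v) \<in> stable_rels. u \<in> words (vb_gens n) \<and> v \<in> words (vb_gens n)}"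
    using stable_rels.comm [of Sigma Sigma] stable_rels.comm [of Rho Rho] stable_rels.comm [of Sigma Rho]
      stable_rels.exch [of Sigma Sigma Sigma] stable_rels.exch [of Rho Rho Rho]
      stable_rels.exch [of Rho Rho Sigma] stable_rels.invol
    unfolding vb_rels_def Un_iff
    by (elim disjE CollectE exE conjE) (auto simp: vb_gens_def comm_types_def exch_types_def)
next
  fix u v assume "(u, v) \<in> {(u, v) \<in> stable_rels. u \<in> words (vb_gens n) \<and> v \<in> words (vb_gens n)}"
  then have "(u, v) \<in> stable_rels" "u \<in> words (vb_gens n)" "v \<in> words (vb_gens n)" by auto
  then show "(u, v) \<in> vb_rels n"
    unfolding vb_rels_def by cases (auto simp: vb_gens_def comm_types_def exch_types_def)
qed

lemma vb_word_eq: "word_eq (vb_gens n) (vb_rels n) = stable_eq (vb_gens n)"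
proof (intro ext iffI)
  fix u v assume "word_eq (vb_gens n) (vb_rels n) u v"
  then show "stable_eq (vb_gens n) u v" by (rule word_eq_mono) (auto simp: vb_rels_eq)
next
  fix u v assume "stable_eq (vb_gens n) u v"
  then show "word_eq (vb_gens n) (vb_rels n) u v"
    unfolding vb_rels_eq by (rule word_eq_letters)
qed

quotient_type vb = "vb_gen word" / "stable_eq UNIV"
  by (rule equivp_word_eq_UNIV)

instantiation vb :: mgroup
begin

lift_definition one_vb :: vb is "[]" .

lift_definition times_vb :: "vb \<Rightarrow> vb \<Rightarrow> vb" is "(@)"
  by (rule word_eq.cong)

lift_definition ginv_vb :: "vb \<Rightarrow> vb" is inv_word
  by (rule word_eq_inv_cong)

instance
  by standard (transfer; simp add: word_eq.refl word_eq_inv_left)+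

end

definition gen :: "vb_gen \<Rightarrow> vb" where
  "gen g = abs_vb [(g, True)]"

abbreviation "sg i \<equiv> gen (Sigma i)"
abbreviation "rh i \<equiv> gen (Rho i)"

lemma abs_vb_eq: "abs_vb u = abs_vb v \<longleftrightarrow> stable_eq UNIV u v"
  by (simp add: vb.abs_eq_iff)

lemma abs_vb_append: "abs_vb (u @ v) = abs_vb u * abs_vb v"
  by (simp add: times_vb.abs_eq)

lemma abs_vb_Nil: "abs_vb [] = 1"
  by (simp add: one_vb_def)

lemma abs_vb_inv: "abs_vb (inv_word u) = ginv (abs_vb u)"
  by (simp add: ginv_vb.abs_eq)

lemma abs_vb_letter: "abs_vb [(g, b)] = (if b then gen g else ginv (gen g))"
  using abs_vb_inv [of "[(g, True)]"] by (simp add: gen_def)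

lemma abs_vb_Cons: "abs_vb ((g, b) # w) = (if b then gen g else ginv (gen g)) * abs_vb w"
  using abs_vb_append [of "[(g, b)]" w] by (simp add: abs_vb_letter)

lemmas abs_vb_simps = abs_vb_Nil abs_vb_append abs_vb_inv abs_vb_Cons

lemma abs_vb_eval: "abs_vb w = eval_word whole_group gen w"
  by (induction w) (auto simp: abs_vb_simps letter_val_def)

lemma vb_exists_word: "\<exists>w. x = abs_vb w"
  by (metis Quotient3_vb Quotient3_abs_rep)

lemma vb_induct [case_names one gen ginv]:
  assumes "P 1" "\<And>g x. P x \<Longrightarrow> P (gen g * x)" "\<And>g x. P x \<Longrightarrow> P (ginv (gen g) * x)"
  shows "P x"
proof -
  obtain w where "x = abs_vb w" using vb_exists_word by blast
  moreover have "P (abs_vb w)"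
    by (induction w) (auto simp: abs_vb_simps assms)
  ultimately show ?thesis by simp
qed

lemma stable_relsD: "(u, v) \<in> stable_rels \<Longrightarrow> abs_vb u = abs_vb v"
  by (simp add: abs_vb_eq word_eq.rel lists_UNIV)

definition commuting :: "(nat \<Rightarrow> vb) \<Rightarrow> (nat \<Rightarrow> vb) \<Rightarrow> bool" where
  "commuting x y \<longleftrightarrow> (\<forall>i j. i + 1 < j \<or> j + 1 < i \<longrightarrow> x i * y j = y j * x i)"

definition exchanging :: "(nat \<Rightarrow> vb) \<Rightarrow> (nat \<Rightarrow> vb) \<Rightarrow> (nat \<Rightarrow> vb) \<Rightarrow> bool" where
  "exchanging x y z \<longleftrightarrow> (\<forall>i. x i * (y (Suc i) * z i) = z (Suc i) * (y i * x (Suc i)))"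

lemma gen_comm: "(x, y) \<in> comm_types \<Longrightarrow> commuting (\<lambda>i. gen (x i)) (\<lambda>i. gen (y i))"
  using stable_relsD [OF stable_rels.comm [of x y]] by (auto simp: commuting_def abs_vb_simps)

lemma commuting_gens:
  "commuting (\<lambda>i. sg i) (\<lambda>i. sg i)" "commuting (\<lambda>i. rh i) (\<lambda>i. rh i)"
  "commuting (\<lambda>i. sg i) (\<lambda>i. rh i)" "commuting (\<lambda>i. rh i) (\<lambda>i. sg i)"
proof -
  show "commuting (\<lambda>i. sg i) (\<lambda>i. sg i)" "commuting (\<lambda>i. rh i) (\<lambda>i. rh i)"
    and sr: "commuting (\<lambda>i. sg i) (\<lambda>i. rh i)"
    by (auto intro!: gen_comm simp: comm_types_def)
  show "commuting (\<lambda>i. rh i) (\<lambda>i. sg i)"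
    using sr unfolding commuting_def by metis
qed

lemma gen_exch:
  "(x, y, z) \<in> exch_types \<Longrightarrow> exchanging (\<lambda>i. gen (x i)) (\<lambda>i. gen (y i)) (\<lambda>i. gen (z i))"
  using stable_relsD [OF stable_rels.exch] by (simp add: exchanging_def abs_vb_simps)

lemma rh_rh [simp]: "rh i * rh i = 1"
  using stable_relsD [OF stable_rels.invol [of i]] by (simp add: abs_vb_simps)

lemma rh_rh_cancel [simp]: "rh i * (rh i * x) = x"
  by (simp flip: mult.assoc)

lemma ginv_rh [simp]: "ginv (rh i) = rh i"
  by (rule ginv_unique) simp

section \<open>Tracking, deleting and doubling strands\<close>

fun idx :: "vb_gen \<Rightarrow> nat" where
  "idx (Sigma i) = i"
| "idx (Rho i) = i"

fun reindex :: "vb_gen \<Rightarrow> nat \<Rightarrow> vb_gen" where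
  "reindex (Sigma _) = Sigma"
| "reindex (Rho _) = Rho"

lemma gen_perm_idx: "gen_perm g = transpose (idx g) (idx g + 1)"
  by (cases g) auto

lemma gen_perm_gen_perm [simp]: "gen_perm g (gen_perm g p) = p"
  by (simp add: gen_perm_idx)

lemma reindex_idx [simp]: "reindex g (idx g) = g"
  by (cases g) auto

lemma idx_reindex [simp]: "idx (reindex g i) = i"
  by (cases g) auto

lemma reindex_reindex [simp]: "reindex (reindex g i) = reindex g"
  by (cases g) auto

lemma vb_gens_iff: "g \<in> vb_gens n \<longleftrightarrow> 1 \<le> idx g \<and> idx g < n"
  by (cases g) (auto simp: vb_gens_def)

lemma exch_types_reindex:
  "(x, y, z) \<in> exch_types \<Longrightarrow>
    x = reindex (x 0) \<and> y = reindex (y 0) \<and> z = reindex (z 0) \<and>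
    idx (x i) = i \<and> idx (y i) = i \<and> idx (z i) = i"
  by (auto simp: exch_types_def)

lemma comm_types_reindex:
  "(x, y) \<in> comm_types \<Longrightarrow>
    x = reindex (x 0) \<and> y = reindex (y 0) \<and> idx (x i) = i \<and> idx (y i) = i"
  by (auto simp: comm_types_def)

text \<open>A word is read from left to right: \<open>end_pos w p\<close> is where the strand that starts at position \<open>p\<close>
  ends.\<close>

definition end_pos :: "vb_gen word \<Rightarrow> nat \<Rightarrow> nat" where
  "end_pos w p = fold (\<lambda>l. gen_perm (fst l)) w p"

lemma end_pos_simps [simp]:
  "end_pos [] p = p"
  "end_pos (l # w) p = end_pos w (gen_perm (fst l) p)"
  "end_pos (u @ v) p = end_pos v (end_pos u p)"
  by (simp_all add: end_pos_def)

lemma end_pos_rel: "(u, v) \<in> stable_rels \<Longrightarrow> end_pos u p = end_pos v p"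
  by (erule stable_rels.cases)
    (auto simp: exch_types_def comm_types_def transpose_def)

lemma end_pos_cong: "stable_eq X u v \<Longrightarrow> end_pos u p = end_pos v p"
  unfolding end_pos_def
  by (erule fold_word_eq) (auto simp: end_pos_rel [unfolded end_pos_def])

lift_definition pos :: "vb \<Rightarrow> nat \<Rightarrow> nat" is end_pos
  by (auto intro: end_pos_cong)

lemma pos_abs [simp]: "pos (abs_vb w) = end_pos w"
  by (simp add: pos.abs_eq)

lemma pos_one [simp]: "pos 1 p = p"
  by transfer simp

lemma pos_mult [simp]: "pos (x * y) p = pos y (pos x p)"
  by transfer simp

lemma pos_ginv_pos [simp]: "pos (ginv x) (pos x p) = p"
  by (metis ginv_right pos_mult pos_one)

lemma pos_pos_ginv [simp]: "pos x (pos (ginv x) p) = p"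
  by (metis ginv_left pos_mult pos_one)

lemma pos_gen [simp]: "pos (gen g) = gen_perm g"
  by (rule ext) (simp add: gen_def)

lemma pos_ginv_gen [simp]: "pos (ginv (gen g)) = gen_perm g"
  by (rule ext) (metis gen_perm_gen_perm pos_gen pos_ginv_pos)

subsection \<open>Deleting a strand\<close>

definition del_gen :: "nat \<Rightarrow> vb_gen \<Rightarrow> vb_gen list" where
  "del_gen p g = (if p = idx g \<or> p = idx g + 1 then []
     else if p < idx g then [reindex g (idx g - 1)] else [g])"

fun del :: "nat \<Rightarrow> vb_gen word \<Rightarrow> vb_gen word" where
  "del p [] = []"
| "del p ((g, b) # w) = map (\<lambda>h. (h, b)) (del_gen p g) @ del (gen_perm g p) w"

lemma del_append: "del p (u @ v) = del p u @ del (end_pos u p) v"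
  by (induction p u rule: del.induct) auto

text \<open>A relation collapses if the deleted strand takes part in it; otherwise its indices drop by one or stay.\<close>

lemma del_rel: "(u, v) \<in> stable_rels \<Longrightarrow> del p u = del p v \<or> (del p u, del p v) \<in> stable_rels"
proof (erule stable_rels.cases)
  fix x y i j
  assume uv: "u = pos_word [x i, y j]" "v = pos_word [y j, x i]" and t: "(x, y) \<in> comm_types"
    and far: "i + 1 < j \<or> j + 1 < i"
  note r = comm_types_reindex [OF t]
  obtain g h where gh: "x = reindex g" "y = reindex h" using r by metis
  show ?thesis
  proof (cases "p \<in> {i, i + 1, j, j + 1}")
    case True
    then show ?thesis
      using far unfolding uv by (auto simp: del_gen_def gen_perm_idx transpose_def gh)
  next
    case False
    \<comment> \<open>The indices that remain after the deletion.\<close>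
    define i' j' where "i' = (if p < i then i - 1 else i)" and "j' = (if p < j then j - 1 else j)"
    have "del p u = pos_word [x i', y j']" "del p v = pos_word [y j', x i']"
      using False unfolding uv i'_def j'_def
      by (auto simp: del_gen_def gen_perm_idx transpose_def gh)
    moreover have "i' + 1 < j' \<or> j' + 1 < i'"
      using far False unfolding i'_def j'_def by auto
    ultimately show ?thesis using stable_rels.comm [OF t] by simp
  qed
next
  fix x y z i
  assume uv: "u = pos_word [x i, y (i + 1), z i]" "v = pos_word [z (i + 1), y i, x (i + 1)]"
    and t: "(x, y, z) \<in> exch_types"
  obtain f g h where gh: "x = reindex f" "y = reindex g" "z = reindex h"
    using exch_types_reindex [OF t] by metis
  show ?thesis
    using stable_rels.exch [of x y z i] stable_rels.exch [of x y z "i - 1"] t unfolding uv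
    by (auto simp: del_gen_def gen_perm_idx transpose_def gh)
next
  fix i assume uv: "u = pos_word [Rho i, Rho i]" "v = []"
  show ?thesis
    using stable_rels.invol [of i] stable_rels.invol [of "i - 1"] unfolding uv
    by (auto simp: del_gen_def transpose_def)
qed

lemma del_words:
  assumes "w \<in> words X" "p \<in> S"
    and "\<And>g p. g \<in> X \<Longrightarrow> p \<in> S \<Longrightarrow> set (del_gen p g) \<subseteq> Y \<and> gen_perm g p \<in> S"
  shows "del p w \<in> words Y"
proof -
  have map_words: "map (\<lambda>h. (h, b)) gs \<in> words Y \<longleftrightarrow> set gs \<subseteq> Y" for gs b
    by (induction gs) auto
  show ?thesis
    using assms(1,2)
  proof (induction p w rule: del.induct)
    case (2 p g b w)
    then show ?case using assms(3) [of g p] by (simp add: map_words)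
  qed simp
qed

lemma end_pos_closed:
  assumes "w \<in> words X" "p \<in> S" "\<And>g p. g \<in> X \<Longrightarrow> p \<in> S \<Longrightarrow> gen_perm g p \<in> S"
  shows "end_pos w p \<in> S"
  using assms(1,2) by (induction w arbitrary: p) (auto simp: assms(3))

lemma del_cong:
  assumes "stable_eq X u v" "p \<in> S"
    and closed: "\<And>g p. g \<in> X \<Longrightarrow> p \<in> S \<Longrightarrow> set (del_gen p g) \<subseteq> Y \<and> gen_perm g p \<in> S"
  shows "stable_eq Y (del p u) (del p v)"
  using assms(1,2)
proof (induction arbitrary: p rule: word_eq.induct)
  case (refl w)
  then show ?case by (intro word_eq.refl del_words [of w X p S] closed)
next
  case (cong u u' v v')
  have "end_pos u p \<in> S"
    using cong.prems word_eq_words [OF cong.hyps(1)] closed by (intro end_pos_closed) auto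
  then show ?case
    using cong by (auto simp: del_append end_pos_cong [OF cong.hyps(1)] intro!: word_eq.cong)
next
  case (cancel g b)
  then have "set (del_gen p g) \<subseteq> Y" using closed by blast
  moreover have "del_gen (gen_perm g p) g = del_gen p g"
    by (auto simp: del_gen_def gen_perm_idx transpose_def)
  ultimately show ?case
    by (auto simp: del_gen_def word_eq.refl intro!: word_eq.cancel split: if_splits)
next
  case (rel u v)
  then have "del p u \<in> words Y" "del p v \<in> words Y"
    using del_words [OF _ _ closed] by blast+
  then show ?case using del_rel [OF rel.hyps(1), of p] by (auto intro: word_eq.refl word_eq.rel)
qed (blast intro: word_eq.sym word_eq.trans)+

lemma del_cong_gens:
  assumes "stable_eq (vb_gens (Suc n)) u v" "1 \<le> p" "p \<le> Suc n"
  shows "stable_eq (vb_gens n) (del p u) (del p v)"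
  by (rule del_cong [OF assms(1), where S = "{1..Suc n}"])
    (use assms in \<open>auto simp: del_gen_def vb_gens_iff gen_perm_idx transpose_def split: if_splits\<close>)

lift_definition delete :: "nat \<Rightarrow> vb \<Rightarrow> vb" is del
  by (rule del_cong [where S = UNIV]) auto

lemma delete_abs: "delete p (abs_vb w) = abs_vb (del p w)"
  by (simp add: delete.abs_eq)

lemma delete_one [simp]: "delete p 1 = 1"
  by transfer (simp add: word_eq.refl)

text \<open>Deletion is a homomorphism only up to bookkeeping: the second factor loses the strand that the first
  factor has carried to a new position.\<close>

lemma delete_mult: "delete p (x * y) = delete p x * delete (pos x p) y"
  by transfer (simp add: del_append word_eq.refl lists_UNIV)

lemma delete_gen:
  "delete p (gen g) = (if p = idx g \<or> p = idx g + 1 then 1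
     else if p < idx g then gen (reindex g (idx g - 1)) else gen g)"
  by (simp add: gen_def delete_abs del_gen_def abs_vb_Nil)

lemma delete_ginv: "delete p (ginv x) = ginv (delete (pos (ginv x) p) x)"
proof -
  have "delete p (ginv x) * delete (pos (ginv x) p) x = 1"
    by (simp flip: delete_mult)
  then show ?thesis by (metis ginv_ginv ginv_unique)
qed

subsection \<open>Adding trivial strands is injective\<close>

definition shift_word :: "vb_gen word \<Rightarrow> vb_gen word" where
  "shift_word w = map (\<lambda>(g, b). (reindex g (Suc (idx g)), b)) w"

lemma shift_word_simps [simp]:
  "shift_word [] = []"
  "shift_word ((g, b) # w) = (reindex g (Suc (idx g)), b) # shift_word w"
  "shift_word (u @ v) = shift_word u @ shift_word v"
  by (simp_all add: shift_word_def)

lemma shift_rel: "(u, v) \<in> stable_rels \<Longrightarrow> (shift_word u, shift_word v) \<in> stable_rels"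
proof (erule stable_rels.cases)
  fix x y i j
  assume uv: "u = pos_word [x i, y j]" "v = pos_word [y j, x i]" and t: "(x, y) \<in> comm_types"
    and far: "i + 1 < j \<or> j + 1 < i"
  obtain g h where gh: "x = reindex g" "y = reindex h" using comm_types_reindex [OF t] by metis
  show ?thesis
    using far stable_rels.comm [of x y "Suc i" "Suc j"] t unfolding uv by (simp add: gh)
next
  fix x y z i
  assume uv: "u = pos_word [x i, y (i + 1), z i]" "v = pos_word [z (i + 1), y i, x (i + 1)]"
    and t: "(x, y, z) \<in> exch_types"
  obtain f g h where gh: "x = reindex f" "y = reindex g" "z = reindex h"
    using exch_types_reindex [OF t] by metis
  show ?thesis using stable_rels.exch [of x y z "Suc i"] t unfolding uv by (simp add: gh)
next
  fix i assume uv: "u = pos_word [Rho i, Rho i]" "v = []"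
  show ?thesis using stable_rels.invol [of "Suc i"] unfolding uv by simp
qed

lemma vb_words_mono: "m \<le> n \<Longrightarrow> w \<in> words (vb_gens m) \<Longrightarrow> w \<in> words (vb_gens n)"
  by (induction w) (auto simp: vb_gens_iff)

lemma words_bounded:
  assumes "\<forall>g \<in> fst ` set w. 1 \<le> idx g"
  shows "\<exists>N. w \<in> words (vb_gens N)"
  using assms
proof (induction w)
  case (Cons l w)
  then obtain N where "w \<in> words (vb_gens N)" by auto
  then have "l # w \<in> words (vb_gens (max N (Suc (idx (fst l)))))"
    using Cons.prems vb_words_mono [of N "max N (Suc (idx (fst l)))" w]
    by (simp add: vb_gens_iff mem_Times_iff)
  then show ?case ..
qed (rule exI [of _ 0], simp)

lemma shift_word_bounded: "\<exists>N. shift_word w \<in> words (vb_gens N)"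
  by (rule words_bounded) (auto simp: shift_word_def)

lemma stable_eq_mono: "stable_eq (vb_gens m) u v \<Longrightarrow> m \<le> n \<Longrightarrow> stable_eq (vb_gens n) u v"
  by (erule word_eq_mono) (auto simp: vb_gens_iff)

text \<open>A derivation mentions finitely many generators, and the shift makes their indices positive, so that
  it takes place in a group on finitely many strands.\<close>

lemma stable_eq_bounded:
  assumes "stable_eq UNIV u v"
  shows "\<exists>N. stable_eq (vb_gens N) (shift_word u) (shift_word v)"
  using assms
proof (induction rule: word_eq.induct)
  case (refl w)
  then show ?case using shift_word_bounded word_eq.refl by blast
next
  case (sym u v)
  then show ?case using word_eq.sym by blast
next
  case (trans u v w)
  then obtain M N where "stable_eq (vb_gens M) (shift_word u) (shift_word v)"
    "stable_eq (vb_gens N) (shift_word v) (shift_word w)" by blast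
  then show ?case using stable_eq_mono [of M _ _ "max M N"] stable_eq_mono [of N _ _ "max M N"]
    by (meson max.cobounded1 max.cobounded2 word_eq.trans)
next
  case (cong u u' v v')
  then obtain M N where "stable_eq (vb_gens M) (shift_word u) (shift_word u')"
    "stable_eq (vb_gens N) (shift_word v) (shift_word v')" by blast
  then have "stable_eq (vb_gens (max M N)) (shift_word (u @ v)) (shift_word (u' @ v'))"
    unfolding shift_word_simps
    by (intro word_eq.cong stable_eq_mono [of M _ _ "max M N"] stable_eq_mono [of N _ _ "max M N"]) auto
  then show ?case ..
next
  case (cancel g b)
  then show ?case
    by (intro exI [of _ "Suc (Suc (idx g))"]) (auto simp: vb_gens_iff intro!: word_eq.cancel)
next
  case (rel u v)
  obtain M N where "shift_word u \<in> words (vb_gens M)" "shift_word v \<in> words (vb_gens N)"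
    using shift_word_bounded by meson
  then have "stable_eq (vb_gens (max M N)) (shift_word u) (shift_word v)"
    using vb_words_mono [of M "max M N"] vb_words_mono [of N "max M N"]
    by (intro word_eq.rel shift_rel rel) auto
  then show ?case ..
qed

lemma del_shift: "w \<in> words (vb_gens n) \<Longrightarrow> del (Suc 0) (shift_word w) = w"
  by (induction w) (auto simp: vb_gens_iff del_gen_def gen_perm_idx transpose_def)

lemma del_outside: "w \<in> words (vb_gens n) \<Longrightarrow> n < p \<Longrightarrow> del p w = w"
  by (induction w) (auto simp: vb_gens_iff del_gen_def gen_perm_idx transpose_def)

text \<open>A derivation on \<open>N\<close> strands between words on \<open>n\<close> strands is turned into one on \<open>n\<close> strands by
  deleting the strands \<open>N, \<dots>, n + 1\<close> one after the other: these words do not change. The strand \<open>0\<close> is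
  removed first, by shifting and then deleting strand \<open>1\<close>.\<close>

theorem stable_eq_restrict:
  assumes "stable_eq UNIV u v" "u \<in> words (vb_gens n)" "v \<in> words (vb_gens n)"
  shows "stable_eq (vb_gens n) u v"
proof -
  obtain N where "stable_eq (vb_gens N) (shift_word u) (shift_word v)"
    using stable_eq_bounded assms(1) by blast
  \<comment> \<open>The bound \<open>Suc (max n N)\<close> becomes \<open>max n N\<close>, which is at least \<open>n\<close>, once strand \<open>1\<close> is deleted.\<close>
  then have "stable_eq (vb_gens (Suc (max n N))) (shift_word u) (shift_word v)"
    by (rule stable_eq_mono) auto
  then have "stable_eq (vb_gens (max n N)) (del 1 (shift_word u)) (del 1 (shift_word v))"
    by (rule del_cong_gens) auto
  then have "stable_eq (vb_gens (n + (max n N - n))) u v"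
    using assms by (simp add: del_shift)
  moreover have "stable_eq (vb_gens (n + k)) u v \<Longrightarrow> stable_eq (vb_gens n) u v" for k
  proof (induction k)
    case (Suc k)
    have "stable_eq (vb_gens (n + k)) (del (Suc (n + k)) u) (del (Suc (n + k)) v)"
      using Suc.prems by (intro del_cong_gens) auto
    then show ?case using Suc.IH assms by (simp add: del_outside)
  qed simp
  ultimately show ?thesis by blast
qed

lift_definition shift :: "vb \<Rightarrow> vb" is shift_word
proof -
  fix u v assume "stable_eq UNIV u v"
  then obtain N where "stable_eq (vb_gens N) (shift_word u) (shift_word v)"
    using stable_eq_bounded by blast
  then show "stable_eq UNIV (shift_word u) (shift_word v)"
    by (rule word_eq_mono) auto
qed

lemma shift_abs: "shift (abs_vb w) = abs_vb (shift_word w)"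
  by (simp add: shift.abs_eq)

lemma shift_mult [simp]: "shift (x * y) = shift x * shift y"
  by transfer (simp add: word_eq.refl lists_UNIV)

lemma shift_one [simp]: "shift 1 = 1"
  by transfer (simp add: word_eq.refl)

lemma shift_ginv [simp]: "shift (ginv x) = ginv (shift x)"
  by (metis ginv_right ginv_unique shift_mult shift_one)

lemma shift_gen [simp]: "shift (gen g) = gen (reindex g (Suc (idx g)))"
  by (simp add: gen_def shift_abs)

subsection \<open>Doubling a strand\<close>

text \<open>If strand \<open>p\<close> crosses from position \<open>i\<close> to \<open>i + 1\<close>, its right copy crosses first; if it crosses from
  \<open>i + 1\<close> to \<open>i\<close>, its left copy does.\<close>

definition dbl_gen :: "nat \<Rightarrow> vb_gen \<Rightarrow> vb_gen list" where
  "dbl_gen p g = map (reindex g)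
     (if p = idx g then [p + 1, p] else if p = idx g + 1 then [idx g, p]
      else if p < idx g then [idx g + 1] else [idx g])"

text \<open>An inverse letter meets the doubled strand at its far end, hence the index \<open>gen_perm g p\<close>.\<close>

fun dbl :: "nat \<Rightarrow> vb_gen word \<Rightarrow> vb_gen word" where
  "dbl p [] = []"
| "dbl p ((g, b) # w) =
     (if b then pos_word (dbl_gen p g) else inv_word (pos_word (dbl_gen (gen_perm g p) g)))
       @ dbl (gen_perm g p) w"

lemma dbl_append: "dbl p (u @ v) = dbl p u @ dbl (end_pos u p) v"
proof (induction u arbitrary: p)
  case (Cons l u)
  then show ?case by (cases l) simp
qed simp

lemma commutingD: "commuting x y \<Longrightarrow> i + 1 < j \<or> j + 1 < i \<Longrightarrow> x i * y j = y j * x i"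
  unfolding commuting_def by blast

lemma commutingD_assoc:
  "commuting x y \<Longrightarrow> i + 1 < j \<or> j + 1 < i \<Longrightarrow> x i * (y j * a) = y j * (x i * a)"
  using arg_cong [OF commutingD, of x y i j "\<lambda>b. b * a"] by (simp add: mult.assoc)

lemma exchangingD: "exchanging x y z \<Longrightarrow> x i * (y (Suc i) * z i) = z (Suc i) * (y i * x (Suc i))"
  by (simp add: exchanging_def)

lemma exchangingD_assoc:
  "exchanging x y z \<Longrightarrow> x i * (y (Suc i) * (z i * a)) = z (Suc i) * (y i * (x (Suc i) * a))"
  using arg_cong [OF exchangingD, of x y z "\<lambda>b. b * a" i] by (simp add: mult.assoc)

text \<open>The next three lemmas are the doubled cubic relations, according to which of the three strands is
  doubled. Each follows from two applications of the relation itself, once far generators have been moved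
  past each other.\<close>

lemma exchanging_double_first:
  assumes "exchanging x y z" "commuting x y"
  shows "x (Suc i) * (x i * (y (Suc (Suc i)) * (y (Suc i) * z i))) =
    z (Suc (Suc i)) * (y (Suc i) * (y i * (x (Suc (Suc i)) * x (Suc i))))"
proof -
  have "x (Suc i) * (x i * (y (Suc (Suc i)) * (y (Suc i) * z i))) =
      x (Suc i) * (y (Suc (Suc i)) * (x i * (y (Suc i) * z i)))"
    using assms(2) by (simp add: commutingD_assoc [of x y])
  also have "\<dots> = z (Suc (Suc i)) * (y (Suc i) * (x (Suc (Suc i)) * (y i * x (Suc i))))"
    using assms(1) by (simp add: exchangingD [of x y z] exchangingD_assoc [of x y z])
  finally show ?thesis using assms(2) by (simp add: commutingD_assoc [of x y])
qed

lemma exchanging_double_second: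
  assumes "exchanging x y z" "commuting x z"
  shows "x i * (x (Suc i) * (y (Suc (Suc i)) * (z (Suc i) * z i))) =
    z (Suc (Suc i)) * (z (Suc i) * (y i * (x (Suc i) * x (Suc (Suc i)))))"
proof -
  have "x i * (x (Suc i) * (y (Suc (Suc i)) * (z (Suc i) * z i))) =
      x i * (z (Suc (Suc i)) * (y (Suc i) * (x (Suc (Suc i)) * z i)))"
    using assms(1) by (simp add: exchangingD_assoc [of x y z])
  also have "\<dots> = z (Suc (Suc i)) * (x i * (y (Suc i) * (z i * x (Suc (Suc i)))))"
    using assms(2) by (simp add: commutingD_assoc [of x z] commutingD [of x z])
  finally show ?thesis using assms(1) by (simp add: exchangingD_assoc [of x y z])
qed

lemma exchanging_double_third:
  assumes "exchanging x y z" "commuting y z"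
  shows "x i * (y (Suc i) * (y (Suc (Suc i)) * (z i * z (Suc i)))) =
    z (Suc i) * (z (Suc (Suc i)) * (y i * (y (Suc i) * x (Suc (Suc i)))))"
proof -
  have "x i * (y (Suc i) * (y (Suc (Suc i)) * (z i * z (Suc i)))) =
      x i * (y (Suc i) * (z i * (y (Suc (Suc i)) * z (Suc i))))"
    using assms(2) by (simp add: commutingD_assoc [of y z])
  also have "\<dots> = z (Suc i) * (y i * (z (Suc (Suc i)) * (y (Suc i) * x (Suc (Suc i)))))"
    using assms(1) by (simp add: exchangingD [of x y z] exchangingD_assoc [of x y z])
  finally show ?thesis using assms(2) by (simp add: commutingD_assoc [of y z])
qed

lemma dbl_rel: "(u, v) \<in> stable_rels \<Longrightarrow> abs_vb (dbl p u) = abs_vb (dbl p v)"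
proof (erule stable_rels.cases)
  fix x y i j
  assume uv: "u = pos_word [x i, y j]" "v = pos_word [y j, x i]" and t: "(x, y) \<in> comm_types"
    and far: "i + 1 < j \<or> j + 1 < i"
  obtain g h where gh: "x = reindex g" "y = reindex h" using comm_types_reindex [OF t] by metis
  have c: "gen (reindex g k) * gen (reindex h l) = gen (reindex h l) * gen (reindex g k)"
    "gen (reindex g k) * (gen (reindex h l) * a) = gen (reindex h l) * (gen (reindex g k) * a)"
    if "k + 1 < l \<or> l + 1 < k" for k l a
    using gen_comm [OF t] that unfolding gh
    by (simp_all add: commutingD [of "\<lambda>i. gen (reindex g i)" "\<lambda>i. gen (reindex h i)"]
        commutingD_assoc [of "\<lambda>i. gen (reindex g i)" "\<lambda>i. gen (reindex h i)"])
  show ?thesis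
    using far unfolding uv
    by (auto simp: dbl_gen_def gen_perm_idx transpose_def gh abs_vb_simps mult.assoc c)
next
  fix x y z i
  assume uv: "u = pos_word [x i, y (i + 1), z i]" "v = pos_word [z (i + 1), y i, x (i + 1)]"
    and t: "(x, y, z) \<in> exch_types"
  obtain f g h where gh: "x = reindex f" "y = reindex g" "z = reindex h"
    using exch_types_reindex [OF t] by metis
  let ?x = "\<lambda>i. gen (x i)" and ?y = "\<lambda>i. gen (y i)" and ?z = "\<lambda>i. gen (z i)"
  have e: "exchanging ?x ?y ?z" using t by (rule gen_exch)
  have c: "commuting ?x ?y" "commuting ?x ?z" "commuting ?y ?z"
    using t commuting_gens by (auto simp: exch_types_def)
  consider "p < i" | "p = i" | "p = i + 1" | "p = i + 2" | "p > i + 2" by linarith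
  then show ?thesis
    unfolding uv
    using exchangingD [OF e, of i] exchangingD [OF e, of "Suc i"] exchanging_double_first [OF e c(1), of i]
      exchanging_double_second [OF e c(2), of i] exchanging_double_third [OF e c(3), of i]
    by cases (auto simp: dbl_gen_def gen_perm_idx transpose_def gh abs_vb_simps mult.assoc)
next
  fix i assume uv: "u = pos_word [Rho i, Rho i]" "v = []"
  show ?thesis unfolding uv
    by (auto simp: dbl_gen_def transpose_def abs_vb_simps mult.assoc)
qed

lemma dbl_cong: "stable_eq X u v \<Longrightarrow> abs_vb (dbl p u) = abs_vb (dbl p v)"
proof (induction arbitrary: p rule: word_eq.induct)
  case (cong u u' v v')
  then show ?case by (simp add: dbl_append abs_vb_append end_pos_cong [OF cong.hyps(1)])
next
  case (cancel g b)
  then show ?case by (cases b) (simp_all add: abs_vb_simps)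
next
  case (rel u v)
  show ?case using rel.hyps(1) by (rule dbl_rel)
qed simp_all

lift_definition double :: "nat \<Rightarrow> vb \<Rightarrow> vb" is dbl
  using dbl_cong by (simp add: abs_vb_eq)

lemma double_abs: "double p (abs_vb w) = abs_vb (dbl p w)"
  by (simp add: double.abs_eq)

lemma double_one [simp]: "double p 1 = 1"
  by transfer (simp add: word_eq.refl)

text \<open>As for deletion, the strand doubled in the second factor is the one carried along by the first. On
  pure braids doubling is therefore a homomorphism.\<close>

lemma double_mult: "double p (x * y) = double p x * double (pos x p) y"
  by transfer (simp add: dbl_append word_eq.refl lists_UNIV)

lemma double_ginv: "double p (ginv x) = ginv (double (pos (ginv x) p) x)"
proof -
  have "double p (ginv x) * double (pos (ginv x) p) x = 1"
    by (simp flip: double_mult)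
  then show ?thesis by (metis ginv_ginv ginv_unique)
qed

lemma double_gen:
  "double p (gen g) =
    (if p = idx g then gen (reindex g (p + 1)) * gen g
     else if p = idx g + 1 then gen g * gen (reindex g p)
     else if p < idx g then gen (reindex g (idx g + 1)) else gen g)"
  using double_abs [of p "[(g, True)]"]
  by (auto simp: gen_def dbl_gen_def abs_vb_Nil simp flip: abs_vb_append)

text \<open>After strand \<open>p\<close> has been doubled, position \<open>q\<close> becomes \<open>thick p q\<close>; the position \<open>Suc p\<close> of the second
  copy is the only one that is not of this form.\<close>

definition thick :: "nat \<Rightarrow> nat \<Rightarrow> nat" where
  "thick p q = (if q \<le> p then q else Suc q)"

lemma thick_self [simp]: "thick p p = p"
  by (simp add: thick_def)

lemma thick_cases: "r = Suc p \<or> (\<exists>q. r = thick p q)"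
proof -
  have "r = Suc p \<or> r = thick p (if r \<le> p then r else r - 1)" by (auto simp: thick_def)
  then show ?thesis by blast
qed

lemma pos_double_gen:
  "pos (double p (gen g)) (thick p q) = thick (gen_perm g p) (gen_perm g q)"
  "pos (double p (gen g)) (Suc p) = Suc (gen_perm g p)"
  by (auto simp: double_gen thick_def gen_perm_idx transpose_def)

lemma pos_ginv_eqI: "pos x p = q \<Longrightarrow> pos (ginv x) q = p"
  by auto

lemma pos_double:
  "pos (double p x) (thick p q) = thick (pos x p) (pos x q)"
  "pos (double p x) (Suc p) = Suc (pos x p)"
proof (induction x arbitrary: p q rule: vb_induct)
  case (gen g x)
  { case 1 show ?case using gen by (simp add: double_mult pos_double_gen) }
  { case 2 show ?case using gen by (simp add: double_mult pos_double_gen) }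
next
  case (ginv g x)
  { case 1
    have "pos (double p (ginv (gen g))) (thick p q) = thick (gen_perm g p) (gen_perm g q)"
      unfolding double_ginv by (rule pos_ginv_eqI) (simp add: pos_double_gen)
    then show ?case using ginv by (simp add: double_mult) }
  { case 2
    have "pos (double p (ginv (gen g))) (Suc p) = Suc (gen_perm g p)"
      unfolding double_ginv by (rule pos_ginv_eqI) (simp add: pos_double_gen)
    then show ?case using ginv by (simp add: double_mult) }
qed simp_all

lemma pos_double_self: "pos (double p x) p = pos x p"
  using pos_double(1) [of p x p] by simp

lemma delete_double: "delete p (double p x) = x"
proof (induction x arbitrary: p rule: vb_induct)
  have g: "delete p (double p (gen g)) = gen g" for p g
    by (auto simp: double_gen delete_mult delete_gen gen_perm_idx transpose_def)
  {
    case (gen g x)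
    then show ?case by (simp add: double_mult delete_mult g pos_double_self)
  next
    case (ginv g x)
    have "delete p (double p (ginv (gen g))) = ginv (gen g)"
      using pos_double_self [of p "ginv (gen g)"]
      by (simp add: double_ginv delete_ginv g)
    then show ?case using ginv by (simp add: double_mult delete_mult pos_double_self)
  }
qed simp

text \<open>The simplicial identity. When the two doubled strands cross each other, the two sides traverse the
  four crossings in different orders and differ by one commutation of far generators.\<close>

lemma double_double:
  "p \<noteq> q \<Longrightarrow> double (thick p q) (double p x) = double (thick q p) (double q x)"
proof (induction x arbitrary: p q rule: vb_induct)
  have g: "double (thick p q) (double p (gen g)) = double (thick q p) (double q (gen g))"
    if "p \<noteq> q" for p q g
  proof -
    have "commuting (\<lambda>i. gen (reindex g i)) (\<lambda>i. gen (reindex g i))"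
      using commuting_gens by (cases g) auto
    note c = commutingD [OF this] commutingD_assoc [OF this]
    have "reindex g (idx g) = g" by simp
    then show ?thesis using that c [of "idx g" "idx g + 2"]
      by (auto simp: double_gen double_mult thick_def gen_perm_idx transpose_def mult.assoc)
  qed
  {
    case (gen g x)
    moreover have "gen_perm g p \<noteq> gen_perm g q" using gen.prems by (metis gen_perm_gen_perm)
    ultimately show ?case by (simp add: double_mult g pos_double_gen)
  next
    case (ginv g x)
    have pq: "gen_perm g p \<noteq> gen_perm g q" using ginv.prems by (metis gen_perm_gen_perm)
    have "double (thick p q) (double p (ginv (gen g))) = double (thick q p) (double q (ginv (gen g)))"
      using pos_double(1) [of p "ginv (gen g)" q] pos_double(1) [of q "ginv (gen g)" p] g [OF pq]
      by (simp add: double_ginv)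
    then show ?case
      using ginv pq pos_double(1) [of p "ginv (gen g)" q] pos_double(1) [of q "ginv (gen g)" p]
      by (simp add: double_mult)
  }
qed simp

section \<open>Pure and classical braids\<close>

definition span :: "vb_gen set \<Rightarrow> vb set" where
  "span X = abs_vb ` words X"

lemma span_generate: "span X = generate whole_group (gen ` X)"
  using group.generate_eq_eval_word [OF group_whole_group, of gen X]
  by (simp add: span_def abs_vb_eval [abs_def])

lemma span_one [simp]: "1 \<in> span X"
  unfolding span_def by (intro image_eqI [of _ _ "[]"]) (auto simp: abs_vb_simps)

lemma span_mult: "x \<in> span X \<Longrightarrow> y \<in> span X \<Longrightarrow> x * y \<in> span X"
  by (auto simp: span_def simp flip: abs_vb_append)

lemma span_ginv: "x \<in> span X \<Longrightarrow> ginv x \<in> span X"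
  by (auto simp: span_def simp flip: abs_vb_inv)

lemma span_gen: "g \<in> X \<Longrightarrow> gen g \<in> span X"
  unfolding gen_def span_def by (intro imageI) simp

lemma subgroup_span: "subgroup (span X) whole_group"
  by (rule group.subgroupI [OF group_whole_group])
    (auto intro: span_mult span_ginv span_one simp del: span_one)

lemma span_induct [consumes 1, case_names one gen ginv]:
  assumes "x \<in> span X" "P 1" "\<And>g x. g \<in> X \<Longrightarrow> x \<in> span X \<Longrightarrow> P x \<Longrightarrow> P (gen g * x)"
    "\<And>g x. g \<in> X \<Longrightarrow> x \<in> span X \<Longrightarrow> P x \<Longrightarrow> P (ginv (gen g) * x)"
  shows "P x"
proof -
  obtain w where "w \<in> words X" "x = abs_vb w" using assms(1) by (auto simp: span_def)
  then show ?thesis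
  proof (induction w arbitrary: x)
    case (Cons l w)
    then show ?case using assms(3,4) [of "fst l" "abs_vb w"]
      by (cases l) (auto simp: abs_vb_Cons span_def)
  qed (simp add: assms abs_vb_Nil)
qed

lemma span_induct_right [consumes 1, case_names one gen ginv]:
  assumes "x \<in> span X" "P 1" "\<And>g x. g \<in> X \<Longrightarrow> x \<in> span X \<Longrightarrow> P x \<Longrightarrow> P (x * gen g)"
    "\<And>g x. g \<in> X \<Longrightarrow> x \<in> span X \<Longrightarrow> P x \<Longrightarrow> P (x * ginv (gen g))"
  shows "P x"
proof -
  obtain w where "w \<in> words X" "x = abs_vb w" using assms(1) by (auto simp: span_def)
  then show ?thesis
  proof (induction w arbitrary: x rule: rev_induct)
    case (snoc l w)
    then show ?case using assms(3,4) [of "fst l" "abs_vb w"]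
      by (cases l) (auto simp: abs_vb_append abs_vb_letter span_def)
  qed (simp add: assms abs_vb_Nil)
qed

lemma double_span:
  assumes "x \<in> span X" "p \<in> S"
    and "\<And>g p. g \<in> X \<Longrightarrow> p \<in> S \<Longrightarrow> double p (gen g) \<in> span Y \<and> gen_perm g p \<in> S"
  shows "double p x \<in> span Y"
  using assms(1,2)
  by (induction arbitrary: p rule: span_induct)
    (auto simp: double_mult double_ginv assms(3) intro!: span_mult span_ginv)

definition pure :: "vb set" where
  "pure = {x. pos x = id}"

lemma pureD [simp]: "x \<in> pure \<Longrightarrow> pos x p = p"
  by (simp add: pure_def)

lemma pureI: "(\<And>p. pos x p = p) \<Longrightarrow> x \<in> pure"
  by (auto simp: pure_def)

lemma pure_one [simp]: "1 \<in> pure"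
  by (rule pureI) simp

lemma pure_mult: "x \<in> pure \<Longrightarrow> y \<in> pure \<Longrightarrow> x * y \<in> pure"
  by (rule pureI) simp

lemma pure_ginv: "x \<in> pure \<Longrightarrow> ginv x \<in> pure"
  by (rule pureI) (metis pos_ginv_pos pureD)

lemma pure_double: "x \<in> pure \<Longrightarrow> double p x \<in> pure"
  by (rule pureI) (use pos_double [of p x] thick_cases [of _ p] in \<open>metis pureD\<close>)

lemma double_pure_mult: "x \<in> pure \<Longrightarrow> double p (x * y) = double p x * double p y"
  by (simp add: double_mult)

lemma double_pure_ginv: "x \<in> pure \<Longrightarrow> double p (ginv x) = ginv (double p x)"
  by (simp add: double_ginv pure_ginv)

definition stable_braids :: "nat \<Rightarrow> vb set" where
  "stable_braids n = span (Sigma ` {1..<n})"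

definition stable_pure :: "nat \<Rightarrow> vb set" where
  "stable_pure n = stable_braids n \<inter> pure"

lemma stable_pure_one [simp]: "1 \<in> stable_pure n"
  by (simp add: stable_pure_def stable_braids_def)

lemma stable_pure_mult: "x \<in> stable_pure n \<Longrightarrow> y \<in> stable_pure n \<Longrightarrow> x * y \<in> stable_pure n"
  by (simp add: stable_pure_def stable_braids_def span_mult pure_mult)

lemma stable_pure_ginv: "x \<in> stable_pure n \<Longrightarrow> ginv x \<in> stable_pure n"
  by (simp add: stable_pure_def stable_braids_def span_ginv pure_ginv)

lemma subgroup_stable_pure: "subgroup (stable_pure n) whole_group"
  by (intro subgroup_whole_group stable_pure_mult stable_pure_ginv) simp_all

lemma double_stable_pure:
  assumes "x \<in> stable_pure n" "n \<ge> 1"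
  shows "double 1 x \<in> stable_pure (Suc n)"
proof -
  have "double 1 x \<in> span (Sigma ` {1..<Suc n})"
    by (rule double_span [of x "Sigma ` {1..<n}" 1 "{1..n}"])
      (use assms in \<open>auto simp: stable_pure_def stable_braids_def double_gen transpose_def
        intro!: span_mult span_gen\<close>)
  then show ?thesis using assms by (simp add: stable_pure_def stable_braids_def pure_double)
qed

section \<open>The kernel of deleting the first strand\<close>

subsection \<open>Loops of the first strand\<close>

primrec asc :: "nat \<Rightarrow> vb" where
  "asc 0 = 1"
| "asc (Suc j) = asc j * sg (Suc j)"

primrec desc :: "nat \<Rightarrow> vb" where
  "desc 0 = 1"
| "desc (Suc j) = sg (Suc j) * desc j"

text \<open>\<open>loop j\<close> takes the first strand round the strands \<open>2, \<dots>, j + 1\<close> together and back. Compared with the usual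
  generators \<open>A\<^bsub>1,j+1\<^esub> = loop j (loop (j - 1))\<^sup>-\<^sup>1\<close>, these are the ones that arise from cabling, and
  conjugation by \<open>\<sigma>\<^sub>i\<close>, \<open>i \<ge> 2\<close>, changes only one of them.\<close>

definition loop :: "nat \<Rightarrow> vb" where
  "loop j = asc j * desc j"

lemma loop_0 [simp]: "loop 0 = 1"
  by (simp add: loop_def)

lemma sg_far: "i + 1 < j \<or> j + 1 < i \<Longrightarrow> sg i * sg j = sg j * sg i"
  using commutingD [OF commuting_gens(1)] by blast

lemma sg_far_assoc: "i + 1 < j \<or> j + 1 < i \<Longrightarrow> sg i * (sg j * a) = sg j * (sg i * a)"
  using commutingD_assoc [OF commuting_gens(1)] by blast

lemma exchanging_sg: "exchanging sg sg sg"
  using gen_exch [of Sigma Sigma Sigma] by (simp add: exch_types_def)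

lemma sg_braid: "sg i * (sg (Suc i) * sg i) = sg (Suc i) * (sg i * sg (Suc i))"
  using exchangingD [OF exchanging_sg] .

lemma sg_braid_assoc: "sg i * (sg (Suc i) * (sg i * a)) = sg (Suc i) * (sg i * (sg (Suc i) * a))"
  using exchangingD_assoc [OF exchanging_sg] .

lemma asc_far: "Suc j < i \<Longrightarrow> sg i * asc j = asc j * sg i"
proof (induction j)
  case (Suc j)
  have "sg i * asc (Suc j) = (sg i * asc j) * sg (Suc j)" by (simp add: mult.assoc)
  also have "\<dots> = asc j * (sg i * sg (Suc j))" using Suc by (simp add: mult.assoc)
  finally show ?case using Suc.prems by (simp add: mult.assoc sg_far)
qed simp

lemma desc_far: "Suc j < i \<Longrightarrow> sg i * desc j = desc j * sg i"
proof (induction j)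
  case (Suc j)
  have "sg i * desc (Suc j) = sg (Suc j) * (sg i * desc j)"
    using Suc.prems by (simp add: sg_far_assoc)
  then show ?case using Suc by (simp add: mult.assoc)
qed simp

lemma asc_shift: "1 \<le> i \<Longrightarrow> i < j \<Longrightarrow> sg (Suc i) * asc j = asc j * sg i"
proof (induction j)
  case (Suc j)
  show ?case
  proof (cases "i = j")
    case True
    then obtain k where k: "j = Suc k" using Suc.prems by (cases j) auto
    have "sg (Suc j) * asc (Suc j) = (sg (Suc j) * asc k) * (sg j * sg (Suc j))"
      by (simp add: k mult.assoc)
    also have "\<dots> = asc k * (sg (Suc j) * (sg j * sg (Suc j)))"
      by (simp add: k mult.assoc asc_far)
    also have "\<dots> = asc (Suc j) * sg j" by (simp add: k mult.assoc flip: sg_braid)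
    finally show ?thesis using True by simp
  next
    case False
    then have "sg (Suc i) * asc (Suc j) = asc j * (sg i * sg (Suc j))"
      using Suc by (simp flip: mult.assoc)
    then show ?thesis using False Suc.prems by (simp add: sg_far mult.assoc)
  qed
qed simp

lemma desc_shift: "1 \<le> i \<Longrightarrow> i < j \<Longrightarrow> sg i * desc j = desc j * sg (Suc i)"
proof (induction j)
  case (Suc j)
  show ?case
  proof (cases "i = j")
    case True
    then obtain k where k: "j = Suc k" using Suc.prems by (cases j) auto
    have "sg j * desc (Suc j) = sg (Suc j) * (sg j * (sg (Suc j) * desc k))"
      by (simp add: k sg_braid_assoc)
    also have "\<dots> = desc (Suc j) * sg (Suc j)"
      by (simp add: k mult.assoc desc_far)
    finally show ?thesis using True by simp
  next
    case False
    then have "sg i * desc (Suc j) = sg (Suc j) * (sg i * desc j)"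
      using Suc.prems by (simp add: sg_far_assoc)
    then show ?thesis using False Suc by (simp add: mult.assoc)
  qed
qed simp

text \<open>For \<open>i \<le> j\<close> the generator slides through \<open>asc j\<close> with its index lowered and through \<open>desc j\<close> with the
  index restored.\<close>

lemma loop_comm:
  assumes "2 \<le> i" "i \<noteq> Suc j"
  shows "sg i * loop j = loop j * sg i"
proof (cases "i \<le> j")
  case True
  then obtain k where k: "i = Suc k" "1 \<le> k" "k < j" using assms by (cases i) auto
  have "sg i * loop j = asc j * (sg k * desc j)"
    using asc_shift [of k j] k unfolding loop_def by (simp flip: mult.assoc)
  then show ?thesis using desc_shift [of k j] k by (simp add: loop_def mult.assoc)
next
  case False
  then have "sg i * loop j = asc j * (sg i * desc j)"
    using assms asc_far [of j i] unfolding loop_def by (simp flip: mult.assoc)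
  then show ?thesis using False assms by (simp add: desc_far loop_def mult.assoc)
qed

text \<open>The only nontrivial case of the action of \<open>\<sigma>\<^sub>2, \<sigma>\<^sub>3, \<dots>\<close> on the loops. In terms of the products
  \<open>x\<^sub>1 \<cdots> x\<^sub>j\<close> of the generators of a free group it is Artin's action.\<close>

lemma loop_conj:
  "sg (Suc (Suc j)) * loop (Suc j) * ginv (sg (Suc (Suc j)))
     = loop j * ginv (loop (Suc j)) * loop (Suc (Suc j))"
  "ginv (sg (Suc (Suc j))) * loop (Suc j) * sg (Suc (Suc j))
     = loop (Suc (Suc j)) * ginv (loop (Suc j)) * loop j"
proof -
  let ?a = "sg (Suc j)" and ?b = "sg (Suc (Suc j))"
  have b: "?b * asc j = asc j * ?b" "?b * desc j = desc j * ?b"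
    by (simp_all add: asc_far desc_far)
  have e: "?a * (?b * ?a) = ?b * (?a * ?b)" by (rule sg_braid)
  have "?b * loop (Suc j) = (?b * asc j) * (?a * (?a * desc j))" by (simp add: loop_def mult.assoc)
  also have "\<dots> = asc j * (?b * (?a * (?a * desc j)))" by (simp add: b mult.assoc)
  also have "?b * (?a * (?a * desc j)) = ginv ?a * (?b * (?b * (?a * (?b * desc j))))"
  proof -
    have "?a * (?b * (?a * (?a * desc j))) = ?b * (?a * (?b * (?a * desc j)))"
      by (rule sg_braid_assoc)
    also have "\<dots> = ?b * (?b * (?a * (?b * desc j)))" by (simp add: sg_braid_assoc)
    finally show ?thesis by (metis ginv_left_cancel)
  qed
  finally have *: "?b * loop (Suc j) = asc j * (ginv ?a * (?b * (?b * (?a * (desc j * ?b)))))"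
    by (simp add: b)
  have "loop j * ginv (loop (Suc j)) * loop (Suc (Suc j)) = asc j * (ginv ?a * (?b * (?b * (?a * desc j))))"
    by (simp add: loop_def ginv_mult mult.assoc)
  with * show "?b * loop (Suc j) * ginv ?b = loop j * ginv (loop (Suc j)) * loop (Suc (Suc j))"
    by (simp add: mult.assoc)
  have "loop (Suc j) * ?b = asc j * (?a * (?a * (?b * desc j)))"
    by (simp add: loop_def mult.assoc b)
  also have "?a * (?a * (?b * desc j)) = ?b * (?a * (?b * (?b * (ginv ?a * desc j))))"
  proof -
    have "?a * (?a * (?b * (?a * (ginv ?a * desc j)))) = ?a * (?b * (?a * (?b * (ginv ?a * desc j))))"
      by (simp only: sg_braid_assoc)
    also have "\<dots> = ?b * (?a * (?b * (?b * (ginv ?a * desc j))))" by (simp only: sg_braid_assoc)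
    finally show ?thesis by simp
  qed
  also have "asc j * \<dots> = ?b * (asc j * (?a * (?b * (?b * (ginv ?a * desc j)))))"
    using b(1) by (simp flip: mult.assoc)
  finally show "ginv ?b * loop (Suc j) * ?b = loop (Suc (Suc j)) * ginv (loop (Suc j)) * loop j"
    by (simp add: loop_def ginv_mult mult.assoc)
qed

definition loops :: "nat \<Rightarrow> vb set" where
  "loops n = generate whole_group (loop ` {1..n})"

lemma subgroup_loops: "subgroup (loops n) whole_group"
  unfolding loops_def by (rule group.generate_is_subgroup) auto

lemma loops_one [simp]: "1 \<in> loops n"
  using subgroup.one_closed [OF subgroup_loops] by simp

lemma loops_mult: "x \<in> loops n \<Longrightarrow> y \<in> loops n \<Longrightarrow> x * y \<in> loops n"
  using subgroup.m_closed [OF subgroup_loops] by simp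

lemma loops_ginv: "x \<in> loops n \<Longrightarrow> ginv x \<in> loops n"
  using subgroup.m_inv_closed [OF subgroup_loops] by simp

lemma loop_in_loops: "j \<le> n \<Longrightarrow> loop j \<in> loops n"
proof (cases "j = 0")
  case False
  moreover assume "j \<le> n"
  ultimately show ?thesis unfolding loops_def by (intro generate.incl) auto
qed simp

lemma loops_induct [consumes 1, case_names one loop mult ginv]:
  assumes "x \<in> loops n" "P 1" "\<And>j. 1 \<le> j \<Longrightarrow> j \<le> n \<Longrightarrow> P (loop j)"
    "\<And>x y. P x \<Longrightarrow> P y \<Longrightarrow> P (x * y)" "\<And>x. P x \<Longrightarrow> P (ginv x)"
  shows "P x"
proof -
  have "x \<in> generate whole_group (loop ` {1..n})" using assms(1) by (simp add: loops_def)
  then show ?thesis by induction (use assms in auto)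
qed

lemma loop_conj_in_loops:
  assumes "2 \<le> i" "i \<le> n" "j \<le> n"
  shows "sg i * loop j * ginv (sg i) \<in> loops n \<and> ginv (sg i) * loop j * sg i \<in> loops n"
proof (cases "i = Suc j")
  case True
  then obtain k where "j = Suc k" using assms by (cases j) auto
  then show ?thesis using True assms
    by (auto simp: loop_conj intro!: loops_mult loops_ginv loop_in_loops)
next
  case False
  then have "sg i * loop j = loop j * sg i" using assms loop_comm by blast
  then have "sg i * loop j * ginv (sg i) = loop j" "ginv (sg i) * loop j * sg i = loop j"
    by (auto simp: mult.assoc) (metis ginv_left_cancel)
  then show ?thesis using assms loop_in_loops by simp
qed

lemma conj_in_loops:
  assumes "u \<in> loops n" "\<And>j. j \<le> n \<Longrightarrow> g * loop j * ginv g \<in> loops n"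
  shows "g * u * ginv g \<in> loops n"
  using assms(1)
proof (induction rule: loops_induct)
  case (mult x y)
  have "g * (x * y) * ginv g = (g * x * ginv g) * (g * y * ginv g)" by (simp add: mult.assoc)
  then show ?case using mult by (metis loops_mult)
next
  case (ginv x)
  have "g * ginv x * ginv g = ginv (g * x * ginv g)" by (simp add: ginv_mult mult.assoc)
  then show ?case using ginv by (metis loops_ginv)
qed (use assms(2) in auto)

lemma shift_conj_in_loops:
  assumes "b \<in> stable_braids n" "u \<in> loops n"
  shows "shift b * u * ginv (shift b) \<in> loops n"
  using assms unfolding stable_braids_def
proof (induction arbitrary: u rule: span_induct)
  case (gen g x)
  then obtain i where i: "g = Sigma i" "1 \<le> i" "i < n" by auto
  have "sg (Suc i) * (shift x * u * ginv (shift x)) * ginv (sg (Suc i)) \<in> loops n"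
    by (rule conj_in_loops) (use gen i loop_conj_in_loops in auto)
  then show ?case by (simp add: i ginv_mult mult.assoc)
next
  case (ginv g x)
  then obtain i where i: "g = Sigma i" "1 \<le> i" "i < n" by auto
  have "ginv (sg (Suc i)) * (shift x * u * ginv (shift x)) * ginv (ginv (sg (Suc i))) \<in> loops n"
    by (rule conj_in_loops) (use ginv i loop_conj_in_loops [of "Suc i" n] in auto)
  then show ?case by (simp add: i ginv_mult mult.assoc)
qed simp

subsection \<open>Coset enumeration\<close>

lemma stable_braids_one [simp]: "1 \<in> stable_braids n"
  by (simp add: stable_braids_def)

lemma stable_braids_mult: "x \<in> stable_braids n \<Longrightarrow> y \<in> stable_braids n \<Longrightarrow> x * y \<in> stable_braids n"
  by (simp add: stable_braids_def span_mult)

lemma stable_braids_ginv: "x \<in> stable_braids n \<Longrightarrow> ginv x \<in> stable_braids n"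
  by (simp add: stable_braids_def span_ginv)

lemma sg_in_stable_braids: "1 \<le> i \<Longrightarrow> i < n \<Longrightarrow> sg i \<in> stable_braids n"
  by (simp add: stable_braids_def span_gen)

text \<open>The braids whose first strand ends at position \<open>j + 1\<close> form the coset of \<open>asc j\<close>, and those whose first strand
  returns are products of loops and braids of the other strands.\<close>

definition factored :: "nat \<Rightarrow> nat \<Rightarrow> vb \<Rightarrow> bool" where
  "factored n j x \<longleftrightarrow> (\<exists>u\<in>loops n. \<exists>b\<in>stable_braids n. x = u * shift b * asc j)"

lemma factored_step:
  assumes "factored n j x" "asc j * g = v * shift c * asc k" "v \<in> loops n" "c \<in> stable_braids n"
  shows "factored n k (x * g)"
proof -
  obtain u b where ub: "u \<in> loops n" "b \<in> stable_braids n" "x = u * shift b * asc j"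
    using assms(1) by (auto simp: factored_def)
  have "x * g = (u * (shift b * v * ginv (shift b))) * shift (b * c) * asc k"
    using assms(2) by (simp add: ub mult.assoc)
  moreover have "u * (shift b * v * ginv (shift b)) \<in> loops n" "b * c \<in> stable_braids n"
    using ub assms by (auto intro: loops_mult shift_conj_in_loops stable_braids_mult)
  ultimately show ?thesis unfolding factored_def by blast
qed

text \<open>The coset table: right multiplication by \<open>\<sigma>\<^sub>i\<close> permutes the cosets, up to a factor that is a braid of the
  other strands or, when \<open>\<sigma>\<^sub>i\<^sup>\<plusminus>\<^sup>1\<close> crosses the first strand in the unexpected sense, a quotient of two consecutive
  loops.\<close>

lemma asc_sg:
  assumes "1 \<le> i" "i \<le> n" "j \<le> n"
  defines "k \<equiv> (if i = Suc j then Suc j else if i = j then j - 1 else j)"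
  shows "\<exists>v\<in>loops n. \<exists>c\<in>stable_braids n. asc j * sg i = v * shift c * asc k"
    and "\<exists>v\<in>loops n. \<exists>c\<in>stable_braids n. asc j * ginv (sg i) = v * shift c * asc k"
proof -
  have *: "(\<exists>v\<in>loops n. \<exists>c\<in>stable_braids n. asc j * sg i = v * shift c * asc k) \<and>
    (\<exists>v\<in>loops n. \<exists>c\<in>stable_braids n. asc j * ginv (sg i) = v * shift c * asc k)"
  proof -
    consider "i < j" | "i = j" | "i = Suc j" | "i > Suc j" by linarith
    then show ?thesis
    proof cases
      case 1
      then have "asc j * sg i = 1 * shift (sg i) * asc k"
        "asc j * ginv (sg i) = 1 * shift (ginv (sg i)) * asc k"
        using asc_shift [of i j] assms ginv_swap [OF asc_shift [of i j]] by (auto simp: k_def)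
      then show ?thesis
        using 1 assms by (meson stable_braids_ginv loops_one order_less_le_trans sg_in_stable_braids)
    next
      case 2
      then obtain m where m: "j = Suc m" using assms by (cases j) auto
      have "asc j * sg i = (loop j * ginv (loop m)) * shift 1 * asc k"
        "asc j * ginv (sg i) = 1 * shift 1 * asc k"
        using 2 m by (auto simp: k_def loop_def ginv_mult mult.assoc)
      moreover have "loop j * ginv (loop m) \<in> loops n"
        using m assms by (intro loops_mult loops_ginv loop_in_loops) auto
      ultimately show ?thesis by (meson stable_braids_one loops_one)
    next
      case 3
      then have "asc j * sg i = 1 * shift 1 * asc k"
        "asc j * ginv (sg i) = (loop j * ginv (loop i)) * shift 1 * asc k"
        by (auto simp: k_def loop_def ginv_mult mult.assoc)
      moreover have "loop j * ginv (loop i) \<in> loops n"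
        using 3 assms by (intro loops_mult loops_ginv loop_in_loops) auto
      ultimately show ?thesis by (meson stable_braids_one loops_one)
    next
      case 4
      then obtain m where m: "i = Suc m" "1 \<le> m" "m < n" using assms by (cases i) auto
      have "asc j * sg i = 1 * shift (sg m) * asc k"
        "asc j * ginv (sg i) = 1 * shift (ginv (sg m)) * asc k"
        using asc_far [of j i] ginv_swap [OF asc_far [of j i]] 4 m by (auto simp: k_def)
      then show ?thesis using m by (meson stable_braids_ginv loops_one sg_in_stable_braids)
    qed
  qed
  then show "\<exists>v\<in>loops n. \<exists>c\<in>stable_braids n. asc j * sg i = v * shift c * asc k"
    and "\<exists>v\<in>loops n. \<exists>c\<in>stable_braids n. asc j * ginv (sg i) = v * shift c * asc k" by auto
qed

lemma braid_factored:
  assumes "x \<in> stable_braids (Suc n)"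
  shows "\<exists>j\<le>n. pos x 1 = Suc j \<and> factored n j x"
  using assms unfolding stable_braids_def
proof (induction rule: span_induct_right)
  case one
  show ?case unfolding factored_def
    by (intro exI [of _ 0]) (auto intro!: bexI [of _ 1])
next
  case (gen g x)
  then obtain i j where i: "g = Sigma i" "1 \<le> i" "i \<le> n"
    and j: "j \<le> n" "pos x 1 = Suc j" "factored n j x" by auto
  let ?k = "if i = Suc j then Suc j else if i = j then j - 1 else j"
  have "factored n ?k (x * sg i)"
    using asc_sg(1) [OF i(2,3) j(1)] factored_step [OF j(3)] by blast
  moreover have "?k \<le> n" "pos (x * sg i) 1 = Suc ?k"
    using i j by (auto simp: transpose_def)
  ultimately show ?case unfolding i(1) by blast
next
  case (ginv g x)
  then obtain i j where i: "g = Sigma i" "1 \<le> i" "i \<le> n"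
    and j: "j \<le> n" "pos x 1 = Suc j" "factored n j x" by auto
  let ?k = "if i = Suc j then Suc j else if i = j then j - 1 else j"
  have "factored n ?k (x * ginv (sg i))"
    using asc_sg(2) [OF i(2,3) j(1)] factored_step [OF j(3)] by blast
  moreover have "?k \<le> n" "pos (x * ginv (sg i)) 1 = Suc ?k"
    using i j by (auto simp: transpose_def)
  ultimately show ?case unfolding i(1) by blast
qed

lemma loop_in_stable_pure: "j < n \<Longrightarrow> loop j \<in> stable_pure n"
proof -
  have "asc j \<in> stable_braids n \<and> desc j \<in> stable_braids n" if "j < n" for j n
    using that by (induction j) (auto intro!: stable_braids_mult sg_in_stable_braids)
  moreover have "pos (loop j) p = p" for p
  proof (induction j arbitrary: p)
    case (Suc j)
    have "loop (Suc j) = asc j * (sg (Suc j) * (sg (Suc j) * desc j))"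
      by (simp add: loop_def mult.assoc)
    then show ?case using Suc by (simp add: loop_def)
  qed simp
  ultimately show "j < n \<Longrightarrow> loop j \<in> stable_pure n"
    by (auto simp: stable_pure_def loop_def intro!: stable_braids_mult pureI)
qed

lemma delete_loop: "delete 1 (loop j) = 1"
proof -
  have a: "pos (asc j) 1 = Suc j \<and> delete 1 (asc j) = 1" for j
    by (induction j) (auto simp: delete_mult delete_gen)
  have d: "delete (Suc j) (desc j) = 1" for j
    by (induction j) (auto simp: delete_mult delete_gen)
  show ?thesis using a d by (simp add: loop_def delete_mult)
qed

lemma loops_stable_pure: "x \<in> loops n \<Longrightarrow> x \<in> stable_pure (Suc n)"
  by (induction rule: loops_induct) (auto intro: stable_pure_mult stable_pure_ginv loop_in_stable_pure)

lemma delete_loops: "x \<in> loops n \<Longrightarrow> delete 1 x = 1"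
proof -
  assume "x \<in> loops n"
  then have "x \<in> pure \<and> delete 1 x = 1"
    by (induction rule: loops_induct)
      (use delete_loop loop_in_stable_pure in \<open>auto simp: delete_mult delete_ginv pure_mult pure_ginv stable_pure_def\<close>)
  then show ?thesis ..
qed

lemma delete_shift:
  assumes "b \<in> stable_braids n"
  shows "delete 1 (shift b) = b"
proof -
  obtain w where w: "w \<in> words (Sigma ` {1..<n})" "b = abs_vb w"
    using assms by (auto simp: stable_braids_def span_def)
  have "words (Sigma ` {1..<n}) \<subseteq> words (vb_gens n)"
    by (rule lists_mono) (auto simp: vb_gens_def)
  then have "w \<in> words (vb_gens n)" using w(1) by blast
  then show ?thesis by (simp add: w(2) shift_abs delete_abs del_shift)
qed

lemma pos_shift: "pos (shift x) (Suc q) = Suc (pos x q)"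
proof (induction x arbitrary: q rule: vb_induct)
  case (gen g x)
  then show ?case by (simp add: gen_perm_idx transpose_def)
next
  case (ginv g x)
  then show ?case by (simp add: gen_perm_idx transpose_def)
qed simp_all

lemma stable_pure_factor:
  assumes "x \<in> stable_pure (Suc n)"
  obtains u b where "u \<in> loops n" "b \<in> stable_pure n" "x = u * shift b"
proof -
  obtain u b where ub: "u \<in> loops n" "b \<in> stable_braids n" "x = u * shift b"
    using braid_factored [of x n] assms by (auto simp: stable_pure_def factored_def)
  have "u \<in> pure" using loops_stable_pure ub by (auto simp: stable_pure_def)
  then have "pos (shift b) (Suc q) = Suc q" for q
    using assms pos_mult [of u "shift b" "Suc q"] by (simp add: ub(3)[symmetric] stable_pure_def)
  then have "b \<in> pure" by (auto simp: pos_shift intro: pureI)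
  then show thesis using that ub by (simp add: stable_pure_def)
qed

lemma delete_stable_pure: "x \<in> stable_pure (Suc n) \<Longrightarrow> delete 1 x \<in> stable_pure n"
proof (erule stable_pure_factor)
  fix u b assume "u \<in> loops n" "b \<in> stable_pure n" "x = u * shift b"
  moreover from this have "u \<in> pure" using loops_stable_pure by (auto simp: stable_pure_def)
  ultimately show "delete 1 x \<in> stable_pure n"
    by (auto simp: delete_mult delete_loops delete_shift stable_pure_def simp del: One_nat_def)
qed

text \<open>In a factorisation \<open>u * shift b\<close> of a pure braid, deleting the first strand leaves \<open>b\<close>.\<close>

lemma loops_kernel: "loops n = {x \<in> stable_pure (Suc n). delete 1 x = 1}"
proof (intro equalityI subsetI CollectI conjI)
  fix x assume "x \<in> {x \<in> stable_pure (Suc n). delete 1 x = 1}"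
  then have x: "x \<in> stable_pure (Suc n)" "delete 1 x = 1" by auto
  then obtain u b where ub: "u \<in> loops n" "b \<in> stable_pure n" "x = u * shift b" by (auto elim: stable_pure_factor)
  have "u \<in> pure" using ub loops_stable_pure by (auto simp: stable_pure_def)
  then have "delete 1 x = b" using ub by (auto simp: delete_mult delete_loops delete_shift stable_pure_def simp del: One_nat_def)
  then show "x \<in> loops n" using x ub by simp
qed (auto simp: loops_stable_pure delete_loops simp del: One_nat_def)

text \<open>Deleting the first strand is a retraction with kernel \<open>loops n\<close>, and doubling the first strand is a section of
  it.\<close>

lemma stable_pure_semidirect:
  assumes "n \<ge> 1"
  shows "internal_semidirect whole_group (stable_pure (Suc n)) (loops n) (double 1 ` stable_pure n)"
proof -
  let ?W = "(whole_group :: vb monoid)\<lparr>carrier := stable_pure (Suc n)\<rparr>"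
  have W: "group ?W"
    by (rule subgroup.subgroup_is_group [OF subgroup_stable_pure group_whole_group])
  have inv: "inv\<^bsub>?W\<^esub> x = ginv x" if "x \<in> stable_pure (Suc n)" for x
    using group.m_inv_consistent [OF group_whole_group subgroup_stable_pure that] by simp
  have pure: "x \<in> pure" if "x \<in> stable_pure m" for x m using that by (simp add: stable_pure_def)
  have subU: "subgroup (loops n) ?W"
    by (rule group.subgroupI [OF W])
      (use loops_stable_pure in \<open>auto simp: inv intro: loops_mult loops_ginv, metis loops_one empty_iff\<close>)
  have subD: "subgroup (double 1 ` stable_pure n) ?W"
  proof (rule group.subgroupI [OF W])
    show "double 1 ` stable_pure n \<subseteq> carrier ?W" using double_stable_pure assms by auto
    show "double 1 ` stable_pure n \<noteq> {}" using stable_pure_one by blast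
    fix x y assume "x \<in> double 1 ` stable_pure n" "y \<in> double 1 ` stable_pure n"
    then obtain a b where ab: "x = double 1 a" "y = double 1 b" "a \<in> stable_pure n" "b \<in> stable_pure n" by auto
    have "inv\<^bsub>?W\<^esub> x = double 1 (ginv a)"
      using ab assms by (simp add: inv double_stable_pure double_pure_ginv pure del: One_nat_def)
    then show "inv\<^bsub>?W\<^esub> x \<in> double 1 ` stable_pure n" using ab stable_pure_ginv by blast
    have "x * y = double 1 (a * b)" using ab pure by (simp add: double_pure_mult)
    then show "x \<otimes>\<^bsub>?W\<^esub> y \<in> double 1 ` stable_pure n" using ab stable_pure_mult by simp
  qed
  have "loops n \<lhd> ?W"
  proof (subst group.normal_inv_iff [OF W], intro conjI ballI subU)
    fix x u assume "x \<in> carrier ?W" "u \<in> loops n"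
    then have xu: "x \<in> stable_pure (Suc n)" "u \<in> stable_pure (Suc n)" "delete 1 u = 1"
      by (auto simp: loops_kernel)
    then have "delete 1 (x * u * ginv x) = 1"
      by (simp add: delete_mult delete_ginv pure pure_ginv stable_pure_mult stable_pure_ginv)
    then show "x \<otimes>\<^bsub>?W\<^esub> u \<otimes>\<^bsub>?W\<^esub> inv\<^bsub>?W\<^esub> x \<in> loops n"
      using xu by (simp add: inv loops_kernel stable_pure_mult stable_pure_ginv)
  qed
  moreover have "loops n \<inter> double 1 ` stable_pure n = {\<one>\<^bsub>whole_group\<^esub>}"
  proof -
    have "x = 1" if "x \<in> loops n" "x \<in> double 1 ` stable_pure n" for x
      using that delete_loops [of x n] delete_double [of 1] by auto
    moreover have "1 \<in> double 1 ` stable_pure n" by (intro image_eqI [of _ _ 1]) auto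
    ultimately show ?thesis by auto
  qed
  moreover have "loops n <#>\<^bsub>whole_group\<^esub> double 1 ` stable_pure n = stable_pure (Suc n)"
  proof (intro equalityI subsetI)
    fix x assume "x \<in> loops n <#>\<^bsub>whole_group\<^esub> double 1 ` stable_pure n"
    then show "x \<in> stable_pure (Suc n)"
      using loops_stable_pure double_stable_pure assms unfolding set_mult_def by (auto intro!: stable_pure_mult)
  next
    fix x assume x: "x \<in> stable_pure (Suc n)"
    \<comment> \<open>The component of \<open>x\<close> in the complement.\<close>
    define d where "d = double 1 (delete 1 x)"
    have d: "d \<in> double 1 ` stable_pure n" "d \<in> stable_pure (Suc n)"
      unfolding d_def using x delete_stable_pure double_stable_pure assms by auto
    have "delete 1 d = delete 1 x" by (simp add: d_def delete_double)
    then have "x * ginv d \<in> loops n"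
      using x d by (simp add: loops_kernel stable_pure_mult stable_pure_ginv delete_mult delete_ginv pure pure_ginv)
    moreover have "x = (x * ginv d) * d" by (simp add: mult.assoc)
    ultimately show "x \<in> loops n <#>\<^bsub>whole_group\<^esub> double 1 ` stable_pure n"
      using d unfolding set_mult_def whole_group_simps by blast
  qed
  ultimately show ?thesis
    unfolding internal_semidirect_def using subgroup_stable_pure subD by blast
qed

lemma stable_pure_1: "stable_pure 1 = {1}"
  by (auto simp: stable_pure_def stable_braids_def span_def abs_vb_simps)

section \<open>Cables\<close>

text \<open>The recursion of \<open>cabled\<close>, with the doubling operation in place of the degeneracy maps.\<close>

fun stable_cabled :: "vb \<Rightarrow> nat \<Rightarrow> nat \<Rightarrow> vb" where
  "stable_cabled g i (Suc (Suc j)) = double (i + Suc j) (stable_cabled g i (Suc j))"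
| "stable_cabled g (Suc (Suc i)) j = double 1 (stable_cabled g (Suc i) j)"
| "stable_cabled g i j = g"

lemma stable_cabled_pure: "g \<in> pure \<Longrightarrow> stable_cabled g i j \<in> pure"
  by (induction g i j rule: stable_cabled.induct) (auto intro: pure_double)

lemma stable_cabled_mult:
  "g \<in> pure \<Longrightarrow> h \<in> pure \<Longrightarrow> stable_cabled (g * h) i j = stable_cabled g i j * stable_cabled h i j"
proof (induction g i j rule: stable_cabled.induct)
  case (1 g i j)
  then show ?case by (simp add: double_pure_mult stable_cabled_pure)
next
  case ("2_1" g i)
  then show ?case by (simp add: double_pure_mult stable_cabled_pure)
next
  case ("2_2" g i)
  then show ?case by (simp add: double_pure_mult stable_cabled_pure)
qed simp_all

text \<open>By definition the first strand is cabled before the second one; the simplicial identity makes it possible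
  to cable the first strand last.\<close>

lemma stable_cabled_Suc:
  assumes "1 \<le> i" "1 \<le> j"
  shows "stable_cabled g (Suc i) j = double 1 (stable_cabled g i j)"
  using assms(2)
proof (induction j rule: dec_induct)
  case base
  obtain k where "i = Suc k" using assms(1) by (cases i) auto
  then show ?case by simp
next
  case (step j)
  then obtain k where j: "j = Suc k" by (cases j) auto
  have "double (Suc (i + j)) (double 1 (stable_cabled g i j)) = double 1 (double (i + j) (stable_cabled g i j))"
    using double_double [of 1 "i + j" "stable_cabled g i j"] assms(1) step.hyps by (simp add: thick_def)
  then show ?case using step.IH by (simp add: j)
qed

definition stable_cable :: "nat \<Rightarrow> nat \<Rightarrow> vb" where
  "stable_cable i j = stable_cabled (ginv (sg 1 * sg 1)) i j"

lemma double_asc_outside: "j < p \<Longrightarrow> 1 \<le> p \<Longrightarrow> double (Suc p) (asc j) = asc j \<and> pos (asc j) (Suc p) = Suc p"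
  by (induction j) (auto simp: double_mult double_gen transpose_def)

lemma double_desc_outside: "j < p \<Longrightarrow> 1 \<le> p \<Longrightarrow> double (Suc p) (desc j) = desc j"
  by (induction j) (auto simp: double_mult double_gen transpose_def)

lemma double_loop: "double (Suc (Suc j)) (loop (Suc j)) = loop (Suc (Suc j))"
proof -
  have "double (Suc (Suc j)) (asc (Suc j)) = asc (Suc (Suc j))"
    "pos (asc (Suc j)) (Suc (Suc j)) = Suc j"
    using double_asc_outside [of j "Suc j"]
    by (auto simp: double_mult double_gen mult.assoc)
  moreover have "double (Suc j) (desc (Suc j)) = desc (Suc (Suc j))"
    using double_desc_outside [of j "Suc j"]
    by (auto simp: double_mult double_gen mult.assoc)
  ultimately show ?thesis unfolding loop_def by (simp only: double_mult)
qed

lemma loop_pure: "loop j \<in> pure"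
  using loop_in_stable_pure [of j "Suc j"] by (simp add: stable_pure_def)

lemma stable_cable_1: "1 \<le> j \<Longrightarrow> stable_cable 1 j = ginv (loop j)"
proof (induction j rule: dec_induct)
  case base
  then show ?case by (simp add: stable_cable_def loop_def)
next
  case (step j)
  then obtain k where j: "j = Suc k" by (cases j) auto
  have "stable_cable 1 (Suc j) = double (Suc j) (stable_cable 1 j)" by (simp add: stable_cable_def j)
  also have "\<dots> = ginv (double (Suc j) (loop j))"
    using step.IH loop_pure by (simp add: double_pure_ginv)
  finally show ?case using j double_loop by simp
qed

lemma stable_cable_Suc: "1 \<le> i \<Longrightarrow> 1 \<le> j \<Longrightarrow> stable_cable (Suc i) j = double 1 (stable_cable i j)"
  by (simp add: stable_cable_def stable_cabled_Suc del: One_nat_def)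

section \<open>Freeness\<close>

subsection \<open>The free group\<close>

quotient_type 'g free_grp = "'g word" / "word_eq UNIV {}"
  by (rule equivp_word_eq_UNIV)

instantiation free_grp :: (type) mgroup
begin

lift_definition one_free_grp :: "'a free_grp" is "[]" .

lift_definition times_free_grp :: "'a free_grp \<Rightarrow> 'a free_grp \<Rightarrow> 'a free_grp" is "(@)"
  by (rule word_eq.cong)

lift_definition ginv_free_grp :: "'a free_grp \<Rightarrow> 'a free_grp" is inv_word
  by (rule word_eq_inv_cong)

instance
  by standard (transfer; simp add: word_eq.refl word_eq_inv_left)+

end

lemma eval_free_grp: "eval_word whole_group (\<lambda>x. abs_free_grp [(x, True)]) w = abs_free_grp w"
proof (induction w)
  case Nil
  show ?case by (simp add: one_free_grp_def)
next
  case (Cons l w)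
  then show ?case
    by (cases l) (auto simp: letter_val_def times_free_grp.abs_eq ginv_free_grp.abs_eq)
qed

text \<open>Words over \<open>X\<close> that agree in the free group on all letters therefore agree in the free group on \<open>X\<close>.\<close>

lemma word_eq_free_restrict:
  assumes "word_eq UNIV {} u v"
  shows "word_eq X {} (filter (\<lambda>l. fst l \<in> X) u) (filter (\<lambda>l. fst l \<in> X) v)"
proof -
  have f: "filter (\<lambda>l. fst l \<in> X) w \<in> words X" for w :: "'a word"
    by (induction w) auto
  show ?thesis using assms
  proof (induction rule: word_eq.induct)
    case (cong u u' v v')
    from cong.IH show ?case unfolding filter_append by (rule word_eq.cong)
  qed (auto intro: word_eq.refl [OF f] word_eq.sym word_eq.trans word_eq.cancel simp: word_eq.refl)
qed

lemma word_eq_free_trivial: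
  assumes "eval_word whole_group (\<lambda>x. abs_free_grp [(x, True)]) w = 1" "w \<in> words X"
  shows "word_eq X {} w []"
proof -
  have "word_eq UNIV {} w []"
    using assms(1) by (simp add: eval_free_grp one_free_grp_def free_grp.abs_eq_iff)
  then have "word_eq X {} (filter (\<lambda>l. fst l \<in> X) w) []" using word_eq_free_restrict by fastforce
  moreover have "filter (\<lambda>l. fst l \<in> X) w = w"
    using assms(2) by (induction w) auto
  ultimately show ?thesis by simp
qed

subsection \<open>The action on colourings\<close>

text \<open>Strands carry colours in a group \<open>G\<close>, and at a crossing the colour \<open>b\<close> of the lower strand becomes \<open>a b a\<^sup>-\<^sup>1\<close>, as
  for the Wirtinger generators of the fundamental group of the complement; virtual crossings change nothing. A
  special strand, marked \<open>Inr\<close>, is given the trivial colour, so that it does not affect the others, and keeps a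
  record of the strands under which it passes: the inverse of the element by which its Wirtinger generator is
  conjugated, read modulo that generator. As words act from left to right, the record grows on the right.\<close>

fun pass :: "vb_gen \<times> bool \<Rightarrow> (nat \<Rightarrow> 'a::mgroup + 'a) \<Rightarrow> nat \<Rightarrow> 'a + 'a" where
  "pass (Rho i, _) c = c(i := c (Suc i), Suc i := c i)"
| "pass (Sigma i, True) c =
     (case c i of
        Inr v \<Rightarrow> c(i := c (Suc i), Suc i := Inr v)
      | Inl a \<Rightarrow> c(i := map_sum (\<lambda>b. a * b * ginv a) (\<lambda>v. v * ginv a) (c (Suc i)), Suc i := Inl a))"
| "pass (Sigma i, False) c =
     (case c (Suc i) of
        Inr v \<Rightarrow> c(i := Inr v, Suc i := c i)
      | Inl a \<Rightarrow> c(i := Inl a, Suc i := map_sum (\<lambda>b. ginv a * b * a) (\<lambda>v. v * a) (c i)))"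

lemma pass_cancel: "pass (g, \<not> b) (pass (g, b) c) = c"
  by (cases g; cases b) (auto simp: mult.assoc fun_eq_iff sum.map_comp map_sum_def split: sum.splits)

lemma pass_rel: "(u, v) \<in> stable_rels \<Longrightarrow> fold pass u c = fold pass v c"
proof (erule stable_rels.cases)
  fix x y i j
  assume uv: "u = pos_word [x i, y j]" "v = pos_word [y j, x i]" and t: "(x, y) \<in> comm_types"
    and far: "i + 1 < j \<or> j + 1 < i"
  show ?thesis using far t unfolding uv comm_types_def
    by (auto simp: fun_eq_iff map_sum_def split: sum.splits)
next
  fix x y z i
  assume uv: "u = pos_word [x i, y (i + 1), z i]" "v = pos_word [z (i + 1), y i, x (i + 1)]"
    and t: "(x, y, z) \<in> exch_types"
  show ?thesis using t unfolding uv exch_types_def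
    by (auto simp: fun_eq_iff mult.assoc ginv_mult map_sum_def split: sum.splits)
next
  fix i assume uv: "u = pos_word [Rho i, Rho i]" "v = []"
  show ?thesis unfolding uv by (auto simp: fun_eq_iff)
qed

lift_definition act :: "vb \<Rightarrow> (nat \<Rightarrow> 'a::mgroup + 'a) \<Rightarrow> nat \<Rightarrow> 'a + 'a" is "fold pass"
  by (rule ext, rule fold_word_eq) (auto simp: pass_cancel pass_rel)

lemma act_one [simp]: "act 1 c = c"
  by transfer simp

lemma act_mult: "act (x * y) c = act y (act x c)"
  by transfer simp

lemma act_sg: "act (sg i) = pass (Sigma i, True)"
  unfolding gen_def by (rule ext) (simp add: act.abs_eq)

text \<open>The special strand is at position \<open>p\<close>. The colours of the others are chosen such that, if \<open>y 0 = 1\<close>, the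
  first \<open>j\<close> of them from position \<open>1\<close> on have the product \<open>y j\<close>.\<close>

definition colouring :: "(nat \<Rightarrow> 'a::mgroup) \<Rightarrow> nat \<Rightarrow> 'a \<Rightarrow> nat \<Rightarrow> 'a + 'a" where
  "colouring y p v q = (if q = p then Inr v
     else if q < p then Inl (ginv (y (q - 1)) * y q) else Inl (ginv (y (q - 2)) * y (q - 1)))"

lemma act_asc: "act (asc j) (colouring y 1 v) = colouring y (Suc j) v"
proof (induction j)
  case (Suc j)
  have "pass (Sigma (Suc j), True) (colouring y (Suc j) v) = colouring y (Suc (Suc j)) v"
    by (auto simp: colouring_def fun_eq_iff numeral_2_eq_2)
  then show ?case using Suc by (simp add: act_mult act_sg)
qed simp

text \<open>On the way back the special strand passes under its neighbours, and the inverse colours multiply to the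
  inverse of \<open>y j\<close>.\<close>

lemma act_desc:
  assumes "y 0 = 1"
  shows "act (desc j) (colouring y (Suc j) v) = colouring y 1 (v * ginv (y j))"
proof (induction j arbitrary: v)
  case 0
  then show ?case using assms by simp
next
  case (Suc j)
  have "pass (Sigma (Suc j), True) (colouring y (Suc (Suc j)) v)
      = colouring y (Suc j) (v * ginv (ginv (y j) * y (Suc j)))"
    by (auto simp: colouring_def fun_eq_iff numeral_2_eq_2)
  then show ?case using Suc by (simp add: act_mult act_sg ginv_mult mult.assoc)
qed

lemma act_loop:
  "y 0 = 1 \<Longrightarrow> act (loop j) (colouring y 1 v) = colouring y 1 (v * ginv (y j))"
  by (simp add: loop_def act_mult act_asc act_desc del: One_nat_def)

lemma act_ginv_loop:
  assumes "y 0 = 1"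
  shows "act (ginv (loop j)) (colouring y 1 v) = colouring y 1 (v * y j)"
proof -
  have "act (ginv (loop j)) (act (loop j) (colouring y 1 (v * y j))) = colouring y 1 (v * y j)"
    by (simp flip: act_mult)
  then show ?thesis using act_loop [where y = y, OF assms] by (simp add: mult.assoc)
qed

lemma act_eval_loops:
  assumes "y 0 = 1"
  shows "act (eval_word whole_group (\<lambda>j. ginv (loop j)) w) (colouring y 1 v)
    = colouring y 1 (v * eval_word whole_group y w)"
proof (induction w arbitrary: v)
  case (Cons l w)
  then show ?case
    using act_loop [where y = y, OF assms] act_ginv_loop [where y = y, OF assms]
    by (auto simp: letter_val_def act_mult mult.assoc simp del: One_nat_def)
qed simp

text \<open>With free generators for \<open>y 1, y 2, \<dots>\<close> the record of a word in the inverse loops is that word itself.\<close>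

theorem loops_free:
  assumes "eval_word whole_group (\<lambda>j. ginv (loop j)) w = 1" "w \<in> words {1..n}"
  shows "word_eq {1..n} {} w []"
proof -
  \<comment> \<open>The value at \<open>0\<close> is the empty product.\<close>
  define y where "y = (\<lambda>j. if j = 0 then 1 else abs_free_grp [(j :: nat, True)])"
  have "eval_word whole_group y w = 1"
  proof -
    have "colouring y 1 1 = colouring y 1 (eval_word whole_group y w)"
      using act_eval_loops [of y w 1] assms(1) by (simp add: y_def)
    from fun_cong [OF this, of 1] show ?thesis by (simp add: colouring_def)
  qed
  moreover have "eval_word whole_group y w
      = eval_word whole_group (\<lambda>x. abs_free_grp [(x, True)]) w"
    using assms(2) by (intro eval_word_eqI) (auto simp: y_def)
  ultimately show ?thesis using assms(2) by (intro word_eq_free_trivial) simp_all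
qed

section \<open>The decomposition on infinitely many strands\<close>

definition stable_V :: "nat \<Rightarrow> nat \<Rightarrow> vb set" where
  "stable_V n k = generate whole_group (stable_cable k ` {1..n - k})"

lemma stable_V_1: "stable_V (Suc n) 1 = loops n"
proof -
  have "stable_cable 1 ` {1..n} = (\<lambda>j. ginv (loop j)) ` {1..n}"
    by (rule image_cong) (auto simp: stable_cable_1 simp del: One_nat_def)
  moreover have "generate whole_group ((\<lambda>j. ginv (loop j)) ` {1..n}) = loops n"
  proof (rule group.generateI [OF group_whole_group, symmetric])
    show "subgroup (loops n) whole_group" by (rule subgroup_loops)
    show "(\<lambda>j. ginv (loop j)) ` {1..n} \<subseteq> loops n"
      by (intro image_subsetI loops_ginv loop_in_loops) simp
  next
    fix K assume K: "subgroup K (whole_group :: vb monoid)" "(\<lambda>j. ginv (loop j)) ` {1..n} \<subseteq> K"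
    have "loop j \<in> K" if "j \<in> {1..n}" for j
    proof -
      have "ginv (loop j) \<in> K" using K(2) that by blast
      then show ?thesis using subgroup.m_inv_closed [OF K(1), of "ginv (loop j)"] by simp
    qed
    then show "loops n \<subseteq> K"
      unfolding loops_def by (intro group.generate_subgroup_incl [OF group_whole_group _ K(1)]) auto
  qed
  ultimately show ?thesis by (simp add: stable_V_def)
qed

lemma stable_cable_stable_pure: "1 \<le> k \<Longrightarrow> 1 \<le> j \<Longrightarrow> stable_cable k j \<in> stable_pure (k + j)"
proof (induction k rule: dec_induct)
  case base
  then show ?case using loop_in_stable_pure [of j "Suc j"] stable_cable_1 [of j] by (simp add: stable_pure_ginv)
next
  case (step k)
  then show ?case using double_stable_pure [of "stable_cable k j" "k + j"] by (simp add: stable_cable_Suc del: One_nat_def)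
qed

lemma stable_pure_mono: "m \<le> n \<Longrightarrow> stable_pure m \<subseteq> stable_pure n"
  unfolding stable_pure_def stable_braids_def span_def by (intro Int_mono image_mono lists_mono order_refl) auto

lemma stable_cable_in_stable_pure: "1 \<le> k \<Longrightarrow> 1 \<le> j \<Longrightarrow> k + j \<le> n \<Longrightarrow> stable_cable k j \<in> stable_pure n"
  using stable_cable_stable_pure stable_pure_mono by blast

lemma group_hom_double:
  "group_hom ((whole_group :: vb monoid)\<lparr>carrier := stable_pure n\<rparr>) whole_group (double p)"
proof -
  have "group ((whole_group :: vb monoid)\<lparr>carrier := stable_pure n\<rparr>)"
    by (rule subgroup.subgroup_is_group [OF subgroup_stable_pure group_whole_group])
  then show ?thesis
    by (intro group_hom.intro group_hom_axioms.intro homI group_whole_group)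
      (auto simp: stable_pure_def double_pure_mult)
qed

lemma stable_V_Suc:
  assumes "1 \<le> k"
  shows "stable_V (Suc n) (Suc k) = double 1 ` stable_V n k"
proof -
  have c: "stable_cable k ` {1..n - k} \<subseteq> stable_pure n" 
    by (intro image_subsetI stable_cable_in_stable_pure) (use assms in auto)
  have "stable_cable (Suc k) ` {1..n - k} = double 1 ` stable_cable k ` {1..n - k}"
    unfolding image_image by (rule image_cong) (use assms in \<open>auto simp: stable_cable_Suc simp del: One_nat_def\<close>)
  then have "stable_V (Suc n) (Suc k)
      = double 1 ` generate (whole_group\<lparr>carrier := stable_pure n\<rparr>) (stable_cable k ` {1..n - k})"
    using group_hom.generate_img [OF group_hom_double, of "stable_cable k ` {1..n - k}" n 1] c
    by (simp add: stable_V_def)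
  also have "generate (whole_group\<lparr>carrier := stable_pure n\<rparr>) (stable_cable k ` {1..n - k}) = stable_V n k"
    using group.generate_consistent [OF group_whole_group c subgroup_stable_pure] by (simp add: stable_V_def)
  finally show ?thesis .
qed

lemma inj_double: "inj (double p)"
  by (metis delete_double injI)

text \<open>For \<open>k = 1\<close> the cables are inverse loops. Doubling the first strand is injective and raises \<open>k\<close> by one.\<close>

theorem stable_cable_free:
  assumes "1 \<le> k" "k \<le> n" "w \<in> words {1..n - k}" "eval_word whole_group (stable_cable k) w = 1"
  shows "word_eq {1..n - k} {} w []"
  using assms
proof (induction k arbitrary: n rule: dec_induct)
  case base
  have "eval_word whole_group (stable_cable 1) w = eval_word whole_group (\<lambda>j. ginv (loop j)) w"
    using base.prems by (intro eval_word_eqI) (auto simp: stable_cable_1 simp del: One_nat_def)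
  then show ?case using loops_free base.prems by simp
next
  case (step k)
  then obtain m where m: "n = Suc m" "k \<le> m" by (cases n) auto
  have c: "stable_cable k ` {1..m - k} \<subseteq> stable_pure m" 
    by (intro image_subsetI stable_cable_in_stable_pure) (use step.hyps m in auto)
  let ?G = "(whole_group :: vb monoid)\<lparr>carrier := stable_pure m\<rparr>"
  have "eval_word whole_group (stable_cable (Suc k)) w = eval_word whole_group (\<lambda>j. double 1 (stable_cable k j)) w"
    using step.prems step.hyps m
    by (intro eval_word_eqI) (auto simp: stable_cable_Suc simp del: One_nat_def)
  also have "\<dots> = double 1 (eval_word ?G (stable_cable k) w)"
    using group_hom.eval_word_hom [OF group_hom_double, of "stable_cable k" "{1..m - k}" m w 1]
      step.prems m c by simp
  also have "eval_word ?G (stable_cable k) w = eval_word whole_group (stable_cable k) w"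
    using group.eval_word_subgroup [OF group_whole_group subgroup_stable_pure c] step.prems m by simp
  finally have "eval_word whole_group (stable_cable k) w = 1"
    using step.prems inj_double [of 1] double_one by (metis injD)
  then show ?case using step.IH [of m] step.prems m by simp
qed

subsection \<open>Images of semi-direct products\<close>

lemma internal_semidirect_image:
  assumes G: "group G" and H: "group H" and K: "subgroup K G"
    and h: "h \<in> hom (G\<lparr>carrier := K\<rparr>) H" "inj_on h K"
    and W: "internal_semidirect G W A B" "W \<subseteq> K"
  shows "internal_semidirect H (h ` W) (h ` A) (h ` B)"
proof -
  have sub: "subgroup W G" and nA: "A \<lhd> (G\<lparr>carrier := W\<rparr>)" and sB: "subgroup B (G\<lparr>carrier := W\<rparr>)"
    and AB: "A \<inter> B = {\<one>\<^bsub>G\<^esub>}" "A <#>\<^bsub>G\<^esub> B = W"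
    using W(1) by (auto simp: internal_semidirect_def)
  have mult: "h (x \<otimes>\<^bsub>G\<^esub> y) = h x \<otimes>\<^bsub>H\<^esub> h y" if "x \<in> W" "y \<in> W" for x y
    using h(1) that W(2) by (auto simp: hom_def)
  have AW: "A \<subseteq> W" "B \<subseteq> W"
    using subgroup.subset [OF normal_imp_subgroup [OF nA]] subgroup.subset [OF sB] by auto
  have gW: "group (G\<lparr>carrier := W\<rparr>)" using subgroup.subgroup_is_group [OF sub G] .
  have inj: "inj_on h W" using h(2) W(2) by (rule inj_on_subset)
  have ghW: "group_hom (G\<lparr>carrier := W\<rparr>) H h"
    using gW H h(1) W(2) by (intro group_hom.intro group_hom_axioms.intro) (auto simp: hom_def)
  have subH: "subgroup (h ` W) H"
    using group_hom.img_is_subgroup [OF ghW] by simp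
  have gH: "group (H\<lparr>carrier := h ` W\<rparr>)" using subgroup.subgroup_is_group [OF subH H] .
  have gh: "group_hom (G\<lparr>carrier := W\<rparr>) (H\<lparr>carrier := h ` W\<rparr>) h"
    using gW gH mult by (intro group_hom.intro group_hom_axioms.intro) (auto simp: hom_def)
  have "subgroup (h ` B) (H\<lparr>carrier := h ` W\<rparr>)" "subgroup (h ` A) (H\<lparr>carrier := h ` W\<rparr>)"
    using group_hom.subgroup_img_is_subgroup [OF gh] sB normal_imp_subgroup [OF nA] by auto
  moreover have "h ` A \<lhd> (H\<lparr>carrier := h ` W\<rparr>)"
  proof (subst group.normal_inv_iff [OF gH], intro conjI ballI)
    show "subgroup (h ` A) (H\<lparr>carrier := h ` W\<rparr>)" by fact
    fix y b assume "y \<in> carrier (H\<lparr>carrier := h ` W\<rparr>)" "b \<in> h ` A"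
    then obtain x a where xa: "x \<in> W" "a \<in> A" "y = h x" "b = h a" by auto
    have "x \<otimes>\<^bsub>G\<^esub> a \<otimes>\<^bsub>G\<^esub> inv\<^bsub>G\<lparr>carrier := W\<rparr>\<^esub> x \<in> A"
      using nA xa unfolding group.normal_inv_iff [OF gW] by auto
    moreover have "h (x \<otimes>\<^bsub>G\<^esub> a \<otimes>\<^bsub>G\<^esub> inv\<^bsub>G\<lparr>carrier := W\<rparr>\<^esub> x)
        = y \<otimes>\<^bsub>H\<^esub> b \<otimes>\<^bsub>H\<^esub> inv\<^bsub>H\<lparr>carrier := h ` W\<rparr>\<^esub> y"
      using xa AW group.inv_closed [OF gW, of x] subgroup.m_closed [OF sub]
        group_hom.hom_inv [OF gh, of x] by (simp add: mult subsetD)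
    ultimately show "y \<otimes>\<^bsub>H\<lparr>carrier := h ` W\<rparr>\<^esub> b \<otimes>\<^bsub>H\<lparr>carrier := h ` W\<rparr>\<^esub>
        inv\<^bsub>H\<lparr>carrier := h ` W\<rparr>\<^esub> y \<in> h ` A"
      by simp (metis imageI)
  qed
  moreover have "h ` A \<inter> h ` B = {\<one>\<^bsub>H\<^esub>}"
  proof -
    have "h ` A \<inter> h ` B = h ` (A \<inter> B)" using inj_on_image_Int [OF inj AW] by simp
    then show ?thesis using AB(1) group_hom.hom_one [OF ghW] by simp
  qed
  moreover have "h ` A <#>\<^bsub>H\<^esub> h ` B = h ` W"
  proof -
    have "h ` A <#>\<^bsub>H\<^esub> h ` B = h ` (A <#>\<^bsub>G\<^esub> B)"
      using AW mult unfolding set_mult_def by (auto simp: image_iff) (metis subsetD)+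
    then show ?thesis using AB(2) by simp
  qed
  ultimately show ?thesis unfolding internal_semidirect_def using subH by blast
qed

lemma internal_semidirect_subset: "internal_semidirect G W A B \<Longrightarrow> A \<subseteq> W \<and> B \<subseteq> W"
  unfolding internal_semidirect_def
  using normal_imp_subgroup subgroup.subset by fastforce

lemma iterated_semidirect_image:
  assumes "group G" "group H" "subgroup K G" "h \<in> hom (G\<lparr>carrier := K\<rparr>) H" "inj_on h K"
    and "iterated_semidirect G As W" "W \<subseteq> K"
  shows "iterated_semidirect H (map (image h) As) (h ` W)"
  using assms(6,7)
proof (induction As arbitrary: W rule: induct_list012)
  case 1
  have "h \<one>\<^bsub>G\<^esub> = \<one>\<^bsub>H\<^esub>"
    using hom_one [OF assms(4)] subgroup.subgroup_is_group [OF assms(3,1)] assms(2) by simp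
  then show ?case using 1 by simp
next
  case (2 A)
  have "group (G\<lparr>carrier := W\<rparr>)" using 2 assms(1) subgroup.subgroup_is_group by auto
  then have "group_hom (G\<lparr>carrier := W\<rparr>) H h"
    using assms(2,4) 2 by (intro group_hom.intro group_hom_axioms.intro) (auto simp: hom_def)
  then show ?case using 2 group_hom.img_is_subgroup by fastforce
next
  case (3 A A' As)
  then obtain B where B: "internal_semidirect G W A B" "iterated_semidirect G (A' # As) B" by auto
  then have "iterated_semidirect H (map (image h) (A' # As)) (h ` B)"
    using 3 internal_semidirect_subset by blast
  moreover have "internal_semidirect H (h ` W) (h ` A) (h ` B)"
    using internal_semidirect_image assms B 3 by blast
  ultimately show ?case by auto
qed

subsection \<open>The induction\<close>

theorem stable_pure_iterated:
  assumes "n \<ge> 2"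
  shows "iterated_semidirect whole_group (map (stable_V n) [1..<n]) (stable_pure n)"
  using assms
proof (induction n rule: dec_induct)
  case base
  have "loops 1 = stable_pure 2"
    using stable_pure_1 delete_stable_pure [of _ 1] loops_kernel [of 1] by (auto simp: numeral_2_eq_2)
  then have "stable_V 2 1 = stable_pure 2" using stable_V_1 [of 1] by (simp add: numeral_2_eq_2)
  then show ?case using subgroup_stable_pure by (simp add: numeral_2_eq_2 upt_rec)
next
  case (step n)
  have "iterated_semidirect whole_group (map (image (double 1)) (map (stable_V n) [1..<n])) (double 1 ` stable_pure n)"
    by (rule iterated_semidirect_image [OF group_whole_group group_whole_group subgroup_stable_pure])
      (use step group_hom_double inj_double in \<open>auto intro: group_hom.homh inj_on_subset\<close>)
  moreover have "map (image (double 1)) (map (stable_V n) [1..<n]) = map (stable_V (Suc n)) [2..<Suc n]"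
  proof -
    have "[2..<Suc n] = map Suc [1..<n]" using step.hyps by (simp add: map_Suc_upt numeral_2_eq_2)
    then show ?thesis by (auto simp: stable_V_Suc)
  qed
  moreover have "[1..<Suc n] = 1 # 2 # [3..<Suc n]" "[2..<Suc n] = 2 # [3..<Suc n]"
    using step.hyps upt_conv_Cons [of 1 "Suc n"] upt_conv_Cons [of 2 "Suc n"]
    by (simp_all add: numeral_2_eq_2 numeral_3_eq_3 del: upt_Suc)
  ultimately show ?case
    using stable_pure_semidirect [of n] stable_V_1 [of n] step.hyps by (auto simp del: upt_Suc One_nat_def)
qed

section \<open>Doubling the generators of the virtual pure braid group\<close>

definition stable_conj :: "nat \<Rightarrow> nat \<Rightarrow> vb \<Rightarrow> vb" where
  "stable_conj i j a = list_prod whole_group (map (\<lambda>i. rh i) (rev [i + 1..<j])) * a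
     * list_prod whole_group (map (\<lambda>i. rh i) [i + 1..<j])"

definition stable_lam :: "nat \<Rightarrow> nat \<Rightarrow> vb" where
  "stable_lam i j = (if i < j then stable_conj i j (rh i * ginv (sg i)) else stable_conj j i (ginv (sg j) * rh j))"

lemma list_prod_whole_group: "list_prod whole_group xs = prod_list xs"
  by (simp add: list_prod_def prod_list.eq_foldr)

lemma stable_conj_base [simp]: "stable_conj k (Suc k) a = a"
  by (simp add: stable_conj_def list_prod_whole_group)

lemma stable_conj_Suc: "k < l \<Longrightarrow> stable_conj k (Suc l) a = rh l * stable_conj k l a * rh l"
  by (simp add: stable_conj_def list_prod_whole_group mult.assoc)

lemma rh_far: "i + 1 < j \<or> j + 1 < i \<Longrightarrow> rh i * rh j = rh j * rh i"
  using commutingD [OF commuting_gens(2)] by blast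

lemma rh_sg_far: "i + 1 < j \<or> j + 1 < i \<Longrightarrow> rh i * sg j = sg j * rh i"
  using commutingD [OF commuting_gens(4)] by blast

lemma rh_braid: "rh i * (rh (Suc i) * rh i) = rh (Suc i) * (rh i * rh (Suc i))"
  "rh i * (rh (Suc i) * (rh i * a)) = rh (Suc i) * (rh i * (rh (Suc i) * a))"
proof -
  have "exchanging rh rh rh"
    using gen_exch [of Rho Rho Rho] by (simp add: exch_types_def)
  then show "rh i * (rh (Suc i) * rh i) = rh (Suc i) * (rh i * rh (Suc i))"
    "rh i * (rh (Suc i) * (rh i * a)) = rh (Suc i) * (rh i * (rh (Suc i) * a))"
    by (rule exchangingD, rule exchangingD_assoc)
qed

text \<open>The mixed relation expresses every \<open>\<sigma>\<close> by a lower one and virtual generators.\<close>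

lemma ginv_sg_Suc: "ginv (sg (Suc i)) = rh i * (rh (Suc i) * (ginv (sg i) * (rh (Suc i) * rh i)))"
proof (rule ginv_unique)
  have "exchanging rh rh sg"
    using gen_exch [of Rho Rho Sigma] by (simp add: exch_types_def)
  then have "sg (Suc i) * (rh i * (rh (Suc i) * a)) = rh i * (rh (Suc i) * (sg i * a))" for a
    by (rule exchangingD_assoc [symmetric])
  then show "sg (Suc i) * (rh i * (rh (Suc i) * (ginv (sg i) * (rh (Suc i) * rh i)))) = 1"
    by simp
qed

lemma stable_conj_far:
  assumes "\<And>j. k + 1 < j \<Longrightarrow> rh j * a = a * rh j" "k < l" "l < j"
  shows "rh j * stable_conj k l a = stable_conj k l a * rh j"
  using assms(2,3)
proof (induction l)
  case (Suc l)
  show ?case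
  proof (cases "k = l")
    case True
    then show ?thesis using Suc assms(1) by simp
  next
    case False
    then have "k < l" using Suc by simp
    have r: "rh j * rh l = rh l * rh j" using Suc.prems by (intro rh_far) auto
    have "rh j * stable_conj k (Suc l) a = (rh j * rh l) * stable_conj k l a * rh l"
      using \<open>k < l\<close> by (simp add: stable_conj_Suc mult.assoc)
    also have "\<dots> = rh l * (rh j * stable_conj k l a) * rh l" by (simp add: r mult.assoc)
    also have "\<dots> = rh l * stable_conj k l a * (rh j * rh l)"
      using Suc \<open>k < l\<close> by (simp add: mult.assoc)
    finally show ?thesis using \<open>k < l\<close> by (simp add: r stable_conj_Suc mult.assoc)
  qed
qed simp

lemma stable_conj_pure: "a \<in> pure \<Longrightarrow> k < l \<Longrightarrow> stable_conj k l a \<in> pure"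
proof (induction l)
  case (Suc l)
  then show ?case
    by (cases "k = l") (auto simp: stable_conj_Suc intro!: pureI)
qed simp

lemma rh_conj_op:
  assumes "m = (*) \<or> m = (\<lambda>x y. y * x)"
  shows "rh l * m x y * rh l = m (rh l * x * rh l) (rh l * y * rh l)"
  using assms by (auto simp: mult.assoc)

text \<open>Induction on \<open>l\<close>, for both kinds of generators at once. They behave alike except for the order of the two
  factors when an end of the pair is doubled; the operation \<open>m\<close>, multiplication or its opposite, records that
  order.\<close>

lemma double_stable_conj:
  fixes a :: "nat \<Rightarrow> vb" and m :: "vb \<Rightarrow> vb \<Rightarrow> vb"
  assumes m: "m = (*) \<or> m = (\<lambda>x y. y * x)"
    and pure: "a k \<in> pure"
    and far: "\<And>j. k + 1 < j \<Longrightarrow> rh j * a k = a k * rh j"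
    and base: "\<And>i. double i (a k) =
      (if i < k then a (Suc k) else if i = k then m (stable_conj k (Suc (Suc k)) (a k)) (a (Suc k))
       else if i = Suc k then m (stable_conj k (Suc (Suc k)) (a k)) (a k) else a k)"
    and kl: "k < l"
  shows "double i (stable_conj k l (a k)) =
      (if i < k then stable_conj (Suc k) (Suc l) (a (Suc k))
       else if i = k then m (stable_conj k (Suc l) (a k)) (stable_conj (Suc k) (Suc l) (a (Suc k)))
       else if i < l then stable_conj k (Suc l) (a k)
       else if i = l then m (stable_conj k (Suc l) (a k)) (stable_conj k l (a k))
       else stable_conj k l (a k))"
proof -
  have "Suc k \<le> l" using kl by simp
  then show ?thesis
  proof (induction l arbitrary: i rule: dec_induct)
    case base
    then show ?case using assms(4) by simp
  next
    case (step l)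
    then have kl: "k < l" by simp
    let ?F = "\<lambda>l. stable_conj k l (a k)"
    have dbl: "double i (?F (Suc l)) =
      double i (rh l) * double (transpose l (Suc l) i) (?F l) * double (transpose l (Suc l) i) (rh l)"
      using stable_conj_pure [OF pure kl] by (simp add: stable_conj_Suc [OF kl] double_mult)
    note IH = step.IH
    consider "i < l" | "i = l" | "i = Suc l" | "i > Suc l" by linarith
    then show ?case
    proof cases
      case 1
      have F: "?F (Suc (Suc l)) = rh (Suc l) * ?F (Suc l) * rh (Suc l)"
        "stable_conj (Suc k) (Suc (Suc l)) (a (Suc k)) =
          rh (Suc l) * stable_conj (Suc k) (Suc l) (a (Suc k)) * rh (Suc l)"
        using kl by (auto intro: stable_conj_Suc)
      have "double i (?F (Suc l)) = rh (Suc l) * double i (?F l) * rh (Suc l)"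
        using 1 by (simp add: dbl double_gen transpose_def)
      then show ?thesis using 1 kl by (simp add: IH F rh_conj_op [OF m])
    next
      case 2
      have "double l (?F (Suc l)) = rh (Suc l) * (rh l * ?F l * rh l) * rh (Suc l)"
        using kl by (simp add: dbl [unfolded 2] double_gen IH mult.assoc)
      also have "\<dots> = ?F (Suc (Suc l))" using kl by (simp add: stable_conj_Suc)
      finally show ?thesis using kl 2 by simp
    next
      case 3
      have F: "rh (Suc l) * ?F (Suc l) * rh (Suc l) = ?F (Suc (Suc l))"
        "rh l * ?F l * rh l = ?F (Suc l)"
        using kl by (auto simp: stable_conj_Suc)
      have c: "rh (Suc l) * ?F l = ?F l * rh (Suc l)"
        by (rule stable_conj_far) (use far kl in auto)
      have c': "rh (Suc l) * ?F l * rh (Suc l) = ?F l"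
        "rh (Suc l) * (?F l * (rh (Suc l) * b)) = ?F l * b" for b
        by (simp_all add: c mult.assoc flip: mult.assoc [of "rh (Suc l)" "?F l"])
      have "rh l * ?F (Suc (Suc l)) * rh l
          = rh l * (rh (Suc l) * (rh l * (?F l * (rh l * (rh (Suc l) * rh l)))))"
        using kl by (simp add: stable_conj_Suc mult.assoc)
      also have "\<dots> = rh (Suc l) * (rh l * ((rh (Suc l) * ?F l * rh (Suc l)) * (rh l * rh (Suc l))))"
        by (simp add: rh_braid mult.assoc)
      also have "\<dots> = ?F (Suc (Suc l))" using kl by (simp add: c' stable_conj_Suc mult.assoc)
      finally have s: "rh l * ?F (Suc (Suc l)) * rh l = ?F (Suc (Suc l))" .
      have "double i (?F (Suc l))
          = rh l * (rh (Suc l) * m (?F (Suc l)) (?F l) * rh (Suc l)) * rh l"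
        using kl by (simp add: dbl [unfolded 3] 3 double_gen IH mult.assoc)
      also have "\<dots> = m (?F (Suc (Suc l))) (?F (Suc l))"
        by (simp only: rh_conj_op [OF m] F c'(1) s)
      finally show ?thesis using kl 3 by simp
    next
      case 4
      then have "double i (?F (Suc l)) = rh l * ?F l * rh l"
        using kl by (simp add: dbl double_gen transpose_def IH)
      then show ?thesis using 4 kl by (simp add: stable_conj_Suc)
    qed
  qed
qed

lemma rh_ginv_sg_far: "i + 1 < j \<or> j + 1 < i \<Longrightarrow> rh i * ginv (sg j) = ginv (sg j) * rh i"
  using ginv_swap [of "sg j" "rh i" "sg j"] rh_sg_far [of i j] by simp

lemma double_lam_adjacent:
  "double i (rh k * ginv (sg k)) =
      (if i < k then rh (Suc k) * ginv (sg (Suc k))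
       else if i = k then stable_conj k (Suc (Suc k)) (rh k * ginv (sg k)) * (rh (Suc k) * ginv (sg (Suc k)))
       else if i = Suc k then stable_conj k (Suc (Suc k)) (rh k * ginv (sg k)) * (rh k * ginv (sg k))
       else rh k * ginv (sg k))"
  "double i (ginv (sg k) * rh k) =
      (if i < k then ginv (sg (Suc k)) * rh (Suc k)
       else if i = k then (ginv (sg (Suc k)) * rh (Suc k)) * stable_conj k (Suc (Suc k)) (ginv (sg k) * rh k)
       else if i = Suc k then (ginv (sg k) * rh k) * stable_conj k (Suc (Suc k)) (ginv (sg k) * rh k)
       else ginv (sg k) * rh k)"
proof -
  show "double i (rh k * ginv (sg k)) =
      (if i < k then rh (Suc k) * ginv (sg (Suc k))
       else if i = k then stable_conj k (Suc (Suc k)) (rh k * ginv (sg k)) * (rh (Suc k) * ginv (sg (Suc k)))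
       else if i = Suc k then stable_conj k (Suc (Suc k)) (rh k * ginv (sg k)) * (rh k * ginv (sg k))
       else rh k * ginv (sg k))"
  proof -
    have "rh k * (rh (Suc k) * (ginv (sg (Suc k)) * ginv (sg k)))
        = rh (Suc k) * (rh k * (ginv (sg k) * (rh (Suc k) * (rh k * ginv (sg k)))))"
      unfolding ginv_sg_Suc by (simp add: rh_braid mult.assoc)
    then show ?thesis
      by (auto simp: double_mult double_ginv double_gen stable_conj_Suc ginv_mult mult.assoc transpose_def)
  qed
  show "double i (ginv (sg k) * rh k) =
      (if i < k then ginv (sg (Suc k)) * rh (Suc k)
       else if i = k then (ginv (sg (Suc k)) * rh (Suc k)) * stable_conj k (Suc (Suc k)) (ginv (sg k) * rh k)
       else if i = Suc k then (ginv (sg k) * rh k) * stable_conj k (Suc (Suc k)) (ginv (sg k) * rh k)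
       else ginv (sg k) * rh k)"
  proof -
    have "ginv (sg (Suc k)) * (rh (Suc k) * rh k)
        = rh k * (rh (Suc k) * (ginv (sg k) * (rh (Suc k) * (rh k * (rh (Suc k) * rh k)))))"
      unfolding ginv_sg_Suc by (simp add: mult.assoc)
    also have "\<dots> = rh k * (rh (Suc k) * (ginv (sg k) * (rh k * rh (Suc k))))"
      using rh_braid(2) [of k "rh k"] by simp
    finally have "ginv (sg (Suc k)) * (rh (Suc k) * rh k)
        = rh k * (rh (Suc k) * (ginv (sg k) * (rh k * rh (Suc k))))" .
    then show ?thesis
      by (auto simp: double_mult double_ginv double_gen stable_conj_Suc ginv_mult mult.assoc transpose_def)
  qed
qed

lemma double_stable_lam:
  assumes "k < l"
  shows "double i (stable_lam k l) =
      (if i < k then stable_lam (Suc k) (Suc l)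
       else if i = k then stable_lam k (Suc l) * stable_lam (Suc k) (Suc l)
       else if i < l then stable_lam k (Suc l)
       else if i = l then stable_lam k (Suc l) * stable_lam k l else stable_lam k l)"
    and "double i (stable_lam l k) =
      (if i < k then stable_lam (Suc l) (Suc k)
       else if i = k then stable_lam (Suc l) (Suc k) * stable_lam (Suc l) k
       else if i < l then stable_lam (Suc l) k
       else if i = l then stable_lam l k * stable_lam (Suc l) k else stable_lam l k)"
proof -
  have far: "rh j * (rh k * ginv (sg k)) = rh k * ginv (sg k) * rh j"
    "rh j * (ginv (sg k) * rh k) = ginv (sg k) * rh k * rh j" if "k + 1 < j" for j
  proof -
    have "rh j * (rh k * ginv (sg k)) = (rh j * rh k) * ginv (sg k)" by (simp add: mult.assoc)
    also have "\<dots> = rh k * (rh j * ginv (sg k))" using that by (simp add: rh_far [of j k] mult.assoc)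
    finally show "rh j * (rh k * ginv (sg k)) = rh k * ginv (sg k) * rh j"
      using that by (simp add: rh_ginv_sg_far [of j k] mult.assoc)
    have "rh j * (ginv (sg k) * rh k) = (rh j * ginv (sg k)) * rh k" by (simp add: mult.assoc)
    also have "\<dots> = ginv (sg k) * (rh j * rh k)"
      using that by (simp add: rh_ginv_sg_far [of j k] mult.assoc)
    finally show "rh j * (ginv (sg k) * rh k) = ginv (sg k) * rh k * rh j"
      using that by (simp add: rh_far [of j k] mult.assoc)
  qed
  have pure: "rh k * ginv (sg k) \<in> pure" "ginv (sg k) * rh k \<in> pure"
    by (auto intro!: pureI)
  have "double i (stable_conj k l (rh k * ginv (sg k))) =
      (if i < k then stable_conj (Suc k) (Suc l) (rh (Suc k) * ginv (sg (Suc k)))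
       else if i = k then stable_conj k (Suc l) (rh k * ginv (sg k)) *
         stable_conj (Suc k) (Suc l) (rh (Suc k) * ginv (sg (Suc k)))
       else if i < l then stable_conj k (Suc l) (rh k * ginv (sg k))
       else if i = l then stable_conj k (Suc l) (rh k * ginv (sg k)) * stable_conj k l (rh k * ginv (sg k))
       else stable_conj k l (rh k * ginv (sg k)))"
    by (rule double_stable_conj [where a = "\<lambda>k. rh k * ginv (sg k)" and m = "(*)"])
      (use assms far pure double_lam_adjacent(1) in auto)
  then show "double i (stable_lam k l) =
      (if i < k then stable_lam (Suc k) (Suc l)
       else if i = k then stable_lam k (Suc l) * stable_lam (Suc k) (Suc l)
       else if i < l then stable_lam k (Suc l)
       else if i = l then stable_lam k (Suc l) * stable_lam k l else stable_lam k l)"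
    using assms by (simp add: stable_lam_def)
  have "double i (stable_conj k l (ginv (sg k) * rh k)) =
      (if i < k then stable_conj (Suc k) (Suc l) (ginv (sg (Suc k)) * rh (Suc k))
       else if i = k then stable_conj (Suc k) (Suc l) (ginv (sg (Suc k)) * rh (Suc k)) *
         stable_conj k (Suc l) (ginv (sg k) * rh k)
       else if i < l then stable_conj k (Suc l) (ginv (sg k) * rh k)
       else if i = l then stable_conj k l (ginv (sg k) * rh k) * stable_conj k (Suc l) (ginv (sg k) * rh k)
       else stable_conj k l (ginv (sg k) * rh k))"
    by (rule double_stable_conj [where a = "\<lambda>k. ginv (sg k) * rh k" and m = "\<lambda>x y. y * x"])
      (use assms far pure double_lam_adjacent(2) in auto)
  then show "double i (stable_lam l k) =
      (if i < k then stable_lam (Suc l) (Suc k)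
       else if i = k then stable_lam (Suc l) (Suc k) * stable_lam (Suc l) k
       else if i < l then stable_lam (Suc l) k
       else if i = l then stable_lam l k * stable_lam (Suc l) k else stable_lam l k)"
    using assms by (simp add: stable_lam_def)
qed

lemma stable_lam_pure: "k \<noteq> l \<Longrightarrow> stable_lam k l \<in> pure"
  using stable_conj_pure [OF pureI, of "rh k * ginv (sg k)" k l]
    stable_conj_pure [OF pureI, of "ginv (sg l) * rh l" l k]
  by (simp add: stable_lam_def)

lemma stable_lam_21_12: "stable_lam 2 1 * stable_lam 1 2 = ginv (sg 1 * sg 1)"
  by (simp add: stable_lam_def numeral_2_eq_2 ginv_mult mult.assoc)

section \<open>Back to finitely many strands\<close>

text \<open>The homomorphism that adds trivial strands \<open>0\<close> and \<open>n + 1, n + 2, \<dots>\<close> to a braid on \<open>n\<close> strands. All words of a class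
  have the same value.\<close>

definition realize :: "vb_gen word set \<Rightarrow> vb" where
  "realize A = the_elem (abs_vb ` A)"

abbreviation "vb_words n \<equiv> words (vb_gens n)"
abbreviation "vb_cls n \<equiv> wclass (vb_gens n) (vb_rels n)"

lemma vb_cls_eq_iff: "u \<in> vb_words n \<Longrightarrow> v \<in> vb_words n \<Longrightarrow> vb_cls n u = vb_cls n v \<longleftrightarrow> abs_vb u = abs_vb v"
  by (auto simp: wclass_eq_iff vb_word_eq abs_vb_eq intro: stable_eq_restrict elim: word_eq_mono)

lemma realize_vb_cls:
  assumes "w \<in> vb_words n"
  shows "realize (vb_cls n w) = abs_vb w"
proof -
  have "abs_vb v = abs_vb w" if "v \<in> vb_cls n w" for v
  proof -
    have "stable_eq (vb_gens n) w v" using that by (simp add: wclass_def vb_word_eq)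
    then have "stable_eq UNIV w v" by (rule word_eq_mono) auto
    then show ?thesis by (simp add: abs_vb_eq word_eq.sym)
  qed
  moreover have "w \<in> vb_cls n w"
    using word_eq.refl [OF assms] by (simp add: wclass_def)
  ultimately have "abs_vb ` vb_cls n w = {abs_vb w}" by blast
  then show ?thesis by (simp add: realize_def)
qed

lemma group_VB [simp]: "group (VB n)"
  by (simp add: VB_def)

lemma VB_closed [simp]:
  "\<one>\<^bsub>VB n\<^esub> \<in> carrier (VB n)"
  "x \<in> carrier (VB n) \<Longrightarrow> y \<in> carrier (VB n) \<Longrightarrow> x \<otimes>\<^bsub>VB n\<^esub> y \<in> carrier (VB n)"
  "x \<in> carrier (VB n) \<Longrightarrow> inv\<^bsub>VB n\<^esub> x \<in> carrier (VB n)"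
  using group.is_monoid [OF group_VB] by (simp_all add: monoid.m_closed group.inv_closed)

lemma VB_carrier_iff: "x \<in> carrier (VB n) \<longleftrightarrow> (\<exists>w \<in> vb_words n. x = vb_cls n w)"
  by (auto simp: VB_def carrier_presented_group)

lemma realize_span: "realize ` carrier (VB n) = span (vb_gens n)"
  by (force simp: VB_carrier_iff span_def realize_vb_cls image_iff)

lemma group_hom_realize: "group_hom (VB n) whole_group realize"
proof (intro group_hom.intro group_hom_axioms.intro homI)
  fix x y assume "x \<in> carrier (VB n)" "y \<in> carrier (VB n)"
  then obtain u v where uv: "u \<in> vb_words n" "x = vb_cls n u" "v \<in> vb_words n" "y = vb_cls n v"
    by (auto simp: VB_carrier_iff)
  then have "x \<otimes>\<^bsub>VB n\<^esub> y = vb_cls n (u @ v)" by (simp add: VB_def mult_presented_group)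
  then show "realize (x \<otimes>\<^bsub>VB n\<^esub> y) = realize x \<otimes>\<^bsub>whole_group\<^esub> realize y"
    using uv by (simp add: realize_vb_cls abs_vb_append)
qed simp_all

lemma inj_realize: "inj_on realize (carrier (VB n))"
proof (rule inj_onI)
  fix x y assume "x \<in> carrier (VB n)" "y \<in> carrier (VB n)" and eq: "realize x = realize y"
  then obtain u v where "u \<in> vb_words n" "x = vb_cls n u" "v \<in> vb_words n" "y = vb_cls n v"
    by (auto simp: VB_carrier_iff)
  then show "x = y" using eq by (simp add: realize_vb_cls vb_cls_eq_iff)
qed

lemmas realize_mult = group_hom.hom_mult [OF group_hom_realize, simplified]
lemmas realize_one = group_hom.hom_one [OF group_hom_realize, simplified]
lemmas realize_inv = group_hom.hom_inv [OF group_hom_realize, simplified]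

definition bounded :: "nat \<Rightarrow> vb \<Rightarrow> vb_gen word set" where
  "bounded n = inv_into (carrier (VB n)) realize"

lemma realize_bounded: "x \<in> span (vb_gens n) \<Longrightarrow> realize (bounded n x) = x"
  by (simp add: bounded_def f_inv_into_f realize_span)

lemma bounded_closed: "x \<in> span (vb_gens n) \<Longrightarrow> bounded n x \<in> carrier (VB n)"
  by (simp add: bounded_def inv_into_into realize_span)

lemma bounded_realize: "x \<in> carrier (VB n) \<Longrightarrow> bounded n (realize x) = x"
  by (simp add: bounded_def inj_realize)

lemma bounded_image: "W \<subseteq> carrier (VB n) \<Longrightarrow> bounded n ` realize ` W = W"
  using bounded_realize by (force simp: image_image)

lemma realize_closed: "x \<in> carrier (VB n) \<Longrightarrow> realize x \<in> span (vb_gens n)"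
  using realize_span by blast

lemma VB_eqI: "x \<in> carrier (VB n) \<Longrightarrow> y \<in> carrier (VB n) \<Longrightarrow> realize x = realize y \<Longrightarrow> x = y"
  using inj_realize by (blast dest: inj_onD)

lemma bounded_hom: "bounded n \<in> hom (whole_group\<lparr>carrier := span (vb_gens n)\<rparr>) (VB n)"
proof (rule homI)
  fix x y
  assume "x \<in> carrier ((whole_group :: vb monoid)\<lparr>carrier := span (vb_gens n)\<rparr>)"
    "y \<in> carrier ((whole_group :: vb monoid)\<lparr>carrier := span (vb_gens n)\<rparr>)"
  then have xy: "x \<in> span (vb_gens n)" "y \<in> span (vb_gens n)" by auto
  show "bounded n (x \<otimes>\<^bsub>whole_group\<lparr>carrier := span (vb_gens n)\<rparr>\<^esub> y)
      = bounded n x \<otimes>\<^bsub>VB n\<^esub> bounded n y"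
    using xy by (intro VB_eqI [of _ n])
      (auto simp: realize_mult realize_bounded bounded_closed span_mult)
qed (simp add: bounded_closed)

lemma inj_bounded: "inj_on (bounded n) (span (vb_gens n))"
  by (metis inj_onI realize_bounded)

lemma vb_class_cls: "vb_class n g = vb_cls n [(g, True)]"
  by (simp add: vb_class_def gen_class_eq)

lemma vb_class_closed: "g \<in> vb_gens n \<Longrightarrow> vb_class n g \<in> carrier (VB n)"
  unfolding VB_carrier_iff vb_class_cls by (intro bexI [of _ "[(g, True)]"]) auto

lemma realize_vb_class: "g \<in> vb_gens n \<Longrightarrow> realize (vb_class n g) = gen g"
  by (simp add: vb_class_cls realize_vb_cls gen_def)

lemma sigma_closed: "i \<in> {1..<n} \<Longrightarrow> sigma n i \<in> carrier (VB n)"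
  by (auto simp: sigma_def vb_gens_def intro: vb_class_closed)

lemma rho_closed: "i \<in> {1..<n} \<Longrightarrow> rho n i \<in> carrier (VB n)"
  by (auto simp: rho_def vb_gens_def intro: vb_class_closed)

lemma realize_sigma: "i \<in> {1..<n} \<Longrightarrow> realize (sigma n i) = sg i"
  by (auto simp: sigma_def vb_gens_def intro: realize_vb_class)

lemma realize_rho: "i \<in> {1..<n} \<Longrightarrow> realize (rho n i) = rh i"
  by (auto simp: rho_def vb_gens_def intro: realize_vb_class)

subsection \<open>Pure braids\<close>

text \<open>Products of permutations are compositions, applied from right to left, while strands are followed from left to
  right; hence the inverse.\<close>

lemma eval_perm:
  "w \<in> vb_words n \<Longrightarrow> eval_word (sym_group n) gen_perm w = pos (ginv (abs_vb w))"
proof (induction w)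
  case Nil
  then show ?case by (auto simp: sym_group_one abs_vb_Nil fun_eq_iff)
next
  case (Cons l w)
  obtain g b where l: "l = (g, b)" by force
  have g: "g \<in> vb_gens n" using Cons l by auto
  then have p: "gen_perm g permutes {1..n}"
    by (auto simp: vb_gens_iff gen_perm_idx intro!: permutes_swap_id)
  have "inv' (gen_perm g) = gen_perm g" by (simp add: gen_perm_idx)
  then have "letter_val (sym_group n) gen_perm l = gen_perm g"
    using p by (auto simp: l letter_val_def sym_group_carrier)
  then show ?case using Cons
    by (auto simp: l sym_group_mult fun_eq_iff abs_vb_Cons ginv_mult)
qed

lemma vb_perm_eq:
  assumes "x \<in> carrier (VB n)"
  shows "vb_perm n x = pos (ginv (realize x))"
proof -
  obtain w where w: "w \<in> vb_words n" "x = vb_cls n w" using assms by (auto simp: VB_carrier_iff)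
  have "vb_perm n x = eval_word (sym_group n) gen_perm w"
    unfolding vb_perm_def w(2)
  proof (rule induced_hom_wclass [OF w(1)])
    fix u v assume uv: "word_eq (vb_gens n) (vb_rels n) u v"
    then have "u \<in> vb_words n" "v \<in> vb_words n" using word_eq_words by auto
    moreover from this have "abs_vb u = abs_vb v" using uv by (simp add: wclass_eq_iff flip: vb_cls_eq_iff)
    ultimately show "eval_word (sym_group n) gen_perm u = eval_word (sym_group n) gen_perm v"
      by (simp add: eval_perm)
  qed
  then show ?thesis using w by (simp add: eval_perm realize_vb_cls)
qed

lemma VP_iff: "x \<in> VP n \<longleftrightarrow> x \<in> carrier (VB n) \<and> realize x \<in> pure"
proof -
  have "pos (ginv y) = id \<longleftrightarrow> y \<in> pure" for y
  proof
    assume "pos (ginv y) = id"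
    then show "y \<in> pure" using pos_pos_ginv [of y] by (auto intro: pureI)
  next
    assume "y \<in> pure"
    then show "pos (ginv y) = id" using pure_ginv [of y] by (simp add: pure_def)
  qed
  moreover have "x \<in> VP n \<longleftrightarrow> x \<in> carrier (VB n) \<and> vb_perm n x = id"
    by (simp add: VP_def kernel_def sym_group_one)
  ultimately show ?thesis using vb_perm_eq by metis
qed

lemma subgroup_VP: "subgroup (VP n) (VB n)"
proof (rule group.subgroupI [OF group_VB])
  show "VP n \<noteq> {}"
    using VB_closed(1) realize_one VP_iff by (metis empty_iff pure_one)
qed (auto simp: VP_iff realize_mult realize_inv pure_mult pure_ginv)

lemma realize_pure_braids: "realize ` pure_braids n = stable_pure n"
proof -
  have s: "sigma n ` {1..<n} \<subseteq> carrier (VB n)" using sigma_closed by blast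
  have "realize ` sigma n ` {1..<n} = gen ` Sigma ` {1..<n}"
    unfolding image_image by (rule image_cong) (auto simp: realize_sigma)
  then have c: "realize ` classical_braids n = stable_braids n"
    using group_hom.generate_img [OF group_hom_realize s]
    by (simp add: classical_braids_def stable_braids_def span_generate)
  have "classical_braids n \<subseteq> carrier (VB n)"
    unfolding classical_braids_def using s by (intro group.generate_incl) auto
  then have "pure_braids n = {x \<in> classical_braids n. realize x \<in> pure}"
    by (auto simp: pure_braids_def VP_iff)
  then show ?thesis using c by (auto simp: stable_pure_def)
qed

lemma pure_braids_closed: "pure_braids n \<subseteq> carrier (VB n)"
  by (auto simp: pure_braids_def VP_iff)

lemma vb_incl_vb_cls:
  assumes "w \<in> vb_words m" "m \<le> n"
  shows "vb_incl n (vb_cls m w) = vb_cls n w"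
proof -
  have e: "eval_word (VB n) (vb_class n) u = vb_cls n u" if "u \<in> vb_words m" for u
    using eval_word_gen_class [of u "vb_gens n" "vb_rels n"] vb_words_mono [OF assms(2) that]
    by (simp add: VB_def vb_class_def [abs_def])
  have "vb_incl n (vb_cls m w) = eval_word (VB n) (vb_class n) w"
    unfolding vb_incl_def
  proof (rule induced_hom_wclass [OF assms(1)])
    fix u v assume uv: "word_eq (vb_gens m) (vb_rels m) u v"
    then have w: "u \<in> vb_words m" "v \<in> vb_words m" using word_eq_words by auto
    moreover from this have "abs_vb u = abs_vb v" using uv by (simp add: wclass_eq_iff flip: vb_cls_eq_iff)
    ultimately show "eval_word (VB n) (vb_class n) u = eval_word (VB n) (vb_class n) v"
      using vb_words_mono [OF assms(2)] by (simp add: e vb_cls_eq_iff)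
  qed
  then show ?thesis using e assms by simp
qed

lemma vb_incl:
  assumes "x \<in> carrier (VB m)" "m \<le> n"
  shows "vb_incl n x \<in> carrier (VB n)" "realize (vb_incl n x) = realize x"
proof -
  obtain w where "w \<in> vb_words m" "x = vb_cls m w" using assms by (auto simp: VB_carrier_iff)
  then show "vb_incl n x \<in> carrier (VB n)" "realize (vb_incl n x) = realize x"
    using assms(2) vb_words_mono [OF assms(2)]
    by (auto simp: vb_incl_vb_cls realize_vb_cls VB_carrier_iff)
qed

subsection \<open>Degeneracy maps\<close>

lemma list_prod_VB:
  assumes "set is \<subseteq> {1..<n}"
  shows "list_prod (VB n) (map (rho n) is) \<in> carrier (VB n)"
    "realize (list_prod (VB n) (map (rho n) is)) = list_prod whole_group (map (\<lambda>i. rh i) is)"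
proof -
  have "list_prod (VB n) (map (rho n) is) \<in> carrier (VB n) \<and>
    realize (list_prod (VB n) (map (rho n) is)) = list_prod whole_group (map (\<lambda>i. rh i) is)"
    using assms
    by (induction "is") (auto simp: list_prod_def realize_one realize_mult rho_closed realize_rho)
  then show "list_prod (VB n) (map (rho n) is) \<in> carrier (VB n)"
    "realize (list_prod (VB n) (map (rho n) is)) = list_prod whole_group (map (\<lambda>i. rh i) is)" by auto
qed

lemma rho_conj_VB:
  assumes "1 \<le> i" "j \<le> n" "g \<in> carrier (VB n)"
  shows "rho_conj n i j g \<in> carrier (VB n)" "realize (rho_conj n i j g) = stable_conj i j (realize g)"
proof -
  have s: "set (rev [i + 1..<j]) \<subseteq> {1..<n}" "set [i + 1..<j] \<subseteq> {1..<n}" using assms by auto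
  note l = list_prod_VB [OF s(1)] list_prod_VB [OF s(2)]
  show "rho_conj n i j g \<in> carrier (VB n)"
    unfolding rho_conj_def using l assms(3) by (simp add:)
  show "realize (rho_conj n i j g) = stable_conj i j (realize g)"
    unfolding rho_conj_def stable_conj_def using l assms(3)
    by (simp add: realize_mult)
qed

lemma lam_VB:
  assumes "k \<in> {1..n}" "l \<in> {1..n}" "k \<noteq> l"
  shows "lam n k l \<in> VP n" "realize (lam n k l) = stable_lam k l"
proof -
  have b: "rho n i \<otimes>\<^bsub>VB n\<^esub> inv\<^bsub>VB n\<^esub> (sigma n i) \<in> carrier (VB n)"
    "inv\<^bsub>VB n\<^esub> (sigma n i) \<otimes>\<^bsub>VB n\<^esub> rho n i \<in> carrier (VB n)"
    "realize (rho n i \<otimes>\<^bsub>VB n\<^esub> inv\<^bsub>VB n\<^esub> (sigma n i)) = rh i * ginv (sg i)"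
    "realize (inv\<^bsub>VB n\<^esub> (sigma n i) \<otimes>\<^bsub>VB n\<^esub> rho n i) = ginv (sg i) * rh i"
    if "i \<in> {1..<n}" for i
    using that by (simp_all add: sigma_closed rho_closed realize_mult realize_inv realize_sigma
        realize_rho)
  have "lam n k l \<in> carrier (VB n) \<and> realize (lam n k l) = stable_lam k l"
    using assms b rho_conj_VB by (auto simp: lam_def stable_lam_def)
  then show "lam n k l \<in> VP n" "realize (lam n k l) = stable_lam k l"
    using stable_lam_pure assms(3) by (auto simp: VP_iff)
qed

lemma double_span_gens:
  assumes "x \<in> span (vb_gens n)" "1 \<le> p" "p \<le> n"
  shows "double p x \<in> span (vb_gens (Suc n))"
  by (rule double_span [of x "vb_gens n" p "{1..n}"])
    (use assms in \<open>auto simp: vb_gens_iff double_gen gen_perm_idx transpose_def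
      intro!: span_mult span_gen\<close>)

text \<open>Restricted to pure braids on \<open>n\<close> strands, doubling is a homomorphism, and it has the prescribed values on
  the \<open>\<lambda>\<^bsub>kl\<^esub>\<close>.\<close>

lemma doubles_strand_exists:
  assumes "1 \<le> i" "i \<le> n"
  shows "\<exists>s. doubles_strand n i s"
proof
  let ?s = "\<lambda>x. bounded (n + 1) (double i (realize x))"
  have cl: "double i (realize x) \<in> span (vb_gens (n + 1))" if "x \<in> VP n" for x
    using that double_span_gens [of "realize x" n i] assms realize_closed by (simp add: VP_iff)
  have s: "?s x \<in> VP (n + 1)" "realize (?s x) = double i (realize x)" if "x \<in> VP n" for x
    using cl [OF that] that by (auto simp: VP_iff bounded_closed realize_bounded pure_double)
  have mult: "x \<otimes>\<^bsub>VB m\<^esub> y \<in> VP m" "realize (x \<otimes>\<^bsub>VB m\<^esub> y) = realize x * realize y"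
    if "x \<in> VP m" "y \<in> VP m" for x y m
    using that subgroup.m_closed [OF subgroup_VP] by (auto simp: VP_iff realize_mult)
  have eqI: "x = y" if "x \<in> VP (n + 1)" "y \<in> VP (n + 1)" "realize x = realize y" for x y
    using that VB_eqI by (auto simp: VP_iff)
  have hom: "?s \<in> hom (VP_group n) (VP_group (n + 1))"
  proof (rule homI)
    fix x y assume "x \<in> carrier (VP_group n)" "y \<in> carrier (VP_group n)"
    then have xy: "x \<in> VP n" "y \<in> VP n" by auto
    have "realize (?s (x \<otimes>\<^bsub>VB n\<^esub> y)) = realize (?s x \<otimes>\<^bsub>VB (n + 1)\<^esub> ?s y)"
      using s(2) [OF mult(1) [OF xy]] mult(2) [OF s(1) s(1), OF xy] mult(2) [OF xy]
        s(2) [OF xy(1)] s(2) [OF xy(2)] xy(1) by (simp add: double_pure_mult VP_iff)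
    then show "?s (x \<otimes>\<^bsub>VP_group n\<^esub> y) = ?s x \<otimes>\<^bsub>VP_group (n + 1)\<^esub> ?s y"
      using eqI [OF s(1) [OF mult(1) [OF xy]] mult(1) [OF s(1) s(1), OF xy]] by simp
  qed (use s in auto)
  show "doubles_strand n i ?s"
    unfolding doubles_strand_def
  proof (intro conjI allI impI hom)
    fix k l assume kl: "1 \<le> k \<and> k < l \<and> l \<le> n"
    have L: "lam n k l \<in> VP n" "lam n l k \<in> VP n" "realize (lam n k l) = stable_lam k l"
      "realize (lam n l k) = stable_lam l k"
      using kl lam_VB by auto
    have L': "lam (n + 1) p q \<in> VP (n + 1)" "realize (lam (n + 1) p q) = stable_lam p q"
      if "p \<in> {k, k + 1, l, l + 1}" "q \<in> {k, k + 1, l, l + 1}" "p \<noteq> q" for p q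
      using that kl lam_VB [of p "n + 1" q] by auto
    show "?s (lam n k l) =
          (if i < k then lam (n + 1) (k + 1) (l + 1)
           else if i = k then lam (n + 1) k (l + 1) \<otimes>\<^bsub>VB (n + 1)\<^esub> lam (n + 1) (k + 1) (l + 1)
           else if i < l then lam (n + 1) k (l + 1)
           else if i = l then lam (n + 1) k (l + 1) \<otimes>\<^bsub>VB (n + 1)\<^esub> lam (n + 1) k l
           else lam (n + 1) k l)" (is "_ = ?r")
    proof (rule eqI [OF s(1) [OF L(1)]])
      show "?r \<in> VP (n + 1)" using L' mult kl by auto
      show "realize (?s (lam n k l)) = realize ?r"
        unfolding s(2) [OF L(1)] unfolding L(3) using L' mult kl double_stable_lam(1) [of k l i] by auto
    qed
    show "?s (lam n l k) =
          (if i < k then lam (n + 1) (l + 1) (k + 1)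
           else if i = k then lam (n + 1) (l + 1) (k + 1) \<otimes>\<^bsub>VB (n + 1)\<^esub> lam (n + 1) (l + 1) k
           else if i < l then lam (n + 1) (l + 1) k
           else if i = l then lam (n + 1) l k \<otimes>\<^bsub>VB (n + 1)\<^esub> lam (n + 1) (l + 1) k
           else lam (n + 1) l k)" (is "_ = ?r")
    proof (rule eqI [OF s(1) [OF L(2)]])
      show "?r \<in> VP (n + 1)" using L' mult kl by auto
      show "realize (?s (lam n l k)) = realize ?r"
        unfolding s(2) [OF L(2)] unfolding L(4) using L' mult kl double_stable_lam(2) [of k l i] by auto
    qed
  qed
qed

lemma doubles_strand_degeneracy: "r < n \<Longrightarrow> doubles_strand n (r + 1) (degeneracy n r)"
  unfolding degeneracy_def
  by (rule someI_ex [of "doubles_strand n (r + 1)"]) (rule doubles_strand_exists, auto)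

text \<open>The prescribed values determine a degeneracy map on this subgroup of \<open>VP n\<close>, and it contains the cabled
  generators.\<close>

definition lam_group :: "nat \<Rightarrow> vb_gen word set set" where
  "lam_group n = generate (VP_group n) {lam n k l | k l. k \<in> {1..n} \<and> l \<in> {1..n} \<and> k \<noteq> l}"

lemma group_VP: "group (VP_group n)"
  by (rule subgroup.subgroup_is_group [OF subgroup_VP group_VB])

lemma lam_group_VP: "lam_group n \<subseteq> VP n"
  using group.generate_incl [OF group_VP, of "{lam n k l | k l. k \<in> {1..n} \<and> l \<in> {1..n} \<and> k \<noteq> l}" n]
    lam_VB(1) by (auto simp: lam_group_def)

lemma subgroup_lam_group: "subgroup (lam_group n) (VP_group n)"
  unfolding lam_group_def
  by (rule group.generate_is_subgroup [OF group_VP]) (use lam_VB(1) in auto)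

lemma lam_in_lam_group:
  "k \<in> {1..n} \<Longrightarrow> l \<in> {1..n} \<Longrightarrow> k \<noteq> l \<Longrightarrow> lam n k l \<in> lam_group n"
  unfolding lam_group_def by (rule generate.incl) auto

lemma lam_group_mult: "x \<in> lam_group n \<Longrightarrow> y \<in> lam_group n \<Longrightarrow> x \<otimes>\<^bsub>VB n\<^esub> y \<in> lam_group n"
  using subgroup.m_closed [OF subgroup_lam_group] by simp

lemma group_hom_eq_on_generate:
  assumes f: "group_hom G H f" and g: "group_hom G H g" and S: "S \<subseteq> carrier G"
    and eq: "\<And>x. x \<in> S \<Longrightarrow> f x = g x" and x: "x \<in> generate G S"
  shows "f x = g x"
  using x
proof (induction rule: generate.induct)
  case one
  then show ?case using group_hom.hom_one [OF f] group_hom.hom_one [OF g] by simp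
next
  case (inv x)
  then show ?case using group_hom.hom_inv [OF f] group_hom.hom_inv [OF g] S eq by auto
next
  case (eng x y)
  have "group G" using f by (simp add: group_hom_def)
  then have "x \<in> carrier G" "y \<in> carrier G"
    using eng.hyps S group.generate_in_carrier by metis+
  then show ?case using eng.IH group_hom.hom_mult [OF f] group_hom.hom_mult [OF g] by simp
qed (rule eq)

text \<open>A chosen degeneracy map and the doubling operation are homomorphisms that agree on generators.\<close>

lemma doubles_strand_lam_group:
  assumes s: "doubles_strand n i s" and x: "x \<in> lam_group n"
  shows "s x \<in> lam_group (Suc n)" "realize (s x) = double i (realize x)"
proof -
  let ?S = "{lam n k l | k l. k \<in> {1..n} \<and> l \<in> {1..n} \<and> k \<noteq> l}"
  have hom: "s \<in> hom (VP_group n) (VP_group (n + 1))"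
    using s by (simp add: doubles_strand_def)
  have gh: "group_hom (VP_group n) (VP_group (n + 1)) s"
    using hom group_VP by (intro group_hom.intro group_hom_axioms.intro)
  have S: "?S \<subseteq> carrier (VP_group n)" using lam_VB(1) by auto
  have gens: "s y \<in> lam_group (Suc n) \<and> realize (s y) = double i (realize y)" if "y \<in> ?S" for y
  proof -
    from that obtain k l where kl: "1 \<le> k" "k < l" "l \<le> n" "y = lam n k l \<or> y = lam n l k"
      by (auto simp: nat_neq_iff)
    have L': "lam (n + 1) p q \<in> lam_group (Suc n)" "realize (lam (n + 1) p q) = stable_lam p q"
      "lam (n + 1) p q \<in> carrier (VB (n + 1))"
      if "p \<in> {k, k + 1, l, l + 1}" "q \<in> {k, k + 1, l, l + 1}" "p \<noteq> q" for p q
      using that kl lam_VB [of p "n + 1" q] lam_in_lam_group [of p "n + 1" q] by (auto simp: VP_iff)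
    have "realize (lam n k l) = stable_lam k l" "realize (lam n l k) = stable_lam l k"
      using kl lam_VB by auto
    moreover have
      "s (lam n k l) =
          (if i < k then lam (n + 1) (k + 1) (l + 1)
           else if i = k then lam (n + 1) k (l + 1) \<otimes>\<^bsub>VB (n + 1)\<^esub> lam (n + 1) (k + 1) (l + 1)
           else if i < l then lam (n + 1) k (l + 1)
           else if i = l then lam (n + 1) k (l + 1) \<otimes>\<^bsub>VB (n + 1)\<^esub> lam (n + 1) k l
           else lam (n + 1) k l)"
      "s (lam n l k) =
          (if i < k then lam (n + 1) (l + 1) (k + 1)
           else if i = k then lam (n + 1) (l + 1) (k + 1) \<otimes>\<^bsub>VB (n + 1)\<^esub> lam (n + 1) (l + 1) k
           else if i < l then lam (n + 1) (l + 1) k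
           else if i = l then lam (n + 1) l k \<otimes>\<^bsub>VB (n + 1)\<^esub> lam (n + 1) (l + 1) k
           else lam (n + 1) l k)"
      using s kl unfolding doubles_strand_def by blast+
    ultimately show ?thesis
      using kl L' lam_group_mult [of _ "Suc n"] double_stable_lam [of k l i]
      by (auto simp: realize_mult)
  qed
  have "s ` lam_group n = generate (VP_group (n + 1)) (s ` ?S)"
    unfolding lam_group_def using group_hom.generate_img [OF gh S] by simp
  also have "\<dots> \<subseteq> lam_group (Suc n)"
    using gens subgroup_lam_group [of "Suc n"]
    by (intro group.generate_subgroup_incl [OF group_VP]) auto
  finally show "s x \<in> lam_group (Suc n)" using x by blast
  have r: "group_hom (VP_group m) whole_group realize" for m
    using group_VP by (intro group_hom.intro group_hom_axioms.intro homI) (auto simp: VP_iff realize_mult)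
  have "group_hom (VP_group n) whole_group (\<lambda>x. realize (s x))"
    using group_hom.hom_mult [OF gh] group_hom.hom_closed [OF gh] group_VP
    by (intro group_hom.intro group_hom_axioms.intro homI) (auto simp: VP_iff realize_mult)
  moreover have "group_hom (VP_group n) whole_group (\<lambda>x. double i (realize x))"
    using group_VP
    by (intro group_hom.intro group_hom_axioms.intro homI)
      (auto simp: VP_iff realize_mult double_pure_mult)
  ultimately show "realize (s x) = double i (realize x)"
    using group_hom_eq_on_generate [OF _ _ S] gens x unfolding lam_group_def by blast
qed

lemma cabled_lam_group:
  assumes "g \<in> lam_group 2" "1 \<le> i" "1 \<le> j"
  shows "cabled g i j \<in> lam_group (i + j) \<and> realize (cabled g i j) = stable_cabled (realize g) i j"
  using assms
proof (induction g i j rule: cabled.induct)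
  case (1 g i j)
  have "doubles_strand (i + Suc j) (i + Suc j) (degeneracy (i + Suc j) (i + Suc j - 1))"
    using doubles_strand_degeneracy [of "i + j" "i + Suc j"] by simp
  from doubles_strand_lam_group [OF this, of "cabled g i (Suc j)"] show ?case using 1 by simp
next
  case ("2_1" g i)
  then show ?case by simp
next
  case ("2_2" g i)
  have "doubles_strand (Suc i + 1) 1 (degeneracy (Suc i + 1) 0)"
    using doubles_strand_degeneracy [of 0 "Suc i + 1"] by simp
  from doubles_strand_lam_group [OF this, of "cabled g (Suc i) 1"] show ?case using "2_2" by simp
qed (simp_all add: numeral_2_eq_2)

text \<open>Both families of cables are cabled from \<open>\<lambda>\<^bsub>12\<^esub>\<close> and \<open>\<lambda>\<^bsub>21\<^esub>\<close> by homomorphisms, so their product is cabled from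
  \<open>\<lambda>\<^bsub>21\<^esub> \<lambda>\<^bsub>12\<^esub> = \<sigma>\<^sub>1\<^sup>-\<^sup>2\<close>.\<close>

lemma cable_c_VB:
  assumes "1 \<le> i" "1 \<le> j"
  shows "cable_c i j \<in> carrier (VB (i + j))" "realize (cable_c i j) = stable_cable i j"
proof -
  have g: "lam 2 1 2 \<in> lam_group 2" "lam 2 2 1 \<in> lam_group 2"
    by (auto intro: lam_in_lam_group)
  have r: "realize (lam 2 1 2) = stable_lam 1 2" "realize (lam 2 2 1) = stable_lam 2 1"
    by (auto intro: lam_VB(2))
  have "cable_a i j \<in> VP (i + j)" "cable_b i j \<in> VP (i + j)"
    using cabled_lam_group [OF g(1) assms] cabled_lam_group [OF g(2) assms] lam_group_VP
    by (auto simp: cable_a_def cable_b_def)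
  then have c: "cable_a i j \<in> carrier (VB (i + j))" "cable_b i j \<in> carrier (VB (i + j))"
    by (auto simp: VP_iff)
  then show "cable_c i j \<in> carrier (VB (i + j))"
    by (simp add: cable_c_def)
  have "realize (cable_c i j) = stable_cabled (stable_lam 2 1) i j * stable_cabled (stable_lam 1 2) i j"
    using c cabled_lam_group [OF g(1) assms] cabled_lam_group [OF g(2) assms]
    by (simp add: cable_c_def realize_mult cable_a_def cable_b_def r del: One_nat_def)
  also have "\<dots> = stable_cabled (stable_lam 2 1 * stable_lam 1 2) i j"
    by (rule stable_cabled_mult [symmetric]) (auto intro: stable_lam_pure)
  finally show "realize (cable_c i j) = stable_cable i j" by (simp only: stable_lam_21_12 stable_cable_def)
qed

subsection \<open>The theorem\<close>

lemma cable_c_in_VB: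
  assumes "1 \<le> k" "k \<le> n" "j \<in> {1..n - k}"
  shows "cable_c_in n k j \<in> carrier (VB n)" "realize (cable_c_in n k j) = stable_cable k j"
  using assms cable_c_VB [of k j] vb_incl [of "cable_c k j" "k + j" n]
  by (auto simp: cable_c_in_def)

lemma cable_c_in_closed:
  "1 \<le> k \<Longrightarrow> k \<le> n \<Longrightarrow> cable_c_in n k ` {1..n - k} \<subseteq> carrier (VB n)"
  using cable_c_in_VB by blast

lemma V_closed: "1 \<le> k \<Longrightarrow> k \<le> n \<Longrightarrow> V n k \<subseteq> carrier (VB n)"
  unfolding V_def by (rule group.generate_incl [OF group_VB cable_c_in_closed])

lemma realize_V: "1 \<le> k \<Longrightarrow> k \<le> n \<Longrightarrow> realize ` V n k = stable_V n k"
proof -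
  assume k: "1 \<le> k" "k \<le> n"
  have "realize ` cable_c_in n k ` {1..n - k} = stable_cable k ` {1..n - k}"
    unfolding image_image by (rule image_cong) (use k cable_c_in_VB in auto)
  then show ?thesis
    using group_hom.generate_img [OF group_hom_realize cable_c_in_closed [OF k]]
    by (simp add: V_def stable_V_def)
qed

theorem theorem6p3:
  fixes n :: nat
  assumes "n \<ge> 3"
  shows "iterated_semidirect (VB n) (map (V n) [1..<n]) (pure_braids n) \<and>
    (\<forall>k\<in>{1..<n}. free_basis ((VB n)\<lparr>carrier := V n k\<rparr>) {1..n - k} (cable_c_in n k))"
proof (intro conjI ballI)
  have "stable_pure n \<subseteq> span (vb_gens n)"
    unfolding realize_pure_braids [symmetric] realize_span [symmetric]
    by (intro image_mono pure_braids_closed)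
  then have "iterated_semidirect (VB n) (map (image (bounded n)) (map (stable_V n) [1..<n])) (bounded n ` stable_pure n)"
    using assms stable_pure_iterated [of n]
    by (intro iterated_semidirect_image [OF group_whole_group group_VB subgroup_span bounded_hom
          inj_bounded]) auto
  moreover have "bounded n ` stable_pure n = pure_braids n"
    using bounded_image [OF pure_braids_closed] by (simp add: realize_pure_braids)
  moreover have "map (image (bounded n)) (map (stable_V n) [1..<n]) = map (V n) [1..<n]"
  proof -
    have "bounded n ` stable_V n k = V n k" if "k \<in> {1..<n}" for k
      using bounded_image [OF V_closed, of k n] realize_V [of k n] that by simp
    then show ?thesis by simp
  qed
  ultimately show "iterated_semidirect (VB n) (map (V n) [1..<n]) (pure_braids n)" by (simp only:)
next
  fix k assume "k \<in> {1..<n}"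
  then have k: "1 \<le> k" "k \<le> n" by auto
  note closed = cable_c_in_closed [OF k]
  show "free_basis ((VB n)\<lparr>carrier := V n k\<rparr>) {1..n - k} (cable_c_in n k)"
    unfolding V_def
  proof (rule group.free_basisI [OF group_VB closed])
    fix w :: "nat word" assume w: "w \<in> words {1..n - k}" "eval_word (VB n) (cable_c_in n k) w = \<one>\<^bsub>VB n\<^esub>"
    have "eval_word whole_group (stable_cable k) w
        = eval_word whole_group (\<lambda>j. realize (cable_c_in n k j)) w"
      using k cable_c_in_VB w(1) by (intro eval_word_eqI) auto
    also have "\<dots> = realize (eval_word (VB n) (cable_c_in n k) w)"
      using group_hom.eval_word_hom [OF group_hom_realize closed w(1)] by simp
    finally show "word_eq {1..n - k} {} w []"
      using stable_cable_free [OF k w(1)] w(2) by (simp add: realize_one)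
  qed
qed

end
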